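(* Let $n\geq 1$, let $a$ be a non-zero element of $\mathbb{C}^{2n}$ (a row vector) and let $A=a^t a\in\mathbb{C}^{2n\times 2n}$. Let $\phi_a:\mathbf{Sp}(n)/\mathbf{U}(n)\to\mathbb{C}$ be the complex-valued eigenfunction induced by its $\mathbf{U}(n)$-invariant lift $\hat\phi_a:\mathbf{Sp}(n)\to\mathbb{C}$ given by $$\hat\phi_a(q)=\operatorname{trace}(A\, q\, q^t).$$ Then the origin $0\in\mathbb{C}$ is a regular value of $\phi_a$, so the compact fibre $\phi_a^{-1}(\{0\})$ is a minimal submanifold of $\mathbf{Sp}(n)/\mathbf{U}(n)$ of codimension two.
   Context: Elements of $\mathbb{C}^{2n}$ are written as row vectors and $q^t$ denotes the transpose (without conjugation). $\mathbf{Sp}(n)$ is the subgroup of $\mathbf{U}(2n)$ consisting of the unitary matrices of the form $$q=\begin{bmatrix} z & w\\ -\bar w & \bar z\end{bmatrix},\qquad z,w\in\mathbb{C}^{n\times n}.$$ Here $\mathbf{U}(n)$ is identified with the subgroup of $\mathbf{Sp}(n)$ $$\Big\{\begin{bmatrix} x & y\\ -y & x\end{bmatrix}\in\mathbb{R}^{2n\times 2n}\ \Big|\ xx^t+yy^t=I_n,\ xy^t=yx^t\Big\}.$$ $\mathbf{Sp}(n)$ carries the bi-invariant Riemannian metric induced by the inner product $g(Z,W)=\mathfrak{Re}\,\operatorname{trace}(Z\bar W^t)$ on its Lie algebra (as a subalgebra of $\mathbb{C}^{2n\times 2n}$), and $\mathbf{Sp}(n)/\mathbf{U}(n)$ (the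 space of cosets $q\,\mathbf{U}(n)$) carries the Riemannian symmetric metric for which the natural projection $\pi:\mathbf{Sp}(n)\to\mathbf{Sp}(n)/\mathbf{U}(n)$ is a Riemannian submersion. Since $\hat\phi_a(qk)=\hat\phi_a(q)$ for all $k\in\mathbf{U}(n)$, there is a unique function $\phi_a$ with $\hat\phi_a=\phi_a\circ\pi$; this is the function induced by $\hat\phi_a$. A complex-valued function $\phi$ on a Riemannian manifold $(M,g)$ is an eigenfunction if there exist $\lambda,\mu\in\mathbb{C}$ with $\tau(\phi)=\lambda\,\phi$ and $\kappa(\phi,\phi)=\mu\,\phi^2$, where $\tau(\phi)=\operatorname{div}(\nabla\phi)$ is the Laplace-Beltrami operator and $\kappa(\phi,\psi)=g(\nabla\phi,\nabla\psi)$, with $g$ extended complex bilinearly to the complexified tangent bundle. That $\phi_a$ is an eigenfunction is a previously known fact presupposed in the statement. A submanifold is minimal if its mean curvature vector field vanishes identically. Regular value is meant for $\phi_a$ as a smooth map into $\mathbb{C}\cong\mathbb{R}^2$. *)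

theory Defs
  imports "HOL-Analysis.Analysis"
begin

section \<open>Smooth maps and tangent spaces in Euclidean spaces\<close>

text \<open>Both notions below are meant for an open set \<open>S\<close>.\<close>

primrec Ck_on :: "nat \<Rightarrow> 'a::real_normed_vector set \<Rightarrow> ('a \<Rightarrow> 'b::real_normed_vector) \<Rightarrow> bool" where
  "Ck_on 0 S f \<longleftrightarrow> continuous_on S f"
| "Ck_on (Suc k) S f \<longleftrightarrow> (\<forall>x\<in>S. f differentiable (at x)) \<and>
     (\<forall>v. Ck_on k S (\<lambda>x. frechet_derivative f (at x) v))"

definition smooth_on :: "'a::real_normed_vector set \<Rightarrow> ('a \<Rightarrow> 'b::real_normed_vector) \<Rightarrow> bool" where
  "smooth_on S f \<longleftrightarrow> (\<forall>k. Ck_on k S f)"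

text \<open>Smoothness on an arbitrary subset (in practice an embedded submanifold) of a Euclidean
  space: local extendability to smooth maps on open sets.\<close>

definition smooth_on_subset :: "'a::real_normed_vector set \<Rightarrow> ('a \<Rightarrow> 'b::real_normed_vector) \<Rightarrow> bool" where
  "smooth_on_subset S f \<longleftrightarrow>
     (\<forall>x\<in>S. \<exists>V F. open V \<and> x \<in> V \<and> smooth_on V F \<and> (\<forall>y\<in>S \<inter> V. F y = f y))"

definition tangent_space :: "'a::real_normed_vector set \<Rightarrow> 'a \<Rightarrow> 'a set" where
  "tangent_space S x = {v. \<exists>\<gamma> \<epsilon>. \<epsilon> > 0 \<and> smooth_on {-\<epsilon><..<\<epsilon>} \<gamma> \<and> \<gamma> ` {-\<epsilon><..<\<epsilon>} \<subseteq> S \<and>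
     \<gamma> (0::real) = x \<and> (\<gamma> has_vector_derivative v) (at 0)}"


section \<open>Submanifolds in a coordinate domain with a Riemannian metric\<close>

text \<open>Here \<open>h x u v\<close> is the value at the point \<open>x\<close> of a Riemannian metric on an open subset of
  the Euclidean space \<open>'e\<close>. The Levi-Civita connection is
  \<open>\<nabla>\<^sub>u Y = DY(u) + \<Gamma>(u,Y)\<close>, with \<open>\<Gamma>\<close> determined by the Koszul formula for constant
  vector fields.\<close>

type_synonym 'e metric = "'e \<Rightarrow> 'e \<Rightarrow> 'e \<Rightarrow> real"

definition metric_deriv :: "'e::euclidean_space metric \<Rightarrow> 'e \<Rightarrow> 'e \<Rightarrow> 'e \<Rightarrow> 'e \<Rightarrow> real" where
  "metric_deriv h x w u v = frechet_derivative (\<lambda>y. h y u v) (at x) w"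

definition christoffel :: "'e::euclidean_space metric \<Rightarrow> 'e \<Rightarrow> 'e \<Rightarrow> 'e \<Rightarrow> 'e" where
  "christoffel h x u v = (THE z. \<forall>w. h x z w =
     (metric_deriv h x u v w + metric_deriv h x v u w - metric_deriv h x w u v) / 2)"

definition cov_deriv :: "'e::euclidean_space metric \<Rightarrow> ('e \<Rightarrow> 'e) \<Rightarrow> 'e \<Rightarrow> 'e \<Rightarrow> 'e" where
  "cov_deriv h Y x u = frechet_derivative Y (at x) u + christoffel h x u (Y x)"

definition normal_part :: "'e::euclidean_space metric \<Rightarrow> 'e \<Rightarrow> 'e set \<Rightarrow> 'e \<Rightarrow> 'e" where
  "normal_part h x T w = (THE z. (\<forall>v\<in>T. h x z v = 0) \<and> w - z \<in> T)"

text \<open>\<open>B(u,v) = (\<nabla>\<^sub>u Y)\<^sup>\<bottom>\<close> for tangent vectors \<open>u, v\<close> of \<open>S\<close> at \<open>x\<close>, where \<open>Y\<close> is any local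
  vector field in the ambient space that is tangent to \<open>S\<close> along \<open>S\<close> and has the value \<open>v\<close>
  at \<open>x\<close>. The result does not depend on \<open>Y\<close>.\<close>

definition second_fundamental_form ::
    "'e::euclidean_space metric \<Rightarrow> 'e set \<Rightarrow> 'e \<Rightarrow> 'e \<Rightarrow> 'e \<Rightarrow> 'e" where
  "second_fundamental_form h S x u v = (THE b. \<exists>V Y. open V \<and> x \<in> V \<and> smooth_on V Y \<and>
     (\<forall>y\<in>S \<inter> V. Y y \<in> tangent_space S y) \<and> Y x = v \<and>
     b = normal_part h x (tangent_space S x) (cov_deriv h Y x u))"

definition orthonormal_basis :: "'e::euclidean_space metric \<Rightarrow> 'e \<Rightarrow> 'e set \<Rightarrow> 'e set \<Rightarrow> bool" where
  "orthonormal_basis h x T E \<longleftrightarrow> finite E \<and> E \<subseteq> T \<and> T \<subseteq> span E \<and>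
     (\<forall>e\<in>E. \<forall>f\<in>E. h x e f = (if e = f then 1 else 0))"

text \<open>The trace of the second fundamental form, without the factor \<open>1 / dim S\<close>: this does not
  affect its vanishing and is meaningful when \<open>S\<close> is zero-dimensional.\<close>

definition mean_curvature :: "'e::euclidean_space metric \<Rightarrow> 'e set \<Rightarrow> 'e \<Rightarrow> 'e" where
  "mean_curvature h S x = (THE H. \<exists>E. orthonormal_basis h x (tangent_space S x) E \<and>
     H = (\<Sum>e\<in>E. second_fundamental_form h S x e e))"


section \<open>Manifolds given by an atlas\<close>

text \<open>A chart is a domain together with a coordinate map. A Riemannian metric on the manifold is
  given by its expression in every chart of the atlas.\<close>

type_synonym ('p, 'e) chart = "'p set \<times> ('p \<Rightarrow> 'e)"

definition smooth_map :: "('p, 'e::euclidean_space) chart set \<Rightarrow> ('p \<Rightarrow> 'b::real_normed_vector) \<Rightarrow> bool" where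
  "smooth_map \<A> f \<longleftrightarrow> (\<forall>(U, c)\<in>\<A>. smooth_on (c ` U) (f \<circ> inv_into U c))"

definition regular_value ::
    "('p, 'e::euclidean_space) chart set \<Rightarrow> 'p set \<Rightarrow> ('p \<Rightarrow> 'b::real_normed_vector) \<Rightarrow> 'b \<Rightarrow> bool" where
  "regular_value \<A> M f z \<longleftrightarrow> smooth_map \<A> f \<and>
     (\<forall>p\<in>M. f p = z \<longrightarrow> (\<forall>(U, c)\<in>\<A>. p \<in> U \<longrightarrow>
        surj (frechet_derivative (f \<circ> inv_into U c) (at (c p)))))"

text \<open>Embedded submanifolds, by slice charts around all of their points. The atlas is meant to
  be maximal.\<close>

definition submanifold_of_codim ::
    "('p, 'e::euclidean_space) chart set \<Rightarrow> 'p set \<Rightarrow> nat \<Rightarrow> 'p set \<Rightarrow> bool" where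
  "submanifold_of_codim \<A> M k N \<longleftrightarrow> N \<subseteq> M \<and>
     (\<forall>p\<in>N. \<exists>(U, c)\<in>\<A>. p \<in> U \<and>
        (\<exists>L. subspace L \<and> dim L + k = DIM('e) \<and> c ` (U \<inter> N) = c ` U \<inter> L))"

definition minimal ::
    "('p, 'e::euclidean_space) chart set \<Rightarrow> (('p, 'e) chart \<Rightarrow> 'e metric) \<Rightarrow> 'p set \<Rightarrow> bool" where
  "minimal \<A> g N \<longleftrightarrow>
     (\<forall>p\<in>N. \<forall>(U, c)\<in>\<A>. p \<in> U \<longrightarrow> mean_curvature (g (U, c)) (c ` (U \<inter> N)) (c p) = 0)"

definition quotient_topology :: "'a topology \<Rightarrow> ('a \<Rightarrow> 'b) \<Rightarrow> 'b topology" where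
  "quotient_topology X f =
     topology (\<lambda>U. U \<subseteq> f ` topspace X \<and> openin X {x \<in> topspace X. f x \<in> U})"

lemma openin_quotient_topology:
  "openin (quotient_topology X f) U \<longleftrightarrow>
     U \<subseteq> f ` topspace X \<and> openin X {x \<in> topspace X. f x \<in> U}"
proof -
  have "istopology (\<lambda>U. U \<subseteq> f ` topspace X \<and> openin X {x \<in> topspace X. f x \<in> U})"
    unfolding istopology_def
  proof (intro conjI allI impI; (elim conjE)?)
    fix S T assume "openin X {x \<in> topspace X. f x \<in> S}" "openin X {x \<in> topspace X. f x \<in> T}"
    then have "openin X ({x \<in> topspace X. f x \<in> S} \<inter> {x \<in> topspace X. f x \<in> T})"
      by blast
    also have "{x \<in> topspace X. f x \<in> S} \<inter> {x \<in> topspace X. f x \<in> T} =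
      {x \<in> topspace X. f x \<in> S \<inter> T}" by blast
    finally show "openin X {x \<in> topspace X. f x \<in> S \<inter> T}" .
  next
    fix K assume K: "\<forall>S\<in>K. S \<subseteq> f ` topspace X \<and> openin X {x \<in> topspace X. f x \<in> S}"
    then have "openin X (\<Union>S\<in>K. {x \<in> topspace X. f x \<in> S})" by blast
    also have "(\<Union>S\<in>K. {x \<in> topspace X. f x \<in> S}) = {x \<in> topspace X. f x \<in> \<Union>K}" by blast
    finally show "openin X {x \<in> topspace X. f x \<in> \<Union>K}" .
  qed blast+
  then show ?thesis by (simp add: quotient_topology_def)
qed


section \<open>The groups \<open>Sp(n)\<close> and \<open>U(n)\<close>\<close>

text \<open>The index type \<open>'n + 'n\<close> of cardinality \<open>2n\<close> carries the block decomposition.\<close>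

type_synonym 'n cmat2 = "complex ^ ('n + 'n) ^ ('n + 'n)"

definition block :: "'a ^ 'n ^ 'n \<Rightarrow> 'a ^ 'n ^ 'n \<Rightarrow> 'a ^ 'n ^ 'n \<Rightarrow> 'a ^ 'n ^ 'n \<Rightarrow>
    'a ^ ('n::finite + 'n) ^ ('n + 'n)" where
  "block A B C D = (\<chi> i j. case i of
       Inl k \<Rightarrow> (case j of Inl l \<Rightarrow> A $ k $ l | Inr l \<Rightarrow> B $ k $ l)
     | Inr k \<Rightarrow> (case j of Inl l \<Rightarrow> C $ k $ l | Inr l \<Rightarrow> D $ k $ l))"

definition unitary :: "complex ^ 'm ^ 'm::finite \<Rightarrow> bool" where
  "unitary q \<longleftrightarrow> q ** transpose (map_matrix cnj q) = mat 1 \<and> transpose (map_matrix cnj q) ** q = mat 1"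

definition Sp :: "'n::finite cmat2 set" where
  "Sp = {q. unitary q \<and> (\<exists>z w. q = block z w (- map_matrix cnj w) (map_matrix cnj z))}"

definition Ugroup :: "'n::finite cmat2 set" where
  "Ugroup = {map_matrix complex_of_real (block x y (- y) x) | x y.
      x ** transpose x + y ** transpose y = mat 1 \<and> x ** transpose y = y ** transpose x}"

definition sp_inner :: "'n::finite cmat2 \<Rightarrow> 'n cmat2 \<Rightarrow> real" where
  "sp_inner Z W = Re (trace (Z ** transpose (map_matrix cnj W)))"

text \<open>The left-invariant extension of this inner product; it is bi-invariant.\<close>

definition Sp_metric :: "'n::finite cmat2 \<Rightarrow> 'n cmat2 \<Rightarrow> 'n cmat2 \<Rightarrow> real" where
  "Sp_metric q X Y = sp_inner (matrix_inv q ** X) (matrix_inv q ** Y)"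


section \<open>The symmetric space \<open>Sp(n)/U(n)\<close>\<close>

definition proj :: "'n::finite cmat2 \<Rightarrow> 'n cmat2 set" where
  "proj q = {q ** k | k. k \<in> Ugroup}"

definition SpU :: "'n::finite cmat2 set set" where
  "SpU = proj ` Sp"

definition SpU_topology :: "'n::finite cmat2 set topology" where
  "SpU_topology = quotient_topology (top_of_set Sp) proj"

text \<open>Coordinates take values in a Euclidean space of dimension
  \<open>n\<^sup>2 + n = dim Sp(n) - dim U(n)\<close>.\<close>

type_synonym 'n model = "(real ^ 'n ^ 'n) \<times> (real ^ 'n)"

lemma DIM_model: "DIM('n::finite model) = CARD('n) * (CARD('n) + 1)"
  by simp

text \<open>The differential at \<open>q\<close> of the expression of the projection in the coordinates \<open>c\<close>. The
  derivative within \<open>Sp\<close> is determined (only) on the vectors tangent to \<open>Sp\<close> at \<open>q\<close>.\<close>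

definition dproj :: "('n::finite cmat2 set \<Rightarrow> 'n model) \<Rightarrow> 'n cmat2 \<Rightarrow> 'n cmat2 \<Rightarrow> 'n model" where
  "dproj c q = frechet_derivative (c \<circ> proj) (at q within Sp)"

text \<open>The maximal atlas of the unique smooth structure for which the projection is a smooth
  submersion: a homeomorphism onto an open set belongs to it iff its composition with the projection
  is a smooth submersion.\<close>

definition SpU_atlas :: "('n::finite cmat2 set, 'n model) chart set" where
  "SpU_atlas = {(U, c). openin SpU_topology U \<and> open (c ` U) \<and>
     homeomorphic_map (subtopology SpU_topology U) (top_of_set (c ` U)) c \<and>
     smooth_on_subset {q \<in> Sp. proj q \<in> U} (c \<circ> proj) \<and>
     (\<forall>q\<in>Sp. proj q \<in> U \<longrightarrow> dproj c q ` tangent_space Sp q = UNIV)}"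

text \<open>The kernel of the differential of the projection at \<open>q\<close> is the tangent space of the
  coset \<open>proj q\<close>, so the following is its orthogonal complement.\<close>

definition horizontal :: "'n::finite cmat2 \<Rightarrow> 'n cmat2 set" where
  "horizontal q = {X \<in> tangent_space Sp q. \<forall>V\<in>tangent_space (proj q) q. Sp_metric q X V = 0}"

text \<open>The metric for which the projection is a Riemannian submersion, that is, for which its
  differential is isometric on horizontal vectors. By right invariance of \<open>Sp_metric\<close> under
  \<open>U(n)\<close> the value does not depend on the representative \<open>q\<close>.\<close>

definition SpU_metric :: "('n::finite cmat2 set, 'n model) chart \<Rightarrow> 'n model metric" where
  "SpU_metric = (\<lambda>(U, c) x u v. THE r. \<exists>q X Y. q \<in> Sp \<and> proj q \<in> U \<and> c (proj q) = x \<and>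
     X \<in> horizontal q \<and> Y \<in> horizontal q \<and> dproj c q X = u \<and> dproj c q Y = v \<and>
     r = Sp_metric q X Y)"


section \<open>The function \<open>\<phi>\<^sub>a\<close>\<close>

definition phi_hat :: "complex ^ ('n + 'n) \<Rightarrow> 'n::finite cmat2 \<Rightarrow> complex" where
  "phi_hat a q = (let A = transpose (rowvector a :: complex ^ ('n + 'n) ^ 1) ** rowvector a
                  in trace (A ** q ** transpose q))"

definition phi :: "complex ^ ('n + 'n) \<Rightarrow> 'n::finite cmat2 set \<Rightarrow> complex" where
  "phi a C = the_elem (phi_hat a ` C)"

lemma sum_Plus_UNIV:
  fixes f :: "'a::finite + 'b::finite \<Rightarrow> 'c::comm_monoid_add"
  shows "(\<Sum>i\<in>UNIV. f i) = (\<Sum>k\<in>UNIV. f (Inl k)) + (\<Sum>k\<in>UNIV. f (Inr k))"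
  using sum.Plus[of "UNIV :: 'a set" "UNIV :: 'b set" f] by (simp add: comp_def)

lemma block_nth [simp]:
  "block A B C D $ Inl k $ Inl l = A $ k $ l"
  "block A B C D $ Inl k $ Inr l = B $ k $ l"
  "block A B C D $ Inr k $ Inl l = C $ k $ l"
  "block A B C D $ Inr k $ Inr l = D $ k $ l"
  by (simp_all add: block_def)

lemma Ugroup_orthogonal:
  fixes k :: "'n::finite cmat2"
  assumes "k \<in> Ugroup"
  shows "k ** transpose k = mat 1"
proof -
  obtain x y :: "real ^ 'n ^ 'n" where k: "k = map_matrix complex_of_real (block x y (- y) x)"
    and 1: "x ** transpose x + y ** transpose y = mat 1" and 2: "x ** transpose y = y ** transpose x"
    using assms unfolding Ugroup_def by blast
  have e1: "(\<Sum>l\<in>UNIV. x $ i $ l * x $ j $ l) + (\<Sum>l\<in>UNIV. y $ i $ l * y $ j $ l) =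
      (if i = j then 1 else 0)" for i j
    using arg_cong[OF 1, of "\<lambda>A. A $ i $ j"]
    by (simp add: matrix_matrix_mult_def transpose_def mat_def)
  have e2: "(\<Sum>l\<in>UNIV. x $ i $ l * y $ j $ l) = (\<Sum>l\<in>UNIV. y $ i $ l * x $ j $ l)" for i j
    using arg_cong[OF 2, of "\<lambda>A. A $ i $ j"]
    by (simp add: matrix_matrix_mult_def transpose_def)
  let ?r = "block x y (- y) x"
  have r: "(\<Sum>l\<in>UNIV. ?r $ i $ l * ?r $ j $ l) = (if i = j then 1 else 0)" for i j
  proof (cases i; cases j)
    fix i' j' assume "i = Inr i'" "j = Inr j'"
    then show ?thesis using e1[of i' j'] by (simp add: sum_Plus_UNIV)
  qed (simp_all add: sum_Plus_UNIV sum_negf e1 e2)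
  have "(\<Sum>l\<in>UNIV. k $ i $ l * k $ j $ l) = complex_of_real (\<Sum>l\<in>UNIV. ?r $ i $ l * ?r $ j $ l)" for i j
    by (simp add: k)
  then show ?thesis
    unfolding r by (simp add: matrix_matrix_mult_def transpose_def mat_def vec_eq_iff)
qed

lemma one_in_Ugroup: "(mat 1 :: 'n::finite cmat2) \<in> Ugroup"
proof -
  have "(mat 1 :: 'n cmat2) $ i $ j =
      map_matrix complex_of_real (block (mat 1) 0 (- 0) (mat 1)) $ i $ j" for i j
    by (cases i; cases j) (simp_all add: mat_def)
  then have "(mat 1 :: 'n cmat2) = map_matrix complex_of_real (block (mat 1) 0 (- 0) (mat 1))"
    by (metis vec_eq_iff)
  moreover have "(mat 1 :: real ^ 'n ^ 'n) ** transpose (mat 1) + 0 ** transpose 0 = mat 1"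
    "(mat 1 :: real ^ 'n ^ 'n) ** transpose 0 = 0 ** transpose (mat 1)"
    by (simp_all add: transpose_mat) (simp_all add: vec_eq_iff matrix_matrix_mult_def transpose_def)
  ultimately show ?thesis
    unfolding Ugroup_def by blast
qed

lemma phi_proj: "phi a (proj q) = phi_hat a q"
proof -
  have "phi_hat a (q ** k) = phi_hat a q" if "k \<in> Ugroup" for k
  proof -
    have "(q ** k) ** transpose (q ** k) = q ** (k ** transpose k) ** transpose q"
      by (simp add: matrix_transpose_mul matrix_mul_assoc)
    then show ?thesis
      by (simp add: phi_hat_def Let_def Ugroup_orthogonal[OF that] flip: matrix_mul_assoc)
  qed
  then have "phi_hat a ` proj q = {phi_hat a q}"
    using one_in_Ugroup by (fastforce simp: proj_def image_iff)
  then show ?thesis by (simp add: phi_def)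
qed

end

theory Submission
  imports Defs
begin

text \<open>The map \<open>q U(n) \<mapsto> P = q q\<^sup>t\<close> embeds \<open>Sp(n)/U(n)\<close> into the complex matrices. It multiplies the metric
  by four, and it turns \<open>\<phi>\<^sub>a\<close> into the linear function \<open>P \<mapsto> a P a\<^sup>t\<close>. The tangent space at \<open>P\<close> consists of
  the matrices \<open>q X q\<^sup>t\<close> with \<open>X\<close> in the space \<open>\<pp>\<close> of purely imaginary elements of the Lie algebra, and
  differentiating \<open>P cj P = 1\<close> twice shows that the second fundamental form of the image is \<open>q X\<^sup>2 q\<^sup>t\<close>.
  With \<open>b = a q\<close> the function vanishes iff \<open>b\<close> is isotropic, \<open>b b\<^sup>t = 0\<close>; its differential is \<open>X \<mapsto> b X b\<^sup>t\<close>,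
  and its Hessian is \<open>X \<mapsto> b X\<^sup>2 b\<^sup>t\<close>.

  Let \<open>G\<close> be the projection of \<open>b\<^sup>t b\<close> to the complexification of \<open>\<pp>\<close>, that is, the complex gradient. If \<open>b\<close>
  is isotropic, then \<open>G b\<^sup>t = 0\<close>, whereas \<open>G\<close> pairs to a positive number with its conjugate. This gives
  surjectivity of the differential. Moreover the trace of the Hessian over \<open>\<pp>\<close> and its trace over the
  span of the real and imaginary parts of \<open>G\<close> both vanish, hence so does the trace over the tangent space
  of the fibre, which is the mean curvature up to the differential of \<open>\<phi>\<^sub>a\<close>, injective on normal vectors.

  As \<open>\<phi>\<^sub>a\<close> is linear in \<open>P\<close>, slice charts are restrictions of suitable linear maps to the image.\<close>

section \<open>Calculus of smooth maps\<close>

text \<open>Christoffel symbols, normal parts, second fundamental forms, mean curvature and the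
  quotient metric are definite descriptions, in arbitrary charts of a maximal atlas: each must be
  shown to exist and be unique before it can be used. The immersion makes this cheap. For a multiple
  of a pulled back metric, Koszul's formula says that the Christoffel symbol is the tangential part
  of the second derivative, and the other objects come from orthogonal decompositions in the ambient
  space.

  The differential of the projection is a derivative within \<open>Sp\<close>, meaningful on tangent
  vectors only. Curves in \<open>Sp\<close> pin it down; they come from the Cayley transform, which
  is rational, so that its smoothness reduces to that of inversion. The factor four is the square of
  2, the number of equal terms that the product rule gives for the derivative of q q^t along a
  horizontal vector.

  The delicate point of the slice charts is injectivity on a full neighbourhood of cosets. The
  inverse function theorem separates the points of a Cayley section, but a coset whose image is
  close by might a priori miss the section. A secant estimate excludes this.\<close>

abbreviation D :: "('a::real_normed_vector \<Rightarrow> 'b::real_normed_vector) \<Rightarrow> 'a \<Rightarrow> 'a \<Rightarrow> 'b" where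
  "D f x \<equiv> frechet_derivative f (at x)"

lemma D_eqI: "(f has_derivative f') (at x) \<Longrightarrow> D f x = f'"
  by (metis frechet_derivative_at)

lemma D_cong:
  assumes "open S" "x \<in> S" "\<And>y. y \<in> S \<Longrightarrow> f y = g y"
  shows "D f x = D g x"
proof -
  have "(f has_derivative f') (at x) \<longleftrightarrow> (g has_derivative f') (at x)" for f'
    using assms by (metis has_derivative_transform_within_open)
  then show ?thesis by (simp add: frechet_derivative_def)
qed

lemma differentiable_cong_open:
  assumes "open S" "x \<in> S" "\<And>y. y \<in> S \<Longrightarrow> f y = g y"
  shows "f differentiable at x \<longleftrightarrow> g differentiable at x"
  using assms unfolding differentiable_def by (metis has_derivative_transform_within_open)

lemma Ck_on_cong:
  assumes "open S" "\<And>y. y \<in> S \<Longrightarrow> f y = g y"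
  shows "Ck_on k S f \<longleftrightarrow> Ck_on k S g"
  using assms(2)
proof (induction k arbitrary: f g)
  case 0
  then show ?case by (simp cong: continuous_on_cong)
next
  case (Suc k)
  have "D f y v = D g y v" if "y \<in> S" for y v
    using D_cong[OF assms(1) that, of f g] Suc.prems by simp
  then have "Ck_on k S (\<lambda>x. D f x v) \<longleftrightarrow> Ck_on k S (\<lambda>x. D g x v)" for v
    by (intro Suc.IH)
  moreover have "f differentiable at y \<longleftrightarrow> g differentiable at y" if "y \<in> S" for y
    using differentiable_cong_open[OF assms(1) that, of f g] Suc.prems by simp
  ultimately show ?case by simp
qed

lemma Ck_on_subset: "Ck_on k S f \<Longrightarrow> T \<subseteq> S \<Longrightarrow> Ck_on k T f"
  by (induction k arbitrary: f) (auto intro: continuous_on_subset)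

lemma Ck_on_local:
  assumes "\<And>x. x \<in> S \<Longrightarrow> \<exists>V. open V \<and> x \<in> V \<and> Ck_on k V f"
  shows "Ck_on k S f"
  using assms
proof (induction k arbitrary: f)
  case 0
  then show ?case
    by (auto intro!: continuous_at_imp_continuous_on)
       (metis continuous_on_eq_continuous_at)
next
  case (Suc k)
  have "Ck_on k S (\<lambda>x. D f x v)" for v
    by (rule Suc.IH) (use Suc.prems in fastforce)
  moreover have "f differentiable at x" if "x \<in> S" for x
    using Suc.prems[OF that] by auto
  ultimately show ?case by simp
qed

lemma Ck_on_imp_continuous_on: "Ck_on k S f \<Longrightarrow> continuous_on S f"
  by (cases k) (auto intro!: continuous_at_imp_continuous_on differentiable_imp_continuous_within)

lemma Ck_on_SucD: "Ck_on (Suc k) S f \<Longrightarrow> Ck_on k S f"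
proof (induction k arbitrary: f)
  case 0
  then show ?case using Ck_on_imp_continuous_on[of "Suc 0"] by simp
next
  case (Suc k)
  then have "\<forall>v. Ck_on k S (\<lambda>x. D f x v)" by (metis Ck_on.simps(2))
  with Suc.prems show ?case by simp
qed

lemma Ck_on_const: "Ck_on k S (\<lambda>x. c)"
proof (induction k arbitrary: c)
  case (Suc k)
  have "D (\<lambda>x. c) x v = 0" for x :: 'a and v by simp
  then show ?case using Suc[of 0] by simp
qed simp

lemma Ck_on_bounded_linear:
  assumes "bounded_linear f" shows "Ck_on k S f"
proof (cases k)
  case 0
  then show ?thesis using assms by (simp add: linear_continuous_on)
next
  case (Suc j)
  have *: "(f has_derivative f) (at x)" for x
    using assms bounded_linear_imp_has_derivative by blast
  then have "D f x v = f v" for x v using D_eqI by metis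
  then show ?thesis
    using Suc * by (auto simp: Ck_on_const differentiable_def)
qed

lemma Ck_on_SucI:
  assumes "open S" "\<And>x. x \<in> S \<Longrightarrow> (f has_derivative f' x) (at x)"
    "\<And>v. Ck_on k S (\<lambda>x. f' x v)"
  shows "Ck_on (Suc k) S f"
proof -
  have "D f x v = f' x v" if "x \<in> S" for x v
    using assms(2)[OF that] by (simp add: D_eqI)
  then have "Ck_on k S (\<lambda>x. D f x v)" for v
    using Ck_on_cong[OF assms(1), of "\<lambda>x. D f x v" "\<lambda>x. f' x v" k] assms(3) by simp
  then show ?thesis using assms(2) by (auto simp: differentiable_def)
qed

lemma Ck_on_Suc_derivative:
  assumes "Ck_on (Suc k) S f" "x \<in> S"
  shows "(f has_derivative D f x) (at x)"
  using assms frechet_derivative_works by auto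

lemma Ck_on_add:
  assumes "open S" shows "Ck_on k S f \<Longrightarrow> Ck_on k S g \<Longrightarrow> Ck_on k S (\<lambda>x. f x + g x)"
proof (induction k arbitrary: f g)
  case 0 then show ?case by (auto intro: continuous_intros)
next
  case (Suc k)
  show ?case
    by (rule Ck_on_SucI[OF assms has_derivative_add[OF Ck_on_Suc_derivative Ck_on_Suc_derivative]])
       (use Suc in auto)
qed

lemma Ck_on_bilinear:
  assumes "bounded_bilinear b" "open S"
  shows "Ck_on k S f \<Longrightarrow> Ck_on k S g \<Longrightarrow> Ck_on k S (\<lambda>x. b (f x) (g x))"
proof -
  interpret bounded_bilinear b by fact
  show "Ck_on k S f \<Longrightarrow> Ck_on k S g \<Longrightarrow> Ck_on k S (\<lambda>x. b (f x) (g x))"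
  proof (induction k arbitrary: f g)
    case 0
    then show ?case by (auto intro: continuous_on)
  next
    case (Suc k)
    have "((\<lambda>x. b (f x) (g x)) has_derivative (\<lambda>h. b (f x) (D g x h) + b (D f x h) (g x))) (at x)"
      if "x \<in> S" for x
      using FDERIV[OF Ck_on_Suc_derivative[OF Suc.prems(1) that] Ck_on_Suc_derivative[OF Suc.prems(2) that]] .
    then show ?case
      using Suc.prems Ck_on_SucD[OF Suc.prems(1)] Ck_on_SucD[OF Suc.prems(2)]
      by (intro Ck_on_SucI[OF assms(2)]) (auto intro!: Ck_on_add[OF assms(2)] Suc.IH)
  qed
qed

lemma Ck_on_linear_comp:
  assumes "bounded_linear l" "open S" "Ck_on k S f"
  shows "Ck_on k S (\<lambda>x. l (f x))"
  using assms(3)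
proof (induction k arbitrary: f)
  case 0 then show ?case by (auto intro: bounded_linear.continuous_on[OF assms(1)])
next
  case (Suc k)
  show ?case
    by (rule Ck_on_SucI[OF assms(2) bounded_linear.has_derivative[OF assms(1) Ck_on_Suc_derivative]])
       (use Suc in auto)
qed

lemma Ck_on_sum:
  assumes "open S" "\<And>i. i \<in> I \<Longrightarrow> Ck_on k S (f i)"
  shows "Ck_on k S (\<lambda>x. \<Sum>i\<in>I. f i x)"
  using assms(2)
  by (induction I rule: infinite_finite_induct) (auto intro: Ck_on_add[OF assms(1)] Ck_on_const)

lemma linear_euclidean_representation:
  fixes l :: "'b::euclidean_space \<Rightarrow> 'c::real_vector"
  assumes "linear l" shows "(\<Sum>b\<in>Basis. (z \<bullet> b) *\<^sub>R l b) = l z"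
proof -
  have "l z = l (\<Sum>b\<in>Basis. (z \<bullet> b) *\<^sub>R b)" by (simp add: euclidean_representation)
  also have "\<dots> = (\<Sum>b\<in>Basis. (z \<bullet> b) *\<^sub>R l b)"
    by (simp add: linear_sum[OF assms] linear_scale[OF assms])
  finally show ?thesis by simp
qed

text \<open>\<open>Ck_on\<close> controls \<open>A x v\<close> for fixed \<open>v\<close> only.
  Expanding \<open>f x\<close> in the standard basis trades the varying argument for finitely many
  fixed ones.\<close>

lemma Ck_on_apply:
  fixes A :: "'a::real_normed_vector \<Rightarrow> 'b::euclidean_space \<Rightarrow> 'c::real_normed_vector"
  assumes "open S" "\<And>x. x \<in> S \<Longrightarrow> linear (A x)" "\<And>v. Ck_on k S (\<lambda>x. A x v)" "Ck_on k S f"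
  shows "Ck_on k S (\<lambda>x. A x (f x))"
proof -
  have "A x (f x) = (\<Sum>b\<in>Basis. (f x \<bullet> b) *\<^sub>R A x b)" if "x \<in> S" for x
    using linear_euclidean_representation[OF assms(2)[OF that]] by metis
  moreover have "Ck_on k S (\<lambda>x. \<Sum>b\<in>Basis. (f x \<bullet> b) *\<^sub>R A x b)"
    by (intro Ck_on_sum[OF assms(1)] Ck_on_bilinear[OF bounded_bilinear_scaleR assms(1)] assms(3)
        Ck_on_linear_comp[OF bounded_linear_inner_left assms(1)] assms(4))
  ultimately show ?thesis
    using Ck_on_cong[OF assms(1), of "\<lambda>x. A x (f x)" "\<lambda>x. \<Sum>b\<in>Basis. (f x \<bullet> b) *\<^sub>R A x b" k] by simp
qed

lemma Ck_on_compose: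
  fixes f :: "'b::euclidean_space \<Rightarrow> 'c::real_normed_vector"
  assumes "open S" "open T" "g ` S \<subseteq> T"
  shows "Ck_on k S g \<Longrightarrow> Ck_on k T f \<Longrightarrow> Ck_on k S (\<lambda>x. f (g x))"
proof (induction k arbitrary: f)
  case 0
  then show ?case using assms continuous_on_compose2 by auto
next
  case (Suc k)
  have der: "((\<lambda>x. f (g x)) has_derivative (\<lambda>v. D f (g x) (D g x v))) (at x)" if "x \<in> S" for x
    using diff_chain_at[OF Ck_on_Suc_derivative[OF Suc.prems(1) that] Ck_on_Suc_derivative[OF Suc.prems(2)]]
      that assms(3) by (auto simp: o_def)
  show ?case
  proof (rule Ck_on_SucI[OF assms(1) der])
    fix v
    have "linear (D f (g x))" if "x \<in> S" for x
      using Ck_on_Suc_derivative[OF Suc.prems(2), of "g x"] that assms(3)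
      by (auto intro: has_derivative_linear)
    moreover have "Ck_on k S (\<lambda>x. D f (g x) u)" for u
      using Suc.IH[of "\<lambda>y. D f y u"] Suc.prems Ck_on_SucD[of k S g] by auto
    ultimately show "Ck_on k S (\<lambda>x. D f (g x) (D g x v))"
      by (rule Ck_on_apply[OF assms(1), where A = "\<lambda>x. D f (g x)"]) (use Suc.prems in auto)
  qed
qed

text \<open>In finite dimension pointwise continuity of a family of linear maps is continuity in
  operator norm: the deviation at \<open>w\<close> is at most \<open>norm w\<close> times the sum of
  the deviations on the basis.\<close>

lemma eventually_linear_close:
  fixes B :: "'a::real_normed_vector \<Rightarrow> 'b::euclidean_space \<Rightarrow> 'c::real_normed_vector"
  assumes "open S" "x \<in> S" "\<And>y. y \<in> S \<Longrightarrow> linear (B y)" "\<And>v. continuous_on S (\<lambda>y. B y v)" "e > 0"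
  shows "\<forall>\<^sub>F y in at x. y \<in> S \<and> (\<forall>w. norm (B y w - B x w) \<le> e * norm w)"
proof -
  have "isCont (\<lambda>y. B y v) x" for v
    using assms(1,2,4) continuous_on_eq_continuous_at by blast
  then have "((\<lambda>y. \<Sum>b\<in>Basis. norm (B y b - B x b)) \<longlongrightarrow> (\<Sum>b\<in>Basis. norm (B x b - B x b))) (at x)"
    unfolding isCont_def by (intro tendsto_intros)
  then have "\<forall>\<^sub>F y in at x. (\<Sum>b\<in>Basis. norm (B y b - B x b)) < e"
    using assms(5) by (intro order_tendstoD) auto
  moreover have "\<forall>\<^sub>F y in at x. y \<in> S"
    using assms(1,2) eventually_at_in_open' by blast
  ultimately show ?thesis
  proof eventually_elim
    case (elim y)
    have "norm (B y w - B x w) \<le> e * norm w" for w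
    proof -
      have lin: "linear (\<lambda>w. B y w - B x w)"
        using assms(2,3) elim(2) by (intro linear_compose_sub) auto
      have "B y w - B x w = (\<Sum>b\<in>Basis. (w \<bullet> b) *\<^sub>R (B y b - B x b))"
        using linear_sum[OF lin, of "\<lambda>b. (w \<bullet> b) *\<^sub>R b" Basis] linear_scale[OF lin]
        by (simp add: euclidean_representation)
      also have "norm \<dots> \<le> (\<Sum>b\<in>Basis. norm w * norm (B y b - B x b))"
        by (intro sum_norm_le) (auto intro!: mult_right_mono Basis_le_norm)
      also have "\<dots> = norm w * (\<Sum>b\<in>Basis. norm (B y b - B x b))" by (simp add: sum_distrib_left)
      also have "\<dots> \<le> norm w * e" using elim(1) by (intro mult_left_mono) auto
      finally show ?thesis by (simp add: mult.commute)
    qed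
    then show ?case using elim by blast
  qed
qed

text \<open>A product rule with a second factor that is merely continuous. It works because
  \<open>f\<close> vanishes at \<open>x\<close>: the error \<open>f y *\<^sub>R (g y - g x)\<close>
  is of order \<open>norm (y - x)\<close> times something tending to zero. This is how an inverse
  family of linear maps becomes differentiable once it is known to be continuous.\<close>

lemma has_derivative_scaleR_zero:
  fixes f :: "'a::real_normed_vector \<Rightarrow> real" and g :: "'a \<Rightarrow> 'b::real_normed_vector"
  assumes "(f has_derivative f') (at x)" "f x = 0" "isCont g x"
  shows "((\<lambda>y. f y *\<^sub>R g y) has_derivative (\<lambda>v. f' v *\<^sub>R g x)) (at x)"
proof -
  have 1: "((\<lambda>y. f y *\<^sub>R g x) has_derivative (\<lambda>v. f' v *\<^sub>R g x)) (at x)"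
    using assms(1) by (rule bounded_linear.has_derivative[OF bounded_linear_scaleR_left])
  obtain K where K: "K > 0" "\<forall>\<^sub>F y in at x. norm (f y - f x) \<le> K * norm (y - x)"
  proof -
    obtain e where e: "\<forall>v. norm (f' v) \<le> norm v * e" "e > 0"
      using has_derivative_bounded_linear[OF assms(1)] bounded_linear.pos_bounded by blast
    have "((\<lambda>y. (f y - f x - f' (y - x)) /\<^sub>R norm (y - x)) \<longlongrightarrow> 0) (at x)"
      using assms(1) unfolding has_derivative_at_within by simp
    then have "\<forall>\<^sub>F y in at x. norm ((f y - f x - f' (y - x)) /\<^sub>R norm (y - x)) < 1"
      using tendsto_norm_zero order_tendstoD(2) zero_less_one by blast
    moreover have "\<forall>\<^sub>F y in at x. y \<noteq> x" by (simp add: eventually_neq_at_within)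
    ultimately have "\<forall>\<^sub>F y in at x. norm (f y - f x) \<le> (e + 1) * norm (y - x)"
    proof eventually_elim
      case (elim y)
      then have "norm (f y - f x - f' (y - x)) \<le> norm (y - x)" by (simp add: field_simps)
      moreover have "norm (f' (y - x)) \<le> norm (y - x) * e" using e by blast
      ultimately show ?case by (simp add: algebra_simps)
    qed
    with e show ?thesis using that[of "e + 1"] by simp
  qed
  have 2: "((\<lambda>y. f y *\<^sub>R (g y - g x)) has_derivative (\<lambda>v. 0)) (at x)"
    unfolding has_derivative_at_within
  proof (intro conjI)
    have "((\<lambda>y. K * norm (g y - g x)) \<longlongrightarrow> K * norm (g x - g x)) (at x)"
      using assms(3) unfolding isCont_def by (intro tendsto_intros)
    then have lim: "((\<lambda>y. K * norm (g y - g x)) \<longlongrightarrow> 0) (at x)" by simp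
    have "\<forall>\<^sub>F y in at x. y \<noteq> x" by (simp add: eventually_neq_at_within)
    then have "\<forall>\<^sub>F y in at x. norm ((f y *\<^sub>R (g y - g x) - f x *\<^sub>R (g x - g x) - 0) /\<^sub>R norm (y - x)) \<le> K * norm (g y - g x)"
      using K(2)
    proof eventually_elim
      case (elim y)
      then have "norm (f y) * norm (g y - g x) \<le> K * norm (y - x) * norm (g y - g x)"
        using assms(2) by (intro mult_right_mono) auto
      moreover have "f y *\<^sub>R (g y - g x) - f x *\<^sub>R (g x - g x) - 0 = f y *\<^sub>R (g y - g x)" by simp
      ultimately show ?case using elim by (simp only:) (simp add: divide_simps mult_ac)
    qed
    then show "((\<lambda>y. (f y *\<^sub>R (g y - g x) - f x *\<^sub>R (g x - g x) - 0) /\<^sub>R norm (y - x)) \<longlongrightarrow> 0) (at x)"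
      using lim by (rule Lim_null_comparison)
  qed simp
  show ?thesis
    using has_derivative_add[OF 1 2] by (simp add: algebra_simps)
qed

text \<open>The derivative of \<open>x \<mapsto> C\<^sub>x v\<close>, where \<open>C\<^sub>x\<close> is inverse to \<open>B\<^sub>x\<close>, is \<open>-C\<^sub>x B'\<^sub>x C\<^sub>x v\<close>: as this
  involves \<open>C\<close> itself, the differentiability classes of \<open>C\<close> are obtained one by one.\<close>

lemma Ck_on_inverse:
  fixes B C :: "'a::real_normed_vector \<Rightarrow> 'b::euclidean_space \<Rightarrow> 'b"
  assumes "open S" and lin: "\<And>x. x \<in> S \<Longrightarrow> linear (B x)"
    and CB: "\<And>x v. x \<in> S \<Longrightarrow> C x (B x v) = v" and BC: "\<And>x v. x \<in> S \<Longrightarrow> B x (C x v) = v"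
    and "\<And>v. Ck_on k S (\<lambda>x. B x v)"
  shows "Ck_on k S (\<lambda>x. C x v)"
  using assms(5)
proof (induction k arbitrary: v)
  case 0
  then have cB: "\<And>v. continuous_on S (\<lambda>y. B y v)" by simp
  have "isCont (\<lambda>x. C x v) x" if x: "x \<in> S" for x
  proof -
    have "inj (B x)" by (metis CB injI x)
    \<comment> \<open>\<open>c\<close> bounds \<open>B x\<close> from below. Maps \<open>B y\<close>
      that differ from it by at most \<open>c/2\<close> are bounded below by \<open>c/2\<close>,
      hence the factor \<open>2/c\<close> in the estimate.\<close>
    then obtain c where c: "c > 0" "\<And>w. c * norm w \<le> norm (B x w)"
      using linear_inj_bounded_below_pos[OF lin[OF x]] by (metis mult.commute)
    have "((\<lambda>y. (2/c) * norm (v - B y (C x v))) \<longlongrightarrow> (2/c) * norm (v - B x (C x v))) (at x)"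
      using cB[of "C x v"] x assms(1) unfolding continuous_on_eq_continuous_at[OF assms(1)] isCont_def
      by (intro tendsto_intros) auto
    then have lim: "((\<lambda>y. (2/c) * norm (v - B y (C x v))) \<longlongrightarrow> 0) (at x)"
      using BC[OF x] by simp
    have "\<forall>\<^sub>F y in at x. norm (C y v - C x v) \<le> (2/c) * norm (v - B y (C x v))"
      using eventually_linear_close[of S x B "c/2", OF assms(1) x lin cB, simplified, OF c(1)]
    proof eventually_elim
      case (elim y)
      let ?w = "C y v - C x v"
      have "B y ?w = v - B y (C x v)" using elim by (simp add: BC linear_diff[OF lin])
      moreover have "c * norm ?w \<le> norm (B x ?w)" by (rule c)
      moreover have "norm (B y ?w - B x ?w) * 2 \<le> c * norm ?w" using elim by blast
      moreover have "norm (B x ?w) \<le> norm (B y ?w) + norm (B y ?w - B x ?w)"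
        by (metis norm_minus_commute norm_triangle_sub)
      ultimately have "c * norm ?w \<le> 2 * norm (v - B y (C x v))" by simp
      then show ?case using c(1) by (simp add: field_simps)
    qed
    then have "((\<lambda>y. C y v - C x v) \<longlongrightarrow> 0) (at x)" using lim by (rule Lim_null_comparison)
    then show ?thesis by (simp add: isCont_def LIM_zero_iff)
  qed
  then show ?case by (simp add: continuous_at_imp_continuous_on)
next
  case (Suc k)
  have linC: "linear (C x)" if "x \<in> S" for x
  proof
    fix u u'
    have "C x (B x (C x u + C x u')) = C x (u + u')"
      using that by (simp add: linear_add[OF lin] BC)
    then show "C x (u + u') = C x u + C x u'" using CB[OF that] by simp
  next
    fix r u
    have "C x (B x (r *\<^sub>R C x u)) = C x (r *\<^sub>R u)"
      using that by (simp add: linear_scale[OF lin] BC)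
    then show "C x (r *\<^sub>R u) = r *\<^sub>R C x u" using CB[OF that] by simp
  qed
  have IH: "Ck_on k S (\<lambda>x. C x u)" for u
    using Suc.IH Ck_on_SucD[OF Suc.prems] by blast
  have cC: "isCont (\<lambda>x. C x u) x" if "x \<in> S" for x u
    using Ck_on_imp_continuous_on[OF IH] assms(1) that continuous_on_eq_continuous_at by blast
  define B' where "B' w x u = D (\<lambda>y. B y u) x w" for w x u
  have B': "((\<lambda>y. B y u) has_derivative (\<lambda>w. B' w x u)) (at x)" if "x \<in> S" for x u
    unfolding B'_def using Ck_on_Suc_derivative[OF Suc.prems that, of u] by simp
  have linB': "linear (B' w x)" if x: "x \<in> S" for w x
  proof
    fix u u'
    have "((\<lambda>y. B y u + B y u') has_derivative (\<lambda>w. B' w x u + B' w x u')) (at x)"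
      by (intro has_derivative_add B' x)
    moreover have "D (\<lambda>y. B y (u + u')) x = D (\<lambda>y. B y u + B y u') x"
      by (rule D_cong[OF assms(1) x]) (simp add: lin linear_add)
    ultimately show "B' w x (u + u') = B' w x u + B' w x u'" by (simp add: B'_def D_eqI)
  next
    fix r u
    have "((\<lambda>y. r *\<^sub>R B y u) has_derivative (\<lambda>w. r *\<^sub>R B' w x u)) (at x)"
      by (intro has_derivative_scaleR_right B' x)
    moreover have "D (\<lambda>y. B y (r *\<^sub>R u)) x = D (\<lambda>y. r *\<^sub>R B y u) x"
      by (rule D_cong[OF assms(1) x]) (simp add: lin linear_scale)
    ultimately show "B' w x (r *\<^sub>R u) = r *\<^sub>R B' w x u" by (simp add: B'_def D_eqI)
  qed
  show ?case
  proof (rule Ck_on_SucI[OF assms(1)])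
    fix x assume x: "x \<in> S"
    let ?u = "C x v"
    \<comment> \<open>\<open>C y v = ?u + C y (?z y)\<close> with \<open>?z x = 0\<close>, so in
      basis coordinates a vanishing differentiable factor meets a continuous one.\<close>
    let ?z = "\<lambda>y. v - B y ?u"
    have z: "(?z has_derivative (\<lambda>w. - B' w x ?u)) (at x)"
      using has_derivative_diff[OF has_derivative_const B'[OF x, of ?u]] by simp
    have "((\<lambda>y. (?z y \<bullet> b) *\<^sub>R C y b) has_derivative (\<lambda>w. (- B' w x ?u \<bullet> b) *\<^sub>R C x b)) (at x)" for b
      by (rule has_derivative_scaleR_zero[OF has_derivative_inner_left[OF z]]) (simp_all add: BC x cC)
    then have "((\<lambda>y. ?u + (\<Sum>b\<in>Basis. (?z y \<bullet> b) *\<^sub>R C y b)) has_derivative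
        (\<lambda>w. 0 + (\<Sum>b\<in>Basis. (- B' w x ?u \<bullet> b) *\<^sub>R C x b))) (at x)"
      by (intro has_derivative_add has_derivative_const has_derivative_sum)
    moreover have *: "(\<Sum>b\<in>Basis. (z \<bullet> b) *\<^sub>R C y b) = C y z" if "y \<in> S" for y z
      by (rule linear_euclidean_representation[OF linC[OF that]])
    ultimately have "((\<lambda>y. ?u + (\<Sum>b\<in>Basis. (?z y \<bullet> b) *\<^sub>R C y b)) has_derivative
        (\<lambda>w. - C x (B' w x ?u))) (at x)"
      using linear_neg[OF linC[OF x]] by (simp only: *[OF x]) simp
    then show "((\<lambda>y. C y v) has_derivative (\<lambda>w. - C x (B' w x ?u))) (at x)"
    proof (rule has_derivative_transform_within_open[OF _ assms(1) x])
      fix y assume "y \<in> S"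
      then show "?u + (\<Sum>b\<in>Basis. (?z y \<bullet> b) *\<^sub>R C y b) = C y v"
        by (simp only: *) (simp add: linear_diff[OF linC] CB)
    qed
  next
    fix w
    have *: "Ck_on k S (\<lambda>x. B' w x u)" for u
      unfolding B'_def using Suc.prems[of u] by simp
    have "Ck_on k S (\<lambda>x. B' w x (C x v))"
      by (rule Ck_on_apply[OF assms(1) linB' * IH])
    from Ck_on_apply[OF assms(1) linC IH this]
    have "Ck_on k S (\<lambda>x. C x (B' w x (C x v)))" by simp
    then show "Ck_on k S (\<lambda>x. - C x (B' w x (C x v)))"
      by (rule Ck_on_linear_comp[OF bounded_linear_minus[OF bounded_linear_ident] assms(1)])
  qed
qed

section \<open>Smooth maps and the smooth inverse function theorem\<close>

lemma smooth_on_derivative: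
  assumes "smooth_on S f" "x \<in> S" shows "(f has_derivative D f x) (at x)"
  using assms unfolding smooth_on_def by (metis Ck_on_Suc_derivative)

lemma smooth_on_D: "smooth_on S f \<Longrightarrow> smooth_on S (\<lambda>x. D f x v)"
  unfolding smooth_on_def by (metis Ck_on.simps(2))

lemma smooth_on_imp_continuous_on: "smooth_on S f \<Longrightarrow> continuous_on S f"
  unfolding smooth_on_def using Ck_on_imp_continuous_on by blast

lemma smooth_on_subset: "smooth_on S f \<Longrightarrow> T \<subseteq> S \<Longrightarrow> smooth_on T f"
  unfolding smooth_on_def using Ck_on_subset by blast

lemma smooth_on_cong:
  assumes "open S" "smooth_on S f" "\<And>y. y \<in> S \<Longrightarrow> f y = g y" shows "smooth_on S g"
  using assms Ck_on_cong unfolding smooth_on_def by metis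

lemma smooth_on_local:
  assumes "\<And>x. x \<in> S \<Longrightarrow> \<exists>V. open V \<and> x \<in> V \<and> smooth_on V f"
  shows "smooth_on S f"
  using assms unfolding smooth_on_def by (metis Ck_on_local)

lemma smooth_on_const: "smooth_on S (\<lambda>x. c)"
  by (simp add: smooth_on_def Ck_on_const)

lemma smooth_on_bounded_linear: "bounded_linear f \<Longrightarrow> smooth_on S f"
  by (simp add: smooth_on_def Ck_on_bounded_linear)

lemma smooth_on_bilinear:
  "bounded_bilinear b \<Longrightarrow> open S \<Longrightarrow> smooth_on S f \<Longrightarrow> smooth_on S g \<Longrightarrow> smooth_on S (\<lambda>x. b (f x) (g x))"
  by (simp add: smooth_on_def Ck_on_bilinear)

lemma smooth_on_add:
  "open S \<Longrightarrow> smooth_on S f \<Longrightarrow> smooth_on S g \<Longrightarrow> smooth_on S (\<lambda>x. f x + g x)"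
  by (simp add: smooth_on_def Ck_on_add)

lemma smooth_on_linear_comp:
  "bounded_linear l \<Longrightarrow> open S \<Longrightarrow> smooth_on S f \<Longrightarrow> smooth_on S (\<lambda>x. l (f x))"
  by (simp add: smooth_on_def Ck_on_linear_comp)

lemma smooth_on_compose:
  fixes f :: "'b::euclidean_space \<Rightarrow> 'c::real_normed_vector"
  assumes "open S" "open T" "g ` S \<subseteq> T" "smooth_on S g" "smooth_on T f"
  shows "smooth_on S (\<lambda>x. f (g x))"
  using Ck_on_compose[OF assms(1-3)] assms(4,5) unfolding smooth_on_def by blast

lemma smooth_on_inverse:
  fixes B C :: "'a::real_normed_vector \<Rightarrow> 'b::euclidean_space \<Rightarrow> 'b"
  assumes "open S" "\<And>x. x \<in> S \<Longrightarrow> linear (B x)"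
    "\<And>x v. x \<in> S \<Longrightarrow> C x (B x v) = v" "\<And>x v. x \<in> S \<Longrightarrow> B x (C x v) = v"
    "\<And>v. smooth_on S (\<lambda>x. B x v)"
  shows "smooth_on S (\<lambda>x. C x v)"
  unfolding smooth_on_def
proof
  fix k
  show "Ck_on k S (\<lambda>x. C x v)"
    by (rule Ck_on_inverse[of S B C]) (use assms in \<open>auto simp: smooth_on_def\<close>)
qed

lemma linear_D: "smooth_on S f \<Longrightarrow> x \<in> S \<Longrightarrow> linear (D f x)"
  using smooth_on_derivative has_derivative_linear by blast

text \<open>The local inverse \<open>g\<close> is at first only C^1. Its derivative at
  \<open>y\<close> is the inverse of \<open>D f (g y)\<close>, so by \<open>Ck_on_inverse\<close> a
  \<open>g\<close> of class C^k has a derivative of class C^k and gains one class.\<close>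

lemma smooth_inverse_function:
  fixes f :: "'a::euclidean_space \<Rightarrow> 'a"
  assumes "open U" "smooth_on U f" "x0 \<in> U" "inj (D f x0)"
  obtains W V g where "open W" "W \<subseteq> U" "x0 \<in> W" "open V" "f ` W = V"
    "\<And>x. x \<in> W \<Longrightarrow> g (f x) = x" "g ` V = W" "\<And>y. y \<in> V \<Longrightarrow> f (g y) = y"
    "smooth_on V g" "\<And>x. x \<in> W \<Longrightarrow> bij (D f x)"
proof -
  let ?f' = "\<lambda>x. Blinfun (D f x)"
  have ap: "blinfun_apply (?f' x) = D f x" if "x \<in> U" for x
    using smooth_on_derivative[OF assms(2) that]
    by (simp add: bounded_linear_Blinfun_apply has_derivative_bounded_linear)
  have der: "(f has_derivative blinfun_apply (?f' x)) (at x)" if "x \<in> U" for x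
    using ap smooth_on_derivative[OF assms(2)] that by simp
  have cont: "continuous_on U ?f'"
  proof (rule continuous_on_blinfun_componentwise)
    fix i :: 'a
    have "continuous_on U (\<lambda>x. D f x i)"
      using smooth_on_D[OF assms(2)] smooth_on_imp_continuous_on by blast
    then show "continuous_on U (\<lambda>x. blinfun_apply (?f' x) i)"
      by (simp add: ap cong: continuous_on_cong)
  qed
  obtain l where l: "linear l" "l \<circ> D f x0 = id"
    using linear_injective_left_inverse[OF linear_D[OF assms(2,3)] assms(4)] by blast
  have "Blinfun l o\<^sub>L ?f' x0 = id_blinfun"
    using l ap[OF assms(3)] pointfree_idE[OF l(2)]
    by (intro blinfun_eqI) (simp add: bounded_linear_Blinfun_apply linear_conv_bounded_linear)
  from inverse_function_theorem[OF assms(1) der cont assms(3) this]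
  obtain W V g g' where *: "open W" "W \<subseteq> U" "x0 \<in> W" "open V" "f x0 \<in> V"
    and hom: "homeomorphism W V f g"
    and g: "\<And>y. y \<in> V \<Longrightarrow> (g has_derivative (g' y)) (at y)"
      "\<And>y. y \<in> V \<Longrightarrow> g' y = inv (blinfun_apply (?f' (g y)))"
      "\<And>y. y \<in> V \<Longrightarrow> bij (blinfun_apply (?f' (g y)))"
    by metis
  have gV: "g ` V = W" and gf: "\<And>x. x \<in> W \<Longrightarrow> g (f x) = x" and fg: "\<And>y. y \<in> V \<Longrightarrow> f (g y) = y"
    and fW: "f ` W = V"
    using hom by (auto simp: homeomorphism_def)
  have bij: "bij (D f x)" if "x \<in> W" for x
    using g(3)[of "f x"] ap[of x] gf[OF that] fW that *(2) by auto
  have g'D: "g' y v = inv (D f (g y)) v" if "y \<in> V" for y v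
    using g(2)[OF that] ap[of "g y"] gV *(2) that by auto
  have "Ck_on k V g" for k
  proof (induction k)
    case 0
    then show ?case using hom by (auto simp: homeomorphism_def)
  next
    case (Suc k)
    show ?case
    proof (rule Ck_on_SucI[OF *(4) g(1)])
      fix v
      have 1: "Ck_on k V (\<lambda>y. D f (g y) u)" for u
        using Ck_on_compose[OF *(4) assms(1) _ Suc, of "\<lambda>x. D f x u"] gV *(2) smooth_on_D[OF assms(2)]
        by (auto simp: smooth_on_def)
      have "Ck_on k V (\<lambda>y. inv (D f (g y)) v)"
      proof (rule Ck_on_inverse[OF *(4) _ _ _ 1])
        fix y u assume "y \<in> V"
        then have gy: "g y \<in> W" "g y \<in> U" using gV *(2) by auto
        show "linear (D f (g y))" using linear_D[OF assms(2) gy(2)] .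
        show "inv (D f (g y)) (D f (g y) u) = u" using bij[OF gy(1)] by (simp add: bij_is_inj)
        show "D f (g y) (inv (D f (g y)) u) = u" using bij[OF gy(1)] by (simp add: bij_is_surj surj_f_inv_f)
      qed
      then show "Ck_on k V (\<lambda>y. g' y v)"
        using Ck_on_cong[OF *(4), of "\<lambda>y. g' y v" "\<lambda>y. inv (D f (g y)) v"] g'D by simp
    qed
  qed
  then have "smooth_on V g" by (simp add: smooth_on_def)
  then show ?thesis using that[OF *(1-4) fW gf gV fg _ bij] by blast
qed


section \<open>Second derivatives\<close>

text \<open>The mean value theorem is applied twice, along \<open>u\<close> and then along
  \<open>v\<close>. The second difference does not change when \<open>u\<close> and \<open>v\<close>
  are exchanged, and the symmetry of second derivatives rests on this.\<close>

lemma second_difference: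
  fixes f :: "'a::real_normed_vector \<Rightarrow> real"
  assumes "smooth_on (ball x r) f" "h > 0" "h * (norm u + norm v) < r"
  shows "\<exists>y. norm (y - x) \<le> h * (norm u + norm v) \<and>
    f (x + h *\<^sub>R u + h *\<^sub>R v) - f (x + h *\<^sub>R u) - f (x + h *\<^sub>R v) + f x = h\<^sup>2 * D (\<lambda>y. D f y u) y v"
proof -
  have bound: "norm (s *\<^sub>R u + t *\<^sub>R v) \<le> h * (norm u + norm v)" if "0 \<le> s" "s \<le> h" "0 \<le> t" "t \<le> h" for s t
  proof -
    have "norm (s *\<^sub>R u + t *\<^sub>R v) \<le> s * norm u + t * norm v"
      using norm_triangle_ineq[of "s *\<^sub>R u" "t *\<^sub>R v"] that by simp
    also have "\<dots> \<le> h * norm u + h * norm v" using that by (intro add_mono mult_right_mono) auto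
    finally show ?thesis by (simp add: algebra_simps)
  qed
  have mem: "x + s *\<^sub>R u + t *\<^sub>R v \<in> ball x r" if "0 \<le> s" "s \<le> h" "0 \<le> t" "t \<le> h" for s t
  proof -
    have "dist x (x + s *\<^sub>R u + t *\<^sub>R v) = norm (s *\<^sub>R u + t *\<^sub>R v)"
      by (metis add.assoc add_diff_cancel_left' dist_commute dist_norm)
    then show ?thesis using bound[OF that] assms(3) by simp
  qed
  have der: "((\<lambda>s. g (p + s *\<^sub>R w)) has_real_derivative D g (p + s *\<^sub>R w) w) (at s)"
    if "smooth_on (ball x r) g" "p + s *\<^sub>R w \<in> ball x r" for g :: "'a \<Rightarrow> real" and p w s
  proof -
    have "((\<lambda>s. p + s *\<^sub>R w) has_derivative (\<lambda>k. 0 + k *\<^sub>R w)) (at s)"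
      by (intro has_derivative_add has_derivative_const has_derivative_scaleR_left has_derivative_ident)
    then have "((\<lambda>s. g (p + s *\<^sub>R w)) has_derivative (\<lambda>k. D g (p + s *\<^sub>R w) (k *\<^sub>R w))) (at s)"
      using diff_chain_at[of "\<lambda>s. p + s *\<^sub>R w" _ s g] smooth_on_derivative[OF that] by (auto simp: o_def)
    then show ?thesis
      unfolding has_field_derivative_def
      by (rule has_derivative_eq_rhs) (simp add: linear_scale[OF linear_D[OF that]] fun_eq_iff mult.commute)
  qed
  let ?\<phi> = "\<lambda>s. f (x + h *\<^sub>R v + s *\<^sub>R u) - f (x + s *\<^sub>R u)"
  have "((\<lambda>s. ?\<phi> s) has_real_derivative D f (x + h *\<^sub>R v + s *\<^sub>R u) u - D f (x + s *\<^sub>R u) u) (at s)"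
    if "0 \<le> s" "s \<le> h" for s
    using mem[of s h] mem[of s 0] that assms(2)
    by (intro DERIV_diff der assms(1)) (auto simp: algebra_simps)
  from MVT2[OF assms(2) this]
  obtain s where s: "0 < s" "s < h"
    "?\<phi> h - ?\<phi> 0 = (h - 0) * (D f (x + h *\<^sub>R v + s *\<^sub>R u) u - D f (x + s *\<^sub>R u) u)" by blast
  have "((\<lambda>t. D f (x + s *\<^sub>R u + t *\<^sub>R v) u) has_real_derivative
      D (\<lambda>y. D f y u) (x + s *\<^sub>R u + t *\<^sub>R v) v) (at t)" if "0 \<le> t" "t \<le> h" for t
    using mem[of s t] that s by (intro der smooth_on_D[OF assms(1)]) auto
  from MVT2[OF assms(2) this]
  obtain t where t: "0 < t" "t < h"
    "D f (x + s *\<^sub>R u + h *\<^sub>R v) u - D f (x + s *\<^sub>R u + 0 *\<^sub>R v) u =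
      (h - 0) * D (\<lambda>y. D f y u) (x + s *\<^sub>R u + t *\<^sub>R v) v" by blast
  have "norm (x + s *\<^sub>R u + t *\<^sub>R v - x) \<le> h * (norm u + norm v)"
    using bound[of s t] s t by (simp add: algebra_simps)
  moreover have "f (x + h *\<^sub>R u + h *\<^sub>R v) - f (x + h *\<^sub>R u) - f (x + h *\<^sub>R v) + f x =
      h\<^sup>2 * D (\<lambda>y. D f y u) (x + s *\<^sub>R u + t *\<^sub>R v) v"
  proof -
    have c: "x + h *\<^sub>R v + s *\<^sub>R u = x + s *\<^sub>R u + h *\<^sub>R v" for s by (simp add: algebra_simps)
    from s(3) t(3) show ?thesis by (simp add: c power2_eq_square algebra_simps)
  qed
  ultimately show ?thesis by blast
qed

lemma D_symmetric_real:
  fixes f :: "'a::real_normed_vector \<Rightarrow> real"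
  assumes "open S" "smooth_on S f" "x \<in> S"
  shows "D (\<lambda>y. D f y u) x v = D (\<lambda>y. D f y v) x u"
proof (rule ccontr)
  let ?A = "\<lambda>y. D (\<lambda>y. D f y u) y v" and ?B = "\<lambda>y. D (\<lambda>y. D f y v) y u"
  assume "?A x \<noteq> ?B x"
  \<comment> \<open>Half the gap: the two mixed derivatives agree at some points close to
    \<open>x\<close>, where each is within \<open>e\<close> of its value at
    \<open>x\<close>.\<close>
  define e where "e = \<bar>?A x - ?B x\<bar> / 2"
  have e: "e > 0" using \<open>?A x \<noteq> ?B x\<close> by (simp add: e_def)
  have "isCont ?A x" "isCont ?B x"
    using smooth_on_D[OF smooth_on_D[OF assms(2)]] smooth_on_imp_continuous_on assms(1,3)
      continuous_on_eq_continuous_at by blast+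
  then obtain d1 d2 where d: "d1 > 0" "\<And>y. dist y x < d1 \<Longrightarrow> dist (?A y) (?A x) < e"
    "d2 > 0" "\<And>y. dist y x < d2 \<Longrightarrow> dist (?B y) (?B x) < e"
    using e unfolding continuous_at_eps_delta by metis
  obtain d0 where d0: "d0 > 0" "ball x d0 \<subseteq> S" using assms(1,3) openE by blast
  define r where "r = min d0 (min d1 d2)"
  have r: "r > 0" "r \<le> d0" "r \<le> d1" "r \<le> d2" using d d0 by (auto simp: r_def)
  have sm: "smooth_on (ball x r) f" using smooth_on_subset[OF assms(2)] d0(2) subset_ball[OF r(2), of x] by blast
  \<comment> \<open>The summand 1 keeps the denominator positive for \<open>u = v = 0\<close>; the
    box with sides \<open>h *\<^sub>R u\<close> and \<open>h *\<^sub>R v\<close> then stays within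
    \<open>r / 2\<close> of \<open>x\<close>.\<close>
  define h where "h = r / (2 * (norm u + norm v + 1))"
  have pos: "norm u + norm v + 1 > 0" by (meson add_nonneg_pos norm_ge_zero add_nonneg_nonneg zero_less_one)
  then have h: "h > 0" using r by (simp add: h_def)
  have "h * (norm u + norm v) \<le> h * (norm u + norm v + 1)" using h by simp
  also have "\<dots> = r / 2" using pos by (simp add: h_def divide_simps)
  finally have hr: "h * (norm u + norm v) < r" using r by simp
  obtain y where y: "norm (y - x) \<le> h * (norm u + norm v)"
    "f (x + h *\<^sub>R u + h *\<^sub>R v) - f (x + h *\<^sub>R u) - f (x + h *\<^sub>R v) + f x = h\<^sup>2 * ?A y"
    using second_difference[OF sm h hr] by blast
  obtain z where z: "norm (z - x) \<le> h * (norm v + norm u)"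
    "f (x + h *\<^sub>R v + h *\<^sub>R u) - f (x + h *\<^sub>R v) - f (x + h *\<^sub>R u) + f x = h\<^sup>2 * ?B z"
    using second_difference[OF sm h, of v u] hr by (metis add.commute)
  have comm: "x + h *\<^sub>R v + h *\<^sub>R u = x + h *\<^sub>R u + h *\<^sub>R v" by simp
  have "h\<^sup>2 * ?A y = h\<^sup>2 * ?B z"
    unfolding y(2)[symmetric] z(2)[symmetric] comm by simp
  then have "?A y = ?B z" using h by simp
  moreover have "dist (?A y) (?A x) < e" "dist (?B z) (?B x) < e"
    using d(2)[of y] d(4)[of z] y(1) z(1) hr r(3,4) by (simp_all add: dist_norm add.commute)
  ultimately show False by (simp add: e_def dist_real_def) argo
qed

lemma D_linear_comp:
  assumes "bounded_linear l" "f differentiable at x"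
  shows "D (\<lambda>y. l (f y)) x v = l (D f x v)"
  by (metis D_eqI assms bounded_linear.has_derivative frechet_derivative_works)

lemma smooth_on_differentiable: "smooth_on S f \<Longrightarrow> x \<in> S \<Longrightarrow> f differentiable at x"
  using smooth_on_derivative by (auto simp: differentiable_def)

lemma D_symmetric:
  fixes f :: "'a::real_normed_vector \<Rightarrow> 'b::real_inner"
  assumes "open S" "smooth_on S f" "x \<in> S"
  shows "D (\<lambda>y. D f y u) x v = D (\<lambda>y. D f y v) x u"
proof -
  have *: "D (\<lambda>y. D f y u) x v \<bullet> b = D (\<lambda>y. D (\<lambda>z. f z \<bullet> b) y u) x v" for u v b
  proof -
    have "D (\<lambda>y. D f y u) x v \<bullet> b = D (\<lambda>y. D f y u \<bullet> b) x v"
      by (rule D_linear_comp[OF bounded_linear_inner_left, symmetric])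
         (use smooth_on_D[OF assms(2)] assms(3) smooth_on_differentiable in blast)
    also have "D (\<lambda>y. D f y u \<bullet> b) x = D (\<lambda>y. D (\<lambda>z. f z \<bullet> b) y u) x"
      by (rule D_cong[OF assms(1,3)])
         (simp add: D_linear_comp[OF bounded_linear_inner_left] smooth_on_differentiable[OF assms(2)])
    finally show ?thesis .
  qed
  have "D (\<lambda>y. D f y u) x v \<bullet> b = D (\<lambda>y. D f y v) x u \<bullet> b" for b
    unfolding * by (rule D_symmetric_real[OF assms(1) _ assms(3)])
       (rule smooth_on_linear_comp[OF bounded_linear_inner_left assms(1,2)])
  then show ?thesis by (metis inner_commute vector_eq_ldot)
qed

text \<open>Expanding \<open>Y\<close> in the basis gives second derivatives with the basis vector
  in the inner slot. Symmetry moves it to the outer slot, where linearity is available to sum up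
  again. The lemma serves to differentiate the tangency condition of a vector field.\<close>

lemma has_derivative_D_apply:
  fixes f :: "'a::euclidean_space \<Rightarrow> 'b::euclidean_space"
  assumes "open S" "smooth_on S f" "x \<in> S" "(Y has_derivative Y') (at x)"
  shows "((\<lambda>y. D f y (Y y)) has_derivative (\<lambda>u. D (\<lambda>y. D f y u) x (Y x) + D f x (Y' u))) (at x)"
proof -
  have lin: "linear (D f y)" if "y \<in> S" for y using linear_D[OF assms(2) that] .
  have "((\<lambda>y. \<Sum>b\<in>Basis. (Y y \<bullet> b) *\<^sub>R D f y b) has_derivative
      (\<lambda>u. \<Sum>b\<in>Basis. (Y x \<bullet> b) *\<^sub>R D (\<lambda>y. D f y b) x u + (Y' u \<bullet> b) *\<^sub>R D f x b)) (at x)"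
    by (intro has_derivative_sum has_derivative_scaleR has_derivative_inner_left[OF assms(4)]
        smooth_on_derivative[OF smooth_on_D[OF assms(2)] assms(3)])
  moreover have "(\<Sum>b\<in>Basis. (Y x \<bullet> b) *\<^sub>R D (\<lambda>y. D f y b) x u + (Y' u \<bullet> b) *\<^sub>R D f x b) =
      D (\<lambda>y. D f y u) x (Y x) + D f x (Y' u)" for u
  proof -
    have "(\<Sum>b\<in>Basis. (Y x \<bullet> b) *\<^sub>R D (\<lambda>y. D f y b) x u) = (\<Sum>b\<in>Basis. (Y x \<bullet> b) *\<^sub>R D (\<lambda>y. D f y u) x b)"
      by (simp add: D_symmetric[OF assms(1-3), of _ u])
    also have "\<dots> = D (\<lambda>y. D f y u) x (Y x)"
      by (rule linear_euclidean_representation[OF linear_D[OF smooth_on_D[OF assms(2)] assms(3)]])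
    finally show ?thesis
      by (simp add: sum.distrib linear_euclidean_representation[OF lin[OF assms(3)]])
  qed
  ultimately have "((\<lambda>y. \<Sum>b\<in>Basis. (Y y \<bullet> b) *\<^sub>R D f y b) has_derivative
      (\<lambda>u. D (\<lambda>y. D f y u) x (Y x) + D f x (Y' u))) (at x)" by simp
  then show ?thesis
    by (rule has_derivative_transform_within_open[OF _ assms(1,3)])
       (rule linear_euclidean_representation[OF lin])
qed


section \<open>Zero sets of submersions\<close>

text \<open>Let L be the differential of \<open>F\<close> at \<open>x\<close> and s a right inverse
  of it. The map \<open>H y = y + s (F y - L (y - x))\<close> satisfies
  \<open>L (H y - x) = F y\<close> and has the identity as differential at \<open>x\<close>. So
  \<open>H\<close> is a chart in which \<open>F\<close> becomes affine, and \<open>g\<close> is its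
  inverse.\<close>

lemma smooth_straightening:
  fixes F :: "'e::euclidean_space \<Rightarrow> 'b::euclidean_space"
  assumes "open \<Omega>" "smooth_on \<Omega> F" "x \<in> \<Omega>" "F x = 0" "surj (D F x)"
  obtains W V H g where "open W" "W \<subseteq> \<Omega>" "x \<in> W" "open V" "x \<in> V" "smooth_on W H" "H ` W = V"
    "smooth_on V g" "g ` V = W" "g x = x" "H x = x" "\<And>p. p \<in> W \<Longrightarrow> g (H p) = p"
    "\<And>v. D g x v = v" "\<And>y. y \<in> V \<Longrightarrow> F (g y) = D F x (y - x)"
proof -
  let ?L = "D F x"
  have lin: "linear ?L" using linear_D[OF assms(2,3)] .
  obtain s where s: "linear s" "?L \<circ> s = id"
    using linear_surjective_right_inverse[OF lin assms(5)] by blast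
  have Ls: "?L (s z) = z" for z using s(2) by (metis comp_apply id_apply)
  define H where "H = (\<lambda>y. y + s (F y + - ?L (y - x)))"
  have blin: "bounded_linear ?L" "bounded_linear s" using lin s(1) by (simp_all add: linear_conv_bounded_linear)
  have smH: "smooth_on \<Omega> H"
    unfolding H_def
  proof (intro smooth_on_add assms(1,2) smooth_on_linear_comp[OF blin(2)] smooth_on_bounded_linear[OF bounded_linear_ident])
    have "smooth_on \<Omega> (\<lambda>y. - ?L (y + - x))"
      by (intro smooth_on_linear_comp[OF bounded_linear_minus[OF blin(1)] assms(1)] smooth_on_add[OF assms(1)]
          smooth_on_bounded_linear[OF bounded_linear_ident] smooth_on_const)
    then show "smooth_on \<Omega> (\<lambda>y. - ?L (y - x))" by simp
  qed
  have "((\<lambda>y. ?L (y - x)) has_derivative (\<lambda>v. ?L (v - 0))) (at x)"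
    by (intro bounded_linear.has_derivative[OF blin(1)] has_derivative_diff has_derivative_ident has_derivative_const)
  from has_derivative_add[OF has_derivative_ident bounded_linear.has_derivative[OF blin(2)
    has_derivative_add[OF smooth_on_derivative[OF assms(2,3)] has_derivative_minus[OF this]]]]
  have "(H has_derivative (\<lambda>v. v + s (?L v + - ?L (v - 0)))) (at x)" unfolding H_def .
  then have "D H x = (\<lambda>v. v + s (?L v + - ?L (v - 0)))" by (rule D_eqI)
  also have "\<dots> = (\<lambda>v. v)" using linear_0[OF s(1)] by simp
  finally have DH: "D H x = (\<lambda>v. v)" .
  have "inj (D H x)" unfolding DH by (simp add: inj_on_def)
  obtain W V g where *: "open W" "W \<subseteq> \<Omega>" "x \<in> W" "open V" "H ` W = V"
    "\<And>y. y \<in> W \<Longrightarrow> g (H y) = y" "g ` V = W" "\<And>y. y \<in> V \<Longrightarrow> H (g y) = y" "smooth_on V g"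
    using smooth_inverse_function[OF assms(1) smH assms(3) \<open>inj (D H x)\<close>] by metis
  have Hx: "H x = x" using assms(4) linear_0[OF s(1)] linear_0[OF lin] by (simp add: H_def)
  then have xV: "x \<in> V" using *(3,5) by force
  have gx: "g x = x" using *(6)[OF *(3)] Hx by simp
  have "D g x v = v" for v
  proof -
    have "((H \<circ> g) has_derivative (D H (g x) \<circ> D g x)) (at x)"
      using smooth_on_derivative[OF *(9) xV] smooth_on_derivative[OF smH assms(3)] gx
      by (intro diff_chain_at) auto
    then have "((\<lambda>y. y) has_derivative (D H (g x) \<circ> D g x)) (at x)"
      by (rule has_derivative_transform_within_open[OF _ *(4) xV]) (use *(8) in simp)
    then have "(D H (g x) \<circ> D g x) v = v"
      using has_derivative_ident has_derivative_unique by metis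
    then show ?thesis by (simp add: gx DH)
  qed
  moreover have "F (g y) = ?L (y - x)" if "y \<in> V" for y
  proof -
    have "?L (H (g y) - x) = ?L (g y - x) + (F (g y) + - ?L (g y - x))"
      by (simp only: H_def linear_add[OF lin] linear_diff[OF lin] Ls) simp
    then show ?thesis using *(8)[OF that] by simp
  qed
  ultimately show ?thesis
    using that[OF *(1-4) xV smooth_on_subset[OF smH *(2)] *(5,9,7) gx Hx *(6)] by blast
qed

lemma tangent_space_subset_kernel:
  assumes "x \<in> \<Omega>" "F differentiable at x" "\<And>y. y \<in> S \<Longrightarrow> F y = c" "v \<in> tangent_space S x"
  shows "D F x v = 0"
proof -
  obtain \<gamma> e where g: "e > 0" "\<gamma> ` {-e<..<e} \<subseteq> S" "\<gamma> 0 = x" "(\<gamma> has_vector_derivative v) (at 0)"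
    using assms(4) unfolding tangent_space_def by blast
  have "((F \<circ> \<gamma>) has_derivative (D F x \<circ> (\<lambda>t. t *\<^sub>R v))) (at 0)"
    using g(3,4) assms(2) by (intro diff_chain_at) (auto simp: has_vector_derivative_def simp flip: frechet_derivative_works)
  then have "((\<lambda>t. c) has_derivative (D F x \<circ> (\<lambda>t. t *\<^sub>R v))) (at 0)"
    by (rule has_derivative_transform_within_open[OF _ open_greaterThanLessThan[of "-e" e]])
       (use g(1) in simp, use g(2) assms(3) in force)
  then have "(D F x \<circ> (\<lambda>t. t *\<^sub>R v)) = (\<lambda>t. 0)"
    using has_derivative_const has_derivative_unique by blast
  then have "(D F x \<circ> (\<lambda>t. t *\<^sub>R v)) 1 = 0" by metis
  then show ?thesis by simp
qed

text \<open>For the harder inclusion the line \<open>x + t *\<^sub>R v\<close> is pushed through the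
  straightening: \<open>F (g (x + t *\<^sub>R v))\<close> is \<open>t\<close> times the differential
  at \<open>v\<close>, hence zero, and the velocity at 0 is still \<open>v\<close>.\<close>

lemma tangent_space_zero_set:
  fixes F :: "'e::euclidean_space \<Rightarrow> 'b::euclidean_space"
  assumes "open \<Omega>" "smooth_on \<Omega> F" "x \<in> \<Omega>" "F x = 0" "surj (D F x)"
  shows "tangent_space {y \<in> \<Omega>. F y = 0} x = {v. D F x v = 0}"
proof (intro equalityI subsetI)
  fix v assume "v \<in> tangent_space {y \<in> \<Omega>. F y = 0} x"
  with tangent_space_subset_kernel[OF assms(3) smooth_on_differentiable[OF assms(2,3)] _ this, of 0]
  show "v \<in> {v. D F x v = 0}" by simp
next
  fix v assume v: "v \<in> {v. D F x v = 0}"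
  obtain W V H g where *: "W \<subseteq> \<Omega>" "open V" "x \<in> V" "smooth_on V g" "g ` V = W" "g x = x"
    "\<And>v. D g x v = v" "\<And>y. y \<in> V \<Longrightarrow> F (g y) = D F x (y - x)"
    using smooth_straightening[OF assms] by metis
  have lin: "linear (D F x)" using linear_D[OF assms(2,3)] .
  obtain r where r: "r > 0" "ball x r \<subseteq> V" using *(2,3) openE by blast
  \<comment> \<open>The summand 1 admits \<open>v = 0\<close>; for \<open>\<bar>t\<bar> < e\<close>
    the line stays in the ball of radius \<open>r\<close>.\<close>
  define e where "e = r / (norm v + 1)"
  have pos: "norm v + 1 > 0" by (simp add: add_nonneg_pos)
  have e: "e > 0" using r pos by (simp add: e_def)
  have inV: "x + t *\<^sub>R v \<in> V" if "t \<in> {-e<..<e}" for t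
  proof -
    have "\<bar>t\<bar> * norm v \<le> \<bar>t\<bar> * (norm v + 1)" by (intro mult_left_mono) auto
    also have "\<dots> < e * (norm v + 1)" using that pos by (intro mult_strict_right_mono) auto
    also have "\<dots> = r" using pos by (simp add: e_def)
    finally show ?thesis using r(2) by (auto simp: dist_norm)
  qed
  define \<gamma> where "\<gamma> = (\<lambda>t. g (x + t *\<^sub>R v))"
  have "smooth_on {-e<..<e} (\<lambda>t. x + t *\<^sub>R v)"
    by (intro smooth_on_add smooth_on_const smooth_on_bounded_linear bounded_linear_scaleR_left) auto
  then have sm: "smooth_on {-e<..<e} \<gamma>"
    unfolding \<gamma>_def by (rule smooth_on_compose[OF _ *(2) _ _ *(4), rotated 2]) (use inV in auto)
  have "\<gamma> t \<in> {y \<in> \<Omega>. F y = 0}" if "t \<in> {-e<..<e}" for t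
  proof -
    have "F (\<gamma> t) = D F x (t *\<^sub>R v)" using *(8)[OF inV[OF that]] by (simp add: \<gamma>_def)
    then show ?thesis using v linear_scale[OF lin] inV[OF that] *(1,5) by (auto simp: \<gamma>_def)
  qed
  moreover have "(\<gamma> has_vector_derivative v) (at 0)"
  proof -
    have "((\<lambda>t. x + t *\<^sub>R v) has_derivative (\<lambda>t. 0 + t *\<^sub>R v)) (at 0)"
      by (intro has_derivative_add has_derivative_const has_derivative_scaleR_left has_derivative_ident)
    then have "((g \<circ> (\<lambda>t. x + t *\<^sub>R v)) has_derivative (D g x \<circ> (\<lambda>t. 0 + t *\<^sub>R v))) (at 0)"
      using smooth_on_derivative[OF *(4,3)] by (intro diff_chain_at) auto
    then show ?thesis by (simp add: has_vector_derivative_def \<gamma>_def o_def *(7))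
  qed
  ultimately show "v \<in> tangent_space {y \<in> \<Omega>. F y = 0} x"
    unfolding tangent_space_def using e sm *(6) by (auto simp: \<gamma>_def intro!: exI[of _ \<gamma>] exI[of _ e])
qed

text \<open>The constant field \<open>v\<close> is pushed forward by the straightening. As
  \<open>F\<close> composed with \<open>g\<close> is affine, its differential is the same
  everywhere, so the field is tangent to every level set near \<open>x\<close>. Such a field is the
  witness that the second fundamental form needs.\<close>

lemma tangent_extension:
  fixes F :: "'e::euclidean_space \<Rightarrow> 'b::euclidean_space"
  assumes "open \<Omega>" "smooth_on \<Omega> F" "x \<in> \<Omega>" "F x = 0" "surj (D F x)" "D F x v = 0"
  obtains W Y where "open W" "x \<in> W" "W \<subseteq> \<Omega>" "smooth_on W Y" "Y x = v" "\<And>y. y \<in> W \<Longrightarrow> D F y (Y y) = 0"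
proof -
  obtain W V H g where *: "open W" "W \<subseteq> \<Omega>" "x \<in> W" "open V" "x \<in> V" "smooth_on W H" "H ` W = V"
    "smooth_on V g" "g ` V = W" "g x = x" "H x = x" "\<And>p. p \<in> W \<Longrightarrow> g (H p) = p"
    "\<And>v. D g x v = v" "\<And>y. y \<in> V \<Longrightarrow> F (g y) = D F x (y - x)"
    by (rule smooth_straightening[OF assms(1-5)]) (rule that; assumption)
  have blin: "bounded_linear (D F x)" using smooth_on_derivative[OF assms(2,3)] by (rule has_derivative_bounded_linear)
  have "smooth_on W (\<lambda>y. D g (H y) v)"
    by (rule smooth_on_compose[OF *(1,4) _ *(6) smooth_on_D[OF *(8)]]) (use *(7) in auto)
  moreover have "D F p (D g (H p) v) = 0" if p: "p \<in> W" for p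
  proof -
    have Hp: "H p \<in> V" and gp: "g (H p) = p" using *(7,12) p by auto
    have "((F \<circ> g) has_derivative (D F (g (H p)) \<circ> D g (H p))) (at (H p))"
      using smooth_on_derivative[OF *(8) Hp] smooth_on_derivative[OF assms(2), of p] gp p *(2)
      by (intro diff_chain_at) auto
    then have "((\<lambda>y. D F x (y - x)) has_derivative (D F p \<circ> D g (H p))) (at (H p))"
      unfolding gp by (rule has_derivative_transform_within_open[OF _ *(4) Hp]) (use *(14) in simp)
    moreover have "((\<lambda>y. D F x (y - x)) has_derivative (\<lambda>w. D F x (w - 0))) (at (H p))"
      by (intro bounded_linear.has_derivative[OF blin] has_derivative_diff has_derivative_ident has_derivative_const)
    ultimately have "D F p \<circ> D g (H p) = (\<lambda>w. D F x (w - 0))" by (rule has_derivative_unique)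
    then show ?thesis using assms(6) by (metis comp_apply diff_zero)
  qed
  ultimately show ?thesis using that[OF *(1,3,2)] *(11,13) by simp
qed


section \<open>Mean curvature of the zero set of a linear function on an immersed manifold\<close>

text \<open>A coordinate domain \<open>\<Omega>\<close> immersed by \<open>\<psi>\<close> in a Euclidean space and carrying \<open>\<kappa>\<close> times the
  induced metric. The vector \<open>II x u\<close> is the component of \<open>D\<^sup>2\<psi>(u,u)\<close> normal to the image, so that
  \<open>l (II x u)\<close> is the Hessian of \<open>l \<circ> \<psi>\<close> at \<open>u\<close>.\<close>

locale immersed_zero_set =
  fixes \<Omega> :: "'e::euclidean_space set" and \<psi> :: "'e \<Rightarrow> 'v::euclidean_space"
    and l :: "'v \<Rightarrow> 'b::euclidean_space" and \<kappa> :: real and h :: "'e metric"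
  assumes open_dom: "open \<Omega>" and smooth: "smooth_on \<Omega> \<psi>" and linear_l: "linear l" and \<kappa>: "\<kappa> > 0"
    and h: "\<And>x u v. x \<in> \<Omega> \<Longrightarrow> h x u v = \<kappa> * (D \<psi> x u \<bullet> D \<psi> x v)"
    and immersion: "\<And>x. x \<in> \<Omega> \<Longrightarrow> inj (D \<psi> x)"
    and regular: "\<And>x. x \<in> \<Omega> \<Longrightarrow> l (\<psi> x) = 0 \<Longrightarrow> surj (\<lambda>u. l (D \<psi> x u))"
begin

definition S :: "'e set" where "S = {y \<in> \<Omega>. l (\<psi> y) = 0}"

definition K :: "'e \<Rightarrow> 'e set" where "K x = {v. l (D \<psi> x v) = 0}"

definition D2 :: "'e \<Rightarrow> 'e \<Rightarrow> 'e \<Rightarrow> 'v" where "D2 x u v = D (\<lambda>y. D \<psi> y u) x v"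

lemma bounded_linear_l: "bounded_linear l" using linear_l by (simp add: linear_conv_bounded_linear)

lemma lin: "x \<in> \<Omega> \<Longrightarrow> linear (D \<psi> x)" using linear_D[OF smooth] .

lemma smooth_F: "smooth_on \<Omega> (\<lambda>y. l (\<psi> y))"
  by (rule smooth_on_linear_comp[OF bounded_linear_l open_dom smooth])

lemma DF: "x \<in> \<Omega> \<Longrightarrow> D (\<lambda>y. l (\<psi> y)) x v = l (D \<psi> x v)"
  by (rule D_linear_comp[OF bounded_linear_l smooth_on_differentiable[OF smooth]])

lemma D2_sym: "x \<in> \<Omega> \<Longrightarrow> D2 x u v = D2 x v u"
  unfolding D2_def by (rule D_symmetric[OF open_dom smooth])

lemma surj_DF: "x \<in> S \<Longrightarrow> surj (D (\<lambda>y. l (\<psi> y)) x)"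
  using regular[of x] DF[of x] unfolding S_def by (simp add: surj_def)

lemma tangent_space_S: "x \<in> S \<Longrightarrow> tangent_space S x = K x"
  using tangent_space_zero_set[OF open_dom smooth_F _ _ surj_DF, of x] DF[of x]
  by (auto simp: S_def K_def)

lemma subspace_K: "x \<in> \<Omega> \<Longrightarrow> subspace (K x)"
  unfolding K_def using linear_compose[OF lin linear_l, of x] linear_subspace_kernel by (simp add: o_def)

lemma metric_nondegenerate: "x \<in> \<Omega> \<Longrightarrow> h x z z = 0 \<Longrightarrow> z = 0"
  using immersion[of x] \<kappa> linear_0[OF lin[of x]] by (simp add: h) (metis injD)

lemma metric_diff: "x \<in> \<Omega> \<Longrightarrow> h x (a - b) v = h x a v - h x b v"
  by (simp add: h linear_diff[OF lin] algebra_simps)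

lemma metric_deriv:
  assumes "x \<in> \<Omega>"
  shows "metric_deriv h x w u v = \<kappa> * (D2 x u w \<bullet> D \<psi> x v + D \<psi> x u \<bullet> D2 x v w)"
proof -
  have d: "((\<lambda>y. D \<psi> y a) has_derivative D2 x a) (at x)" for a
    unfolding D2_def using smooth_on_derivative[OF smooth_on_D[OF smooth] assms] .
  have "((\<lambda>y. \<kappa> * (D \<psi> y u \<bullet> D \<psi> y v)) has_derivative
     (\<lambda>w. \<kappa> * (D \<psi> x u \<bullet> D2 x v w + D2 x u w \<bullet> D \<psi> x v))) (at x)"
    by (intro has_derivative_mult_right has_derivative_inner d)
  note D_eqI[OF this]
  moreover have "D (\<lambda>y. h y u v) x = D (\<lambda>y. \<kappa> * (D \<psi> y u \<bullet> D \<psi> y v)) x"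
    by (rule D_cong[OF open_dom assms]) (simp add: h)
  ultimately show ?thesis by (simp add: metric_deriv_def algebra_simps)
qed

text \<open>For a multiple of a pulled back metric the Koszul expression collapses to
  \<open>\<kappa> * (D2 x u v \<bullet> D \<psi> x w)\<close>. The Christoffel symbol is therefore
  the preimage of the tangential part of the second derivative.\<close>

lemma christoffel_normal:
  assumes "x \<in> \<Omega>"
  shows "(D2 x u v - D \<psi> x (christoffel h x u v)) \<bullet> D \<psi> x w = 0"
proof -
  let ?P = "\<lambda>z. \<forall>w. h x z w =
     (metric_deriv h x u v w + metric_deriv h x v u w - metric_deriv h x w u v) / 2"
  have koszul: "(metric_deriv h x u v w + metric_deriv h x v u w - metric_deriv h x w u v) / 2 =
      \<kappa> * (D2 x u v \<bullet> D \<psi> x w)" for w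
    unfolding metric_deriv[OF assms]
    by (simp add: D2_sym[OF assms, of v u] D2_sym[OF assms, of w] inner_commute algebra_simps)
  have sub: "span (range (D \<psi> x)) = range (D \<psi> x)"
    using lin[OF assms] linear_subspace_image span_eq_iff subspace_UNIV by blast
  obtain t n where tn: "t \<in> range (D \<psi> x)" "\<And>w. w \<in> range (D \<psi> x) \<Longrightarrow> orthogonal n w"
    "D2 x u v = t + n"
    using orthogonal_subspace_decomp_exists[of "range (D \<psi> x)" "D2 x u v"] unfolding sub by blast
  then obtain z where z: "t = D \<psi> x z" by blast
  have "?P z" unfolding koszul using tn z by (auto simp: h assms inner_add_left orthogonal_def)
  moreover have "z' = z" if "?P z'" for z'
  proof -
    have "h x (z' - z) (z' - z) = 0" using that \<open>?P z\<close> by (simp only: metric_diff[OF assms])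
    then show ?thesis using metric_nondegenerate[OF assms] by fastforce
  qed
  ultimately have "christoffel h x u v = z" unfolding christoffel_def by (rule the_equality)
  then show ?thesis using tn z by (auto simp: orthogonal_def)
qed

lemma normal_part:
  assumes "x \<in> \<Omega>" "subspace T"
  shows "(\<forall>v\<in>T. h x (normal_part h x T w) v = 0) \<and> w - normal_part h x T w \<in> T"
proof -
  let ?P = "\<lambda>z. (\<forall>v\<in>T. h x z v = 0) \<and> w - z \<in> T"
  have sub: "span (D \<psi> x ` T) = D \<psi> x ` T"
    using lin[OF assms(1)] linear_subspace_image assms(2) span_eq_iff by blast
  obtain t n where tn: "t \<in> D \<psi> x ` T" "\<And>w. w \<in> D \<psi> x ` T \<Longrightarrow> orthogonal n w" "D \<psi> x w = t + n"
    using orthogonal_subspace_decomp_exists[of "D \<psi> x ` T" "D \<psi> x w"] unfolding sub by blast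
  then obtain t0 where t0: "t0 \<in> T" "t = D \<psi> x t0" by blast
  then have "D \<psi> x (w - t0) = n" using tn(3) by (simp add: linear_diff[OF lin[OF assms(1)]])
  then have P: "?P (w - t0)" using tn(2) t0 by (auto simp: h assms orthogonal_def)
  moreover have "z = w - t0" if "?P z" for z
  proof -
    have "z - (w - t0) \<in> T"
      using subspace_diff[OF assms(2), of "w - (w - t0)" "w - z"] that P by (simp add: algebra_simps)
    then have "h x (z - (w - t0)) (z - (w - t0)) = 0"
      using that P by (simp only: metric_diff[OF assms(1), of z])
    then show ?thesis using metric_nondegenerate[OF assms(1)] by fastforce
  qed
  ultimately have "\<exists>!z. ?P z" by blast
  then show ?thesis unfolding normal_part_def by (rule theI')
qed

text \<open>Let \<open>Y\<close> be tangent along \<open>S\<close>. Differentiating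
  \<open>l (D \<psi> y (Y y)) = 0\<close> in the direction \<open>u\<close> expresses
  \<open>l\<close> of the image of the covariant derivative by the Hessian, with no trace of
  \<open>Y\<close> except its value \<open>v\<close>. A vector normal to \<open>K x\<close> is
  determined by this value, since \<open>K x\<close> is the kernel; so the defining description has
  exactly one solution.\<close>

lemma second_fundamental_form:
  assumes "x \<in> S" "u \<in> K x" "v \<in> K x"
  shows "(\<forall>w\<in>K x. h x (second_fundamental_form h S x u v) w = 0) \<and>
    l (D \<psi> x (second_fundamental_form h S x u v)) = - l (D2 x u v - D \<psi> x (christoffel h x u v))"
proof -
  let ?Q = "\<lambda>b. (\<forall>w\<in>K x. h x b w = 0) \<and> l (D \<psi> x b) = - l (D2 x u v - D \<psi> x (christoffel h x u v))"
  let ?P = "\<lambda>b. \<exists>V Y. open V \<and> x \<in> V \<and> smooth_on V Y \<and>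
     (\<forall>y\<in>S \<inter> V. Y y \<in> tangent_space S y) \<and> Y x = v \<and>
     b = normal_part h x (tangent_space S x) (cov_deriv h Y x u)"
  have x: "x \<in> \<Omega>" "l (\<psi> x) = 0" using assms(1) by (auto simp: S_def)
  have sub: "subspace (K x)" by (rule subspace_K[OF x(1)])
  have uniq: "b = b'" if "?Q b" "?Q b'" for b b'
  proof -
    have "l (D \<psi> x (b - b')) = 0"
      using that by (simp add: linear_diff[OF lin[OF x(1)]] linear_diff[OF linear_l])
    then have "b - b' \<in> K x" by (simp add: K_def)
    then have "h x (b - b') (b - b') = 0" using that metric_diff[OF x(1), of b b'] by auto
    then show ?thesis using metric_nondegenerate[OF x(1)] by fastforce
  qed
  have PQ: "?Q b" if "?P b" for b
  proof -
    obtain V Y where Y: "open V" "x \<in> V" "smooth_on V Y" "\<And>y. y \<in> S \<inter> V \<Longrightarrow> Y y \<in> tangent_space S y"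
      "Y x = v" "b = normal_part h x (K x) (cov_deriv h Y x u)"
      using \<open>?P b\<close> unfolding tangent_space_S[OF assms(1)] by blast
    have n: "\<forall>w\<in>K x. h x b w = 0" "cov_deriv h Y x u - b \<in> K x"
      using normal_part[OF x(1) sub, of "cov_deriv h Y x u"] unfolding Y(6) by blast+
    have dY: "(Y has_derivative D Y x) (at x)" by (rule smooth_on_derivative[OF Y(3,2)])
    have dG: "((\<lambda>y. l (D \<psi> y (Y y))) has_derivative (\<lambda>u. l (D2 x u (Y x) + D \<psi> x (D Y x u)))) (at x)"
      unfolding D2_def
      by (rule bounded_linear.has_derivative[OF bounded_linear_l has_derivative_D_apply[OF open_dom smooth x(1) dY]])
    have "l (D \<psi> y (Y y)) = 0" if "y \<in> S \<inter> V" for y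
      using Y(4)[OF that] tangent_space_S[of y] that by (simp add: K_def)
    \<comment> \<open>The function to be differentiated vanishes on \<open>S \<inter> V\<close>
      only, so the curve with velocity \<open>u\<close> has to stay in \<open>V\<close>. It comes
      from the zero set in the smaller domain \<open>\<Omega> \<inter> V\<close>.\<close>
    moreover have "u \<in> tangent_space (S \<inter> V) x"
    proof -
      have "tangent_space {y \<in> \<Omega> \<inter> V. l (\<psi> y) = 0} x = {v. D (\<lambda>y. l (\<psi> y)) x v = 0}"
        by (rule tangent_space_zero_set)
           (use open_dom Y x surj_DF[OF assms(1)] smooth_on_subset[OF smooth_F] in auto)
      moreover have "{y \<in> \<Omega> \<inter> V. l (\<psi> y) = 0} = S \<inter> V" by (auto simp: S_def)
      ultimately show ?thesis using assms(2) by (simp add: DF x K_def)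
    qed
    ultimately have "D (\<lambda>y. l (D \<psi> y (Y y))) x u = 0"
      using dG by (intro tangent_space_subset_kernel[of x UNIV _ "S \<inter> V" 0]) (auto simp: differentiable_def)
    then have "l (D2 x u v + D \<psi> x (D Y x u)) = 0" using D_eqI[OF dG] Y(5) by simp
    then have "l (D \<psi> x (cov_deriv h Y x u)) = - l (D2 x u v - D \<psi> x (christoffel h x u v))"
      by (simp add: cov_deriv_def Y(5) linear_add[OF lin[OF x(1)]] linear_add[OF linear_l]
          linear_diff[OF linear_l] eq_neg_iff_add_eq_0 add.commute)
    moreover have "l (D \<psi> x (cov_deriv h Y x u)) = l (D \<psi> x b)"
      using n(2) by (simp add: K_def linear_diff[OF lin[OF x(1)]] linear_diff[OF linear_l])
    ultimately show ?thesis using n(1) by simp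
  qed
  obtain W Y where WY: "open W" "x \<in> W" "W \<subseteq> \<Omega>" "smooth_on W Y" "Y x = v"
    "\<And>y. y \<in> W \<Longrightarrow> D (\<lambda>y. l (\<psi> y)) y (Y y) = 0"
    by (rule tangent_extension[OF open_dom smooth_F x surj_DF[OF assms(1)], of v])
       (use assms(3) in \<open>auto simp: K_def DF x\<close>)
  have "Y y \<in> tangent_space S y" if "y \<in> S \<inter> W" for y
    using WY(6)[of y] that WY(3) by (simp add: tangent_space_S K_def DF subset_iff)
  then have ex: "\<exists>b. ?P b" using WY by blast
  then have "\<exists>!b. ?P b" using uniq PQ by blast
  then have "?P (second_fundamental_form h S x u v)"
    unfolding second_fundamental_form_def by (rule theI')
  then show ?thesis by (rule PQ)
qed

text \<open>An orthonormal basis of the image of \<open>T\<close> is pulled back by a left inverse;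
  \<open>1 / sqrt \<kappa>\<close> undoes the factor \<open>\<kappa>\<close> of \<open>h\<close>.
  Without such a basis the description of the mean curvature would denote nothing.\<close>

lemma orthonormal_basis_exists:
  assumes "x \<in> \<Omega>" "subspace T"
  shows "\<exists>E. orthonormal_basis h x T E"
proof -
  have "subspace (D \<psi> x ` T)" using lin[OF assms(1)] linear_subspace_image assms(2) by blast
  then obtain B where B: "B \<subseteq> D \<psi> x ` T" "pairwise orthogonal B" "\<And>x. x \<in> B \<Longrightarrow> norm x = 1"
    "independent B" "span B = D \<psi> x ` T"
    using orthonormal_basis_subspace by metis
  obtain L where L: "linear L" "L \<circ> D \<psi> x = id"
    using linear_injective_left_inverse[OF lin[OF assms(1)] immersion[OF assms(1)]] by blast
  have LD: "L (D \<psi> x v) = v" for v using L(2) by (metis comp_apply id_apply)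
  have DL: "D \<psi> x (L b) = b" if "b \<in> D \<psi> x ` T" for b using that LD by auto
  let ?f = "\<lambda>b. (1 / sqrt \<kappa>) *\<^sub>R L b"
  have linf: "linear ?f" using L(1) by (simp add: linear_compose_scale_right)
  have TL: "L b \<in> T" if "b \<in> D \<psi> x ` T" for b using that LD by auto
  have hf: "h x (?f a) (?f b) = a \<bullet> b" if "a \<in> B" "b \<in> B" for a b
    using that B(1) \<kappa> by (simp add: h assms(1) linear_scale[OF lin[OF assms(1)]] DL subset_iff)
  have "orthonormal_basis h x T (?f ` B)"
    unfolding orthonormal_basis_def
  proof (intro conjI ballI)
    show "finite (?f ` B)" using B(4) independent_imp_finite by blast
    show "?f ` B \<subseteq> T" using B(1) TL subspace_scale[OF assms(2)] by blast
    show "T \<subseteq> span (?f ` B)"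
    proof
      fix v assume v: "v \<in> T"
      have "sqrt \<kappa> *\<^sub>R D \<psi> x v \<in> D \<psi> x ` T"
        using v subspace_scale[OF assms(2)] linear_scale[OF lin[OF assms(1)], of "sqrt \<kappa>" v] by (metis imageI)
      then have "?f (sqrt \<kappa> *\<^sub>R D \<psi> x v) \<in> ?f ` span B" using B(5) by blast
      moreover have "?f (sqrt \<kappa> *\<^sub>R D \<psi> x v) = v" using \<kappa> by (simp add: linear_scale[OF L(1)] LD)
      ultimately show "v \<in> span (?f ` B)" using linear_span_image[OF linf] by simp
    qed
  next
    fix e f assume "e \<in> ?f ` B" "f \<in> ?f ` B"
    then obtain a b where ab: "a \<in> B" "b \<in> B" "e = ?f a" "f = ?f b" by blast
    show "h x e f = (if e = f then 1 else 0)"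
    proof (cases "a = b")
      case True
      then show ?thesis using ab hf[OF ab(1,2)] B(3)[OF ab(1)] by (simp add: dot_square_norm)
    next
      case False
      then have "h x e f = 0"
        using ab hf[OF ab(1,2)] B(2) by (simp add: pairwise_def orthogonal_def)
      moreover have "e \<noteq> f" using calculation hf[OF ab(1,1)] B(3)[OF ab(1)] ab by (auto simp: dot_square_norm)
      ultimately show ?thesis by simp
    qed
  qed
  then show ?thesis by blast
qed

text \<open>The sum over any orthonormal basis is normal to \<open>K x\<close>. Its image under
  \<open>l\<close> is minus the sum of the \<open>l (II e)\<close>, which is zero, so the sum also
  lies in \<open>K x\<close> and vanishes. As every basis gives zero, the invariance of the trace
  comes for free.\<close>

lemma mean_curvature_zero:
  assumes "x \<in> S"
    and II: "\<And>u. D2 x u u - II u \<in> range (D \<psi> x)" "\<And>u w. II u \<bullet> D \<psi> x w = 0"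
    and tr: "\<And>E. orthonormal_basis h x (K x) E \<Longrightarrow> (\<Sum>e\<in>E. l (II e)) = 0"
  shows "mean_curvature h S x = 0"
proof -
  have x: "x \<in> \<Omega>" "l (\<psi> x) = 0" using assms(1) by (auto simp: S_def)
  have II_eq: "D2 x u u - D \<psi> x (christoffel h x u u) = II u" for u
  proof -
    let ?d = "D2 x u u - D \<psi> x (christoffel h x u u) - II u"
    obtain w where w: "D2 x u u - II u = D \<psi> x w" using II(1) by blast
    then have "?d = D \<psi> x (w - christoffel h x u u)"
      by (simp add: linear_diff[OF lin[OF x(1)]] algebra_simps)
    moreover have "?d \<bullet> D \<psi> x w' = 0" for w'
      using christoffel_normal[OF x(1)] II(2) by (simp add: inner_diff_left)
    ultimately have "?d \<bullet> ?d = 0" by metis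
    then show ?thesis by simp
  qed
  have sum0: "(\<Sum>e\<in>E. second_fundamental_form h S x e e) = 0" if E: "orthonormal_basis h x (K x) E" for E
  proof -
    have EK: "e \<in> K x" if "e \<in> E" for e using E that by (auto simp: orthonormal_basis_def)
    let ?b = "\<Sum>e\<in>E. second_fundamental_form h S x e e"
    have "l (D \<psi> x ?b) = (\<Sum>e\<in>E. - l (II e))"
      unfolding linear_sum[OF lin[OF x(1)]] linear_sum[OF linear_l]
      by (rule sum.cong) (use second_fundamental_form[OF assms(1) EK EK] II_eq in auto)
    then have "?b \<in> K x" using tr[OF E] by (simp add: K_def sum_negf)
    moreover have "h x ?b w = 0" if "w \<in> K x" for w
    proof -
      have "h x ?b w = (\<Sum>e\<in>E. h x (second_fundamental_form h S x e e) w)"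
        by (simp add: h x linear_sum[OF lin[OF x(1)]] inner_sum_left sum_distrib_left)
      also have "\<dots> = 0"
        by (rule sum.neutral) (use second_fundamental_form[OF assms(1) EK EK] that in auto)
      finally show ?thesis .
    qed
    ultimately show ?thesis using metric_nondegenerate[OF x(1)] by blast
  qed
  show ?thesis
    unfolding mean_curvature_def tangent_space_S[OF assms(1)]
    using orthonormal_basis_exists[OF x(1) subspace_K[OF x(1)]] sum0
    by (intro the_equality) metis+
qed

end


section \<open>Complex matrices\<close>

type_synonym 'm cmat = "complex ^ 'm ^ 'm"

abbreviation cj :: "complex ^ 'n ^ 'm \<Rightarrow> complex ^ 'n ^ 'm" where
  "cj A \<equiv> map_matrix cnj A"

definition adj :: "'m::finite cmat \<Rightarrow> 'm cmat" where
  "adj A = transpose (cj A)"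

lemma bounded_bilinear_mm:
  "bounded_bilinear ((**) :: 'm::finite cmat \<Rightarrow> 'm cmat \<Rightarrow> 'm cmat)"
proof -
  have "bilinear ((**) :: 'm cmat \<Rightarrow> 'm cmat \<Rightarrow> 'm cmat)"
    unfolding bilinear_def linear_iff
    by (simp add: vec_eq_iff matrix_matrix_mult_def algebra_simps sum.distrib scaleR_sum_right)
  then show ?thesis by (simp add: bilinear_conv_bounded_bilinear)
qed

interpretation mm: bounded_bilinear "(**) :: 'm::finite cmat \<Rightarrow> 'm cmat \<Rightarrow> 'm cmat"
  by (rule bounded_bilinear_mm)

lemmas mm_simps = mm.add_left mm.add_right mm.diff_left mm.diff_right mm.minus_left mm.minus_right
  mm.scaleR_left mm.scaleR_right mm.zero_left mm.zero_right

lemma cj_mult: "cj (A ** B) = cj A ** cj (B :: 'm::finite cmat)"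
  by (simp add: vec_eq_iff matrix_matrix_mult_def)

lemma cj_simps [simp]:
  "cj (A + B) = cj A + cj B" "cj (A - B) = cj A - cj B" "cj (- A) = - cj A" "cj (r *\<^sub>R A) = r *\<^sub>R cj A"
  "cj (cj A) = A" "cj (0 :: 'm::finite cmat) = 0"
  for A B :: "'m::finite cmat"
  by (simp_all add: vec_eq_iff)

lemma cj_mat_1 [simp]: "cj (mat 1 :: 'm::finite cmat) = mat 1"
  by (simp add: vec_eq_iff mat_def)

lemma transpose_simps [simp]:
  "transpose (A + B) = transpose A + transpose B" "transpose (A - B) = transpose A - transpose B"
  "transpose (- A) = - transpose A" "transpose (0 :: 'm::finite cmat) = 0"
  "transpose (cj A) = cj (transpose A)"
  for A B :: "'m::finite cmat"
  by (simp_all add: vec_eq_iff transpose_def)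

lemma adj_mult: "adj (A ** B) = adj B ** adj A"
  by (simp add: adj_def cj_mult matrix_transpose_mul del: transpose_simps(5))

lemma adj_simps [simp]:
  "adj (A + B) = adj A + adj B" "adj (A - B) = adj A - adj B" "adj (- A) = - adj A"
  "adj (r *\<^sub>R A) = r *\<^sub>R adj A" "adj (adj A) = A" "adj (mat 1 :: 'm::finite cmat) = mat 1"
  "adj (cj A) = cj (adj A)" "adj (0 :: 'm::finite cmat) = 0"
  for A B :: "'m::finite cmat"
  by (simp_all add: adj_def transpose_scalar)

lemma linear_cj: "linear (cj :: 'm::finite cmat \<Rightarrow> 'm cmat)"
  by (simp add: linear_iff)

lemma linear_adj: "linear (adj :: 'm::finite cmat \<Rightarrow> 'm cmat)"
  by (simp add: linear_iff)

lemma linear_transpose: "linear (transpose :: 'm::finite cmat \<Rightarrow> 'm cmat)"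
  by (simp add: linear_iff transpose_scalar)

text \<open>The Euclidean inner product of the matrix type is thus the one that defines the metric
  of \<open>Sp\<close>, so norms and orthogonality can be used directly.\<close>

lemma inner_cmat: "A \<bullet> B = Re (trace (A ** adj B))"
  by (simp add: inner_vec_def trace_def matrix_matrix_mult_def adj_def transpose_def inner_complex_def)

lemma inner_mult_left: "(C ** A) \<bullet> B = A \<bullet> (adj C ** B)" for A B C :: "'m::finite cmat"
proof -
  have "trace (C ** A ** adj B) = trace (A ** (adj B ** C))"
    by (metis matrix_mul_assoc trace_mul_sym)
  then show ?thesis by (simp add: inner_cmat adj_mult)
qed

lemma inner_mult_right: "(A ** C) \<bullet> B = A \<bullet> (B ** adj C)" for A B C :: "'m::finite cmat"
  by (simp add: inner_cmat adj_mult matrix_mul_assoc)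

lemma inner_cj: "cj A \<bullet> cj B = A \<bullet> B"
  by (simp add: inner_vec_def inner_complex_def)

lemma inverse_unique: "A ** B = mat 1 \<Longrightarrow> C ** A = mat 1 \<Longrightarrow> B = C" for A B C :: "'m::finite cmat"
  by (metis matrix_mul_assoc matrix_mul_lid matrix_mul_rid)

lemma matrix_inv_eqI: "B ** A = mat 1 \<Longrightarrow> matrix_inv A = B" for A B :: "'m::finite cmat"
  unfolding matrix_inv_def
  by (rule some_equality) (use matrix_left_right_inverse inverse_unique in \<open>blast+\<close>)


section \<open>The Lie algebra of \<open>Sp(n)\<close>\<close>

definition J :: "'n::finite cmat2" where "J = block 0 (mat 1) (- mat 1) 0"

text \<open>Multiplication by \<open>J\<close> after conjugation is the quaternionic structure; the matrices commuting
  with it are those of the block form in the definition of \<open>Sp(n)\<close>.\<close>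

definition quat :: "'n::finite cmat2 \<Rightarrow> bool" where "quat A \<longleftrightarrow> J ** cj A = A ** J"

lemma sum_mat_1:
  fixes f :: "'n::finite \<Rightarrow> complex"
  shows "(\<Sum>l\<in>UNIV. mat 1 $ k $ l * f l) = f k" "(\<Sum>l\<in>UNIV. f l * mat 1 $ l $ k) = f k"
proof -
  have "mat 1 $ k $ l * f l = (if l = k then f l else 0)" "f l * mat 1 $ l $ k = (if l = k then f l else 0)" for l
    by (simp_all add: mat_def)
  then show "(\<Sum>l\<in>UNIV. mat 1 $ k $ l * f l) = f k" "(\<Sum>l\<in>UNIV. f l * mat 1 $ l $ k) = f k"
    by simp_all
qed

lemma J_mult:
  "(J ** A) $ Inl k $ j = A $ Inr k $ j" "(J ** A) $ Inr k $ j = - A $ Inl k $ j"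
  "(A ** J) $ i $ Inl l = - A $ i $ Inr l" "(A ** J) $ i $ Inr l = A $ i $ Inl l"
  by (simp_all add: matrix_matrix_mult_def sum_Plus_UNIV J_def sum_mat_1 sum_negf)

lemma J_facts [simp]: "cj J = (J :: 'n::finite cmat2)" "transpose J = - (J :: 'n cmat2)" "adj J = - (J :: 'n cmat2)"
  and J_J: "J ** J = - (mat 1 :: 'n cmat2)"
proof -
  show 1: "cj J = (J :: 'n cmat2)"
  proof -
    have "cj J $ i $ j = (J :: 'n cmat2) $ i $ j" for i j by (cases i; cases j) (simp_all add: J_def mat_def)
    then show ?thesis by (simp add: vec_eq_iff)
  qed
  show 2: "transpose J = - (J :: 'n cmat2)"
  proof -
    have "transpose J $ i $ j = (- (J :: 'n cmat2)) $ i $ j" for i j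
      by (cases i; cases j) (simp_all add: J_def mat_def transpose_def)
    then show ?thesis by (simp add: vec_eq_iff)
  qed
  show "adj J = - (J :: 'n cmat2)" by (simp add: adj_def 1 2 del: transpose_simps)
  have "(J ** J) $ i $ j = (- (mat 1 :: 'n cmat2)) $ i $ j" for i j
    by (cases i; cases j) (simp_all add: J_mult, simp_all add: J_def mat_def)
  then show "J ** J = - (mat 1 :: 'n cmat2)" by (simp add: vec_eq_iff)
qed

lemma quat_iff: "quat q \<longleftrightarrow> (\<exists>z w. q = block z w (- cj w) (cj z))"
proof
  assume q: "quat q"
  let ?z = "\<chi> k l. q $ Inl k $ Inl l" and ?w = "\<chi> k l. q $ Inl k $ Inr l"
  have e: "(J ** cj q) $ i $ j = (q ** J) $ i $ j" for i j using q by (simp add: quat_def)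
  have "q $ i $ j = block ?z ?w (- cj ?w) (cj ?z) $ i $ j" for i j
  proof (cases i; cases j)
    fix k l assume "i = Inr k" "j = Inl l"
    then show ?thesis using e[of "Inr k" "Inr l"] by (simp add: J_mult)
  next
    fix k l assume "i = Inr k" "j = Inr l"
    then show ?thesis using e[of "Inr k" "Inl l"] by (simp add: J_mult)
  qed simp_all
  then show "\<exists>z w. q = block z w (- cj w) (cj z)" by (metis vec_eq_iff)
next
  assume "\<exists>z w. q = block z w (- cj w) (cj z)"
  then obtain z w where q: "q = block z w (- cj w) (cj z)" by blast
  have "(J ** cj q) $ i $ j = (q ** J) $ i $ j" for i j
    by (cases i; cases j) (simp_all add: J_mult q)
  then show "quat q" unfolding quat_def by (simp add: vec_eq_iff)
qed

lemma quat_mult: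
  assumes "quat A" "quat B" shows "quat (A ** B)"
proof -
  have "J ** cj (A ** B) = (J ** cj A) ** cj B" by (simp only: cj_mult matrix_mul_assoc)
  also have "\<dots> = A ** (J ** cj B)" using assms(1) by (simp only: quat_def matrix_mul_assoc)
  also have "\<dots> = (A ** B) ** J" using assms(2) by (simp only: quat_def matrix_mul_assoc)
  finally show ?thesis by (simp only: quat_def)
qed

lemma quat_simps:
  "quat (mat 1)" "quat A \<Longrightarrow> quat B \<Longrightarrow> quat (A + B)" "quat A \<Longrightarrow> quat B \<Longrightarrow> quat (A - B)"
  "quat A \<Longrightarrow> quat (- A)" "quat A \<Longrightarrow> quat (r *\<^sub>R A)"
  by (simp_all add: quat_def mm_simps)

lemma quat_cj:
  assumes "quat A" shows "quat (cj A)"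
proof -
  have "cj (J ** cj A) = cj (A ** J)" using assms by (simp add: quat_def)
  then show ?thesis by (simp add: quat_def cj_mult)
qed

lemma quat_adj: "quat A \<Longrightarrow> quat (adj A)"
proof -
  assume "quat A"
  then have "adj (J ** cj A) = adj (A ** J)" by (simp add: quat_def)
  then have "cj (adj A) ** J = J ** adj A" by (simp add: adj_mult mm_simps)
  then have "quat (cj (adj A))" by (simp add: quat_def)
  then show "quat (adj A)" using quat_cj by fastforce
qed

lemma Sp_iff: "q \<in> Sp \<longleftrightarrow> adj q ** q = mat 1 \<and> quat q"
  unfolding Sp_def unitary_def quat_iff adj_def[symmetric]
  using matrix_left_right_inverse[of q "adj q"] by auto

lemma SpD:
  assumes "q \<in> Sp" shows "adj q ** q = mat 1" "q ** adj q = mat 1" "quat q"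
    "transpose q ** cj q = mat 1" "cj q ** transpose q = mat 1"
proof -
  show 1: "adj q ** q = mat 1" "quat q" using assms by (auto simp: Sp_iff)
  show 2: "q ** adj q = mat 1" using 1 matrix_left_right_inverse by blast
  show "transpose q ** cj q = mat 1" using arg_cong[OF 1(1), of cj] by (simp add: cj_mult adj_def)
  show "cj q ** transpose q = mat 1" using arg_cong[OF 2, of cj] by (simp add: cj_mult adj_def)
qed

lemma quat_transpose: "q \<in> Sp \<Longrightarrow> quat (transpose q)"
  using quat_cj[OF quat_adj[OF SpD(3)]] by (simp add: adj_def)

lemma quat_square: "q \<in> Sp \<Longrightarrow> quat (q ** transpose q)"
  by (intro quat_mult SpD(3) quat_transpose)

lemma transpose_square: "transpose (q ** transpose q) = q ** transpose (q :: 'm::finite cmat)"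
  by (simp add: matrix_transpose_mul)

lemma Sp_mult:
  assumes "q \<in> Sp" "k \<in> Sp" shows "q ** k \<in> Sp"
proof -
  have "adj (q ** k) ** (q ** k) = adj k ** (adj q ** q) ** k" by (simp only: adj_mult matrix_mul_assoc)
  then show ?thesis using assms by (simp add: Sp_iff quat_mult)
qed

lemma Sp_adj: "q \<in> Sp \<Longrightarrow> adj q \<in> Sp"
  using SpD(2,3)[of q] by (simp add: Sp_iff quat_adj)

text \<open>\<open>U(n)\<close> is the fixed group of complex conjugation on \<open>Sp(n)\<close>,
  the involution that makes the quotient a symmetric space.\<close>

lemma Ugroup_iff: "k \<in> Ugroup \<longleftrightarrow> k \<in> Sp \<and> cj k = k"
proof
  assume k: "k \<in> Ugroup"
  then obtain x y where xy: "k = map_matrix complex_of_real (block x y (- y) x)"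
    unfolding Ugroup_def by blast
  have "k $ i $ j = block (map_matrix complex_of_real x) (map_matrix complex_of_real y)
     (- cj (map_matrix complex_of_real y)) (cj (map_matrix complex_of_real x)) $ i $ j" for i j
    by (cases i; cases j) (simp_all add: xy)
  then have "quat k" unfolding quat_iff by (metis vec_eq_iff)
  moreover have r: "cj k = k" by (simp add: xy vec_eq_iff)
  moreover have "k ** adj k = mat 1" using Ugroup_orthogonal[OF k] r by (simp add: adj_def)
  ultimately show "k \<in> Sp \<and> cj k = k" using matrix_left_right_inverse by (auto simp: Sp_iff)
next
  assume k: "k \<in> Sp \<and> cj k = k"
  then obtain z w where zw: "k = block z w (- cj w) (cj z)" using SpD(3) quat_iff by blast
  let ?x = "map_matrix Re z" and ?y = "map_matrix Re w"
  have "cj k $ i $ j = k $ i $ j" for i j using k by simp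
  from this[of "Inl _" "Inl _"] this[of "Inl _" "Inr _"]
  have re: "cnj (z $ i $ j) = z $ i $ j" "cnj (w $ i $ j) = w $ i $ j" for i j by (simp_all add: zw)
  then have Im: "Im (z $ i $ j) = 0" "Im (w $ i $ j) = 0" for i j by (simp_all add: complex_eq_iff)
  have "k $ i $ j = map_matrix complex_of_real (block ?x ?y (- ?y) ?x) $ i $ j" for i j
    by (cases i; cases j) (simp_all add: zw complex_eq_iff Im)
  then have kr: "k = map_matrix complex_of_real (block ?x ?y (- ?y) ?x)" by (metis vec_eq_iff)
  have "k ** transpose k = mat 1" using SpD(5)[of k] k by simp
  \<comment> \<open>The upper left and upper right blocks of this equation are the two relations
    that define \<open>Ugroup\<close>.\<close>
  then have e: "Re ((k ** transpose k) $ i $ j) = (if i = j then 1 else 0)" for i j by (simp add: mat_def)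
  have "?x ** transpose ?x + ?y ** transpose ?y = mat 1"
    using e[of "Inl _" "Inl _"] by (simp add: vec_eq_iff matrix_matrix_mult_def transpose_def mat_def
      sum_Plus_UNIV zw Im)
  moreover have "?x ** transpose ?y = ?y ** transpose ?x"
    using e[of "Inl _" "Inr _"] by (simp add: vec_eq_iff matrix_matrix_mult_def transpose_def mat_def
      sum_Plus_UNIV zw Im sum_negf)
  ultimately show "k \<in> Ugroup" unfolding Ugroup_def using kr by blast
qed

definition lie :: "'n::finite cmat2 set" where "lie = {X. adj X = - X \<and> quat X}"

text \<open>The two eigenspaces of conjugation on the Lie algebra form the Cartan decomposition:
  this one is the Lie algebra of \<open>U(n)\<close>, and \<open>imag_part\<close> is the complement
  \<pp>.\<close>

definition real_part :: "'n::finite cmat2 set" where "real_part = {X \<in> lie. cj X = X}"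

definition imag_part :: "'n::finite cmat2 set" where "imag_part = {X \<in> lie. cj X = - X}"

lemma imag_part_iff: "X \<in> imag_part \<longleftrightarrow> transpose X = X \<and> quat X \<and> cj X = - X"
proof -
  have "adj X = - transpose X" if "cj X = - X" using that unfolding adj_def by (simp del: transpose_simps(5))
  then show ?thesis by (auto simp: imag_part_def lie_def)
qed

lemma half_diff_cj_imag_part:
  assumes "transpose Q = Q" "quat Q" shows "(1/2) *\<^sub>R (Q - cj Q) \<in> imag_part"
  using assms by (simp add: imag_part_iff transpose_scalar quat_simps quat_cj algebra_simps)

lemma subspace_lie: "subspace lie" and subspace_real_part: "subspace real_part"
  and subspace_imag_part: "subspace imag_part"
proof -
  have "quat 0" by (simp add: quat_def mm_simps)
  then show "subspace lie" "subspace real_part" "subspace imag_part"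
    by (auto simp: subspace_def lie_def real_part_def imag_part_def quat_simps)
qed

lemma lie_decomp:
  assumes "X \<in> lie"
  obtains V W where "V \<in> real_part" "W \<in> imag_part" "X = V + W"
proof
  show "(1/2) *\<^sub>R (X + cj X) \<in> real_part" "(1/2) *\<^sub>R (X - cj X) \<in> imag_part"
    using assms by (auto simp: real_part_def imag_part_def lie_def quat_simps quat_cj algebra_simps)
  show "X = (1/2) *\<^sub>R (X + cj X) + (1/2) *\<^sub>R (X - cj X)"
    by (simp add: algebra_simps flip: scaleR_left_distrib)
qed

lemma inner_real_imag: "cj A = A \<Longrightarrow> cj B = - B \<Longrightarrow> A \<bullet> B = 0"
  using inner_cj[of A B] by simp

subsection \<open>The Cayley transform\<close>

text \<open>A substitute for the exponential map, built from ring operations and one inversion. Its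
  differential at 0 is twice the identity, which explains the factors 2 and 1/2 below.\<close>

definition cay :: "'m::finite cmat \<Rightarrow> 'm cmat" where
  "cay X = (mat 1 + X) ** matrix_inv (mat 1 - X)"

text \<open>A skew-adjoint \<open>X\<close> has no eigenvalue 1: \<open>M = X ** M\<close> would
  give \<open>M \<bullet> M = - (M \<bullet> M)\<close>.\<close>

lemma skew_inverse:
  assumes "adj X = - (X :: 'm::finite cmat)"
  shows "(mat 1 - X) ** matrix_inv (mat 1 - X) = mat 1" "matrix_inv (mat 1 - X) ** (mat 1 - X) = mat 1"
proof -
  let ?f = "\<lambda>M :: 'm cmat. (mat 1 - X) ** M"
  have lin: "linear ?f" by (simp add: linear_iff mm_simps algebra_simps)
  have "M = 0" if "?f M = 0" for M
  proof -
    have "M = X ** M" using that by (simp add: mm_simps)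
    then have "M \<bullet> M = (X ** M) \<bullet> M" by simp
    also have "\<dots> = - (M \<bullet> (X ** M))" by (simp add: inner_mult_left assms mm_simps)
    also have "\<dots> = - (M \<bullet> M)" using \<open>M = X ** M\<close> by simp
    finally show ?thesis by simp
  qed
  then have "inj ?f" using linear_injective_0[OF lin] by blast
  then have "surj ?f" using linear_injective_imp_surjective[OF lin] by blast
  then obtain R where "(mat 1 - X) ** R = mat 1" by (metis surjD)
  moreover then have "R ** (mat 1 - X) = mat 1" using matrix_left_right_inverse by blast
  ultimately show "(mat 1 - X) ** matrix_inv (mat 1 - X) = mat 1" "matrix_inv (mat 1 - X) ** (mat 1 - X) = mat 1"
    using matrix_inv_eqI by metis+
qed

lemma cay_mult: "adj X = - X \<Longrightarrow> cay X ** (mat 1 - X) = mat 1 + X"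
  unfolding cay_def by (metis matrix_mul_assoc matrix_mul_rid skew_inverse(2))

lemma cay_eq:
  assumes "adj X = - X" shows "cay X = matrix_inv (mat 1 - X) ** (mat 1 + X)"
proof -
  let ?R = "matrix_inv (mat 1 - X)"
  have comm: "(mat 1 - X) ** (mat 1 + X) = (mat 1 + X) ** (mat 1 - X)" by (simp add: mm_simps algebra_simps)
  have "cay X = (?R ** (mat 1 - X)) ** (mat 1 + X) ** ?R" by (simp add: skew_inverse[OF assms] cay_def)
  also have "\<dots> = ?R ** ((mat 1 - X) ** (mat 1 + X)) ** ?R" by (simp add: matrix_mul_assoc)
  also have "\<dots> = ?R ** (mat 1 + X) ** ((mat 1 - X) ** ?R)" unfolding comm by (simp add: matrix_mul_assoc)
  finally show ?thesis by (simp add: skew_inverse[OF assms])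
qed

lemma cay_unitary:
  assumes "adj X = - X" shows "adj (cay X) ** cay X = mat 1"
proof -
  let ?R = "matrix_inv (mat 1 - X)"
  have R: "adj ?R ** (mat 1 + X) = mat 1"
    using arg_cong[OF skew_inverse(1)[OF assms], of adj] by (simp add: adj_mult assms)
  have "adj (cay X) = (mat 1 - X) ** adj ?R" by (subst cay_eq[OF assms]) (simp add: adj_mult assms)
  then have "adj (cay X) ** cay X = (mat 1 - X) ** (adj ?R ** (mat 1 + X)) ** ?R"
    by (simp add: cay_def matrix_mul_assoc)
  then show ?thesis by (simp add: R skew_inverse[OF assms])
qed

lemma quat_inverse:
  assumes "A ** B = mat 1" "quat A" shows "quat B"
proof -
  have BA: "B ** A = mat 1" using assms(1) matrix_left_right_inverse by blast
  have "J ** cj B = B ** (A ** J) ** cj B" by (simp add: BA matrix_mul_assoc)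
  also have "\<dots> = B ** J ** cj (A ** B)"
    using assms(2) by (simp only: quat_def cj_mult matrix_mul_assoc flip: assms(2)[unfolded quat_def])
  finally show ?thesis by (simp add: quat_def assms(1))
qed

lemma cay_Sp: "X \<in> lie \<Longrightarrow> cay X \<in> Sp"
  unfolding Sp_iff lie_def cay_def[of X]
  using cay_unitary[of X] skew_inverse[of X] quat_inverse[of "mat 1 - X"]
  by (auto simp: cay_def quat_simps intro!: quat_mult)

lemma cay_Ugroup:
  assumes "X \<in> real_part" shows "cay X \<in> Ugroup"
proof -
  have X: "X \<in> lie" "cj X = X" "adj X = - X" using assms by (auto simp: real_part_def lie_def)
  let ?R = "matrix_inv (mat 1 - X)"
  have "cj ?R ** (mat 1 - X) = mat 1" using arg_cong[OF skew_inverse(2)[OF X(3)], of cj] by (simp add: cj_mult X)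
  then have "cj ?R = ?R" using inverse_unique skew_inverse(1)[OF X(3)] by metis
  then have "cj (cay X) = cay X" by (simp add: cay_def cj_mult X)
  then show ?thesis using cay_Sp[OF X(1)] by (simp add: Ugroup_iff)
qed

lemma cay_0: "cay 0 = mat 1"
  using cay_mult[of 0] by simp

text \<open>The derivative is found without differentiating the inverse: both sides of
  \<open>cay (L y) ** (mat 1 - L y) = mat 1 + L y\<close> are differentiated at 0.\<close>

lemma smooth_cay:
  fixes L :: "'e::euclidean_space \<Rightarrow> 'm::finite cmat"
  assumes "linear L" "\<And>y. adj (L y) = - L y"
  shows "smooth_on UNIV (\<lambda>y. cay (L y))" and "D (\<lambda>y. cay (L y)) 0 v = 2 *\<^sub>R L v"
proof -
  have bl: "bounded_linear L" using assms(1) linear_conv_bounded_linear by blast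
  have 1: "smooth_on UNIV (\<lambda>y. (mat 1 + L y) ** M)" for M :: "'m cmat"
    using smooth_on_bilinear[OF bounded_bilinear_mm open_UNIV
      smooth_on_add[OF open_UNIV smooth_on_const[of UNIV "mat 1"] smooth_on_bounded_linear[OF bl]]
      smooth_on_const[of UNIV M]] .
  have 2: "smooth_on UNIV (\<lambda>y. (mat 1 - L y) ** M)" for M :: "'m cmat"
    using smooth_on_bilinear[OF bounded_bilinear_mm open_UNIV
      smooth_on_add[OF open_UNIV smooth_on_const[of UNIV "mat 1"] smooth_on_bounded_linear[OF bounded_linear_minus[OF bl]]]
      smooth_on_const[of UNIV M]]
    by simp
  have "smooth_on UNIV (\<lambda>y. matrix_inv (mat 1 - L y) ** (mat 1 :: 'm cmat))"
  proof (rule smooth_on_inverse[where B = "\<lambda>y M :: 'm cmat. (mat 1 - L y) ** M" and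
      C = "\<lambda>y M :: 'm cmat. matrix_inv (mat 1 - L y) ** M"])
    show "smooth_on UNIV (\<lambda>y. (mat 1 - L y) ** M)" for M :: "'m cmat" by (rule 2)
  qed (simp_all add: bounded_linear.linear[OF mm.bounded_linear_right] matrix_mul_assoc skew_inverse[OF assms(2)])
  then show sm: "smooth_on UNIV (\<lambda>y. cay (L y))"
    unfolding cay_def using smooth_on_bilinear[OF bounded_bilinear_mm open_UNIV 1[of "mat 1"]] by simp
  have c: "((\<lambda>y. cay (L y)) has_derivative D (\<lambda>y. cay (L y)) 0) (at 0)"
    by (rule smooth_on_derivative[OF sm]) simp
  have dL: "((\<lambda>y. mat 1 - L y) has_derivative (\<lambda>v. 0 - L v)) (at 0)"
    by (intro has_derivative_diff has_derivative_const bounded_linear_imp_has_derivative bl)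
  from mm.FDERIV[OF c dL]
  have "((\<lambda>y. mat 1 + L y) has_derivative (\<lambda>v. - L v + D (\<lambda>y. cay (L y)) 0 v)) (at 0)"
    using linear_0[OF assms(1)] by (simp add: cay_mult assms(2) cay_0)
  moreover have "((\<lambda>y. mat 1 + L y) has_derivative (\<lambda>v. 0 + L v)) (at 0)"
    by (intro has_derivative_add has_derivative_const bounded_linear_imp_has_derivative bl)
  ultimately have "(\<lambda>v. - L v + D (\<lambda>y. cay (L y)) 0 v) = (\<lambda>v. 0 + L v)" by (rule has_derivative_unique)
  then have "- L v + D (\<lambda>y. cay (L y)) 0 v = L v" by (metis add_0)
  then show "D (\<lambda>y. cay (L y)) 0 v = 2 *\<^sub>R L v" by (simp add: scaleR_2 algebra_simps)
qed

lemma cay_parametrisation: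
  fixes L :: "'e::euclidean_space \<Rightarrow> 'n::finite cmat2"
  assumes "q \<in> Sp" "linear L" "range L \<subseteq> lie"
  shows "smooth_on UNIV (\<lambda>y. q ** cay (L y))" "q ** cay (L y) \<in> Sp" "q ** cay (L 0) = q"
    "((\<lambda>y. q ** cay (L y)) has_derivative (\<lambda>v. q ** (2 *\<^sub>R L v))) (at 0)"
proof -
  have Llie: "L y \<in> lie" for y using assms(3) by blast
  then have Lsk: "adj (L y) = - L y" for y by (simp add: lie_def)
  note c = smooth_cay[OF assms(2) Lsk]
  show "smooth_on UNIV (\<lambda>y. q ** cay (L y))"
    using smooth_on_linear_comp[OF mm.bounded_linear_right[of q] open_UNIV c(1)] .
  show "q ** cay (L y) \<in> Sp" by (intro Sp_mult assms(1) cay_Sp Llie)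
  show "q ** cay (L 0) = q" using linear_0[OF assms(2)] by (simp add: cay_0)
  show "((\<lambda>y. q ** cay (L y)) has_derivative (\<lambda>v. q ** (2 *\<^sub>R L v))) (at 0)"
    using bounded_linear.has_derivative[OF mm.bounded_linear_right[of q] smooth_on_derivative[OF c(1), of 0]]
    by (simp add: c(2))
qed

lemma cay_curve:
  fixes q X :: "'m::finite cmat"
  assumes "adj X = - X"
  shows "smooth_on UNIV (\<lambda>t. q ** cay ((t / 2) *\<^sub>R X))"
    and "((\<lambda>t. q ** cay ((t / 2) *\<^sub>R X)) has_vector_derivative q ** X) (at 0)"
proof -
  let ?L = "\<lambda>t::real. (t / 2) *\<^sub>R X"
  have lin: "linear ?L" by (simp add: linear_iff algebra_simps add_divide_distrib)
  have sk: "adj (?L t) = - ?L t" for t by (simp add: assms)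
  note c = smooth_cay[OF lin sk]
  show "smooth_on UNIV (\<lambda>t. q ** cay ((t / 2) *\<^sub>R X))"
    using smooth_on_linear_comp[OF mm.bounded_linear_right[of q] open_UNIV c(1)] .
  have "((\<lambda>t. q ** cay (?L t)) has_derivative (\<lambda>v. q ** (v *\<^sub>R X))) (at 0)"
    using bounded_linear.has_derivative[OF mm.bounded_linear_right smooth_on_derivative[OF c(1), of 0]]
    by (simp add: c(2))
  then show "((\<lambda>t. q ** cay ((t / 2) *\<^sub>R X)) has_vector_derivative q ** X) (at 0)"
    by (simp add: has_vector_derivative_def mm_simps)
qed

section \<open>Tangent spaces of the group and of the cosets\<close>

lemma cay_curve_tangent:
  fixes q X :: "'m::finite cmat"
  assumes "adj X = - X" "\<And>t. q ** cay (t *\<^sub>R X) \<in> S"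
  shows "q ** X \<in> tangent_space S q"
  unfolding tangent_space_def
proof (intro CollectI exI conjI)
  show "smooth_on {- (1::real)<..<1} (\<lambda>t. q ** cay ((t / 2) *\<^sub>R X))"
    using smooth_on_subset[OF cay_curve(1)[OF assms(1)]] by blast
qed (use cay_curve[OF assms(1)] assms(2) in \<open>auto simp: cay_0\<close>)

text \<open>\<open>Sp\<close> is cut out by \<open>adj p ** p = mat 1\<close> and the real linear
  equation \<open>J ** cj p = p ** J\<close>. Differentiating them along curves makes
  \<open>adj q ** Z\<close> skew-adjoint and quaternionic.\<close>

lemma tangent_space_Sp_subset:
  assumes "q \<in> Sp" "Z \<in> tangent_space Sp q" shows "adj q ** Z \<in> lie"
proof -
  have d: "((\<lambda>p. adj p ** p) has_derivative (\<lambda>V. adj q ** V + adj V ** q)) (at q)"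
    by (rule mm.FDERIV[OF bounded_linear_imp_has_derivative has_derivative_ident])
       (use linear_adj linear_conv_bounded_linear in blast)
  have "D (\<lambda>p. adj p ** p) q Z = 0"
    using d assms SpD(1) by (intro tangent_space_subset_kernel[of q UNIV _ Sp "mat 1"]) (auto simp: differentiable_def)
  then have "adj q ** Z + adj Z ** q = 0" using D_eqI[OF d] by simp
  then have 1: "adj (adj q ** Z) = - (adj q ** Z)" by (simp add: adj_mult eq_neg_iff_add_eq_0 add.commute)
  have "linear (\<lambda>p. J ** cj p - p ** J :: 'a cmat2)" by (simp add: linear_iff mm_simps algebra_simps)
  then have d: "((\<lambda>p. J ** cj p - p ** J) has_derivative (\<lambda>p. J ** cj p - p ** J)) (at q)"
    using linear_conv_bounded_linear bounded_linear_imp_has_derivative by blast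
  have "D (\<lambda>p. J ** cj p - p ** J) q Z = 0"
    using d assms SpD(3) by (intro tangent_space_subset_kernel[of q UNIV _ Sp 0]) (auto simp: differentiable_def quat_def)
  then have "quat Z" using D_eqI[OF d] by (simp add: quat_def)
  then show ?thesis using 1 by (simp add: lie_def quat_mult quat_adj SpD[OF assms(1)])
qed

lemma mult_adj_cancel: "q \<in> Sp \<Longrightarrow> q ** (adj q ** Z) = Z" "q \<in> Sp \<Longrightarrow> adj q ** (q ** Z) = Z"
  by (simp_all add: matrix_mul_assoc SpD)

lemma tangent_space_Sp:
  assumes "q \<in> Sp" shows "tangent_space Sp q = {q ** X | X. X \<in> lie}"
proof (intro equalityI subsetI)
  fix Z assume "Z \<in> tangent_space Sp q"
  then show "Z \<in> {q ** X | X. X \<in> lie}" using tangent_space_Sp_subset[OF assms] mult_adj_cancel(1)[OF assms]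
    by (metis (mono_tags, lifting) CollectI)
next
  fix Z assume "Z \<in> {q ** X | X. X \<in> lie}"
  then obtain X where X: "Z = q ** X" "X \<in> lie" by blast
  then have "q ** cay (t *\<^sub>R X) \<in> Sp" for t
    using Sp_mult[OF assms cay_Sp] subspace_scale[OF subspace_lie] by blast
  then show "Z \<in> tangent_space Sp q" using X cay_curve_tangent[of X q Sp] by (auto simp: lie_def)
qed

lemma proj_eq: "proj q = {q ** k | k. k \<in> Sp \<and> cj k = k}"
  unfolding proj_def Ugroup_iff by blast

lemma tangent_space_proj:
  assumes "q \<in> Sp" shows "tangent_space (proj q) q = {q ** X | X. X \<in> real_part}"
proof (intro equalityI subsetI)
  fix Z assume Z: "Z \<in> tangent_space (proj q) q"
  have "proj q \<subseteq> Sp" using Sp_mult[OF assms] by (auto simp: proj_eq)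
  then have "Z \<in> tangent_space Sp q" using Z unfolding tangent_space_def by blast
  then have 1: "adj q ** Z \<in> lie" using tangent_space_Sp_subset[OF assms] by blast
  have "linear (\<lambda>p. cj (adj q ** p) - adj q ** p :: 'a cmat2)" by (simp add: linear_iff mm_simps algebra_simps)
  then have d: "((\<lambda>p. cj (adj q ** p) - adj q ** p) has_derivative (\<lambda>p. cj (adj q ** p) - adj q ** p)) (at q)"
    using linear_conv_bounded_linear bounded_linear_imp_has_derivative by blast
  have "D (\<lambda>p. cj (adj q ** p) - adj q ** p) q Z = 0"
    using d Z assms by (intro tangent_space_subset_kernel[of q UNIV _ "proj q" 0])
      (auto simp: differentiable_def proj_eq mult_adj_cancel)
  then have "cj (adj q ** Z) = adj q ** Z" using D_eqI[OF d] by simp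
  then show "Z \<in> {q ** X | X. X \<in> real_part}" using 1 mult_adj_cancel(1)[OF assms, of Z]
    by (auto simp: real_part_def intro!: exI[of _ "adj q ** Z"])
next
  fix Z assume "Z \<in> {q ** X | X. X \<in> real_part}"
  then obtain X where X: "Z = q ** X" "X \<in> real_part" by blast
  then have "q ** cay (t *\<^sub>R X) \<in> proj q" for t
    using cay_Ugroup subspace_scale[OF subspace_real_part] unfolding proj_def by blast
  then show "Z \<in> tangent_space (proj q) q" using X cay_curve_tangent[of X q "proj q"]
    by (auto simp: lie_def real_part_def)
qed

lemma Sp_metric_mult: "q \<in> Sp \<Longrightarrow> Sp_metric q (q ** X) (q ** Y) = X \<bullet> Y"
  unfolding Sp_metric_def matrix_inv_eqI[OF SpD(1)] mult_adj_cancel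
  by (simp add: inner_cmat sp_inner_def adj_def)

text \<open>Conjugation is an isometry, so its eigenspaces \<open>real_part\<close> and
  \<open>imag_part\<close> are orthogonal, and the complement of the first within \<open>lie\<close>
  is the second.\<close>

lemma horizontal:
  assumes "q \<in> Sp" shows "horizontal q = {q ** X | X. X \<in> imag_part}"
proof -
  have "X \<in> imag_part" if X: "X \<in> lie" "\<And>V. V \<in> real_part \<Longrightarrow> X \<bullet> V = 0" for X
  proof -
    obtain V W where VW: "V \<in> real_part" "W \<in> imag_part" "X = V + W" using lie_decomp[OF X(1)] by blast
    then have "V \<bullet> W = 0" by (intro inner_real_imag) (auto simp: real_part_def imag_part_def)
    then have "V \<bullet> V = 0" using X(2)[OF VW(1)] VW(3) by (simp add: inner_add_left inner_add_right inner_commute)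
    then show ?thesis using VW by simp
  qed
  moreover have "X \<bullet> V = 0" if "X \<in> imag_part" "V \<in> real_part" for X V
    using inner_real_imag[of V X] that by (auto simp: real_part_def imag_part_def inner_commute)
  moreover have "imag_part \<subseteq> lie" by (auto simp: imag_part_def)
  ultimately show ?thesis
    unfolding horizontal_def tangent_space_Sp[OF assms] tangent_space_proj[OF assms]
    by (fastforce simp: Sp_metric_mult[OF assms])
qed


section \<open>Linear coordinates on the imaginary part of the Lie algebra\<close>

text \<open>A pair of symmetric matrices is stored in a square matrix and a vector, using an enumeration
  \<open>f\<close> of the index type to tell the two triangles of the matrix apart.\<close>

lemma imag_part_coordinates:
  obtains L :: "'n::finite model \<Rightarrow> 'n cmat2" where "linear L" "inj L" "range L = imag_part"
proof -
  obtain f :: "'n \<Rightarrow> nat" where f: "inj f"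
    using finite_imp_inj_to_nat_seg[of "UNIV :: 'n set"] by auto
  have fi: "f i = f j \<longleftrightarrow> i = j" for i j using f by (simp add: inj_eq)
  define z :: "'n model \<Rightarrow> 'n \<Rightarrow> 'n \<Rightarrow> real"
    \<comment> \<open>The upper triangle with the diagonal stores \<open>z\<close>, the strict lower
      triangle stores the entries of \<open>w\<close> off the diagonal, and the vector stores the
      diagonal of \<open>w\<close>.\<close>
    where "z p i j = (if f i \<le> f j then fst p $ i $ j else fst p $ j $ i)" for p i j
  define w :: "'n model \<Rightarrow> 'n \<Rightarrow> 'n \<Rightarrow> real"
    where "w p i j = (if f i < f j then fst p $ j $ i else if f j < f i then fst p $ i $ j else snd p $ i)" for p i j
  have zs: "z p i j = z p j i" for p i j unfolding z_def using fi[of i j] by auto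
  have ws: "w p i j = w p j i" for p i j unfolding w_def using fi[of i j] by auto
  define Z W :: "'n model \<Rightarrow> complex ^ 'n ^ 'n"
    where "Z p = (\<chi> i j. \<i> * of_real (z p i j))" and "W p = (\<chi> i j. \<i> * of_real (w p i j))" for p
  \<comment> \<open>For purely imaginary blocks \<open>- cj W = W\<close> and
    \<open>cj Z = - Z\<close>, so this is the quaternionic block form.\<close>
  define L :: "'n model \<Rightarrow> 'n cmat2" where "L p = block (Z p) (W p) (W p) (- Z p)" for p
  have Lnth: "L p $ Inl i $ Inl j = \<i> * of_real (z p i j)" "L p $ Inl i $ Inr j = \<i> * of_real (w p i j)"
    "L p $ Inr i $ Inl j = \<i> * of_real (w p i j)" "L p $ Inr i $ Inr j = - (\<i> * of_real (z p i j))" for p i j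
    by (simp_all add: L_def Z_def W_def)
  have eqI: "A = B" if "\<And>i j. A $ i $ j = B $ i $ j" for A B :: "'n cmat2"
    using that by (simp add: vec_eq_iff)
  have lin: "linear L"
  proof
    fix p q show "L (p + q) = L p + L q"
    proof (rule eqI)
      fix i j show "L (p + q) $ i $ j = (L p + L q) $ i $ j"
        by (cases i; cases j) (simp_all add: Lnth, simp_all add: z_def w_def algebra_simps)
    qed
  next
    fix r p show "L (r *\<^sub>R p) = r *\<^sub>R L p"
    proof (rule eqI)
      fix i j show "L (r *\<^sub>R p) $ i $ j = (r *\<^sub>R L p) $ i $ j"
        by (cases i; cases j) (simp_all add: Lnth, simp_all add: z_def w_def scaleR_conv_of_real[where 'a = complex] algebra_simps)
    qed
  qed
  moreover have "inj L"
    unfolding linear_injective_0[OF lin]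
  proof (intro allI impI)
    fix p assume "L p = 0"
    then have 0: "L p $ i $ j = 0" for i j by simp
    have z0: "z p i j = 0" for i j using 0[of "Inl i" "Inl j"] by (simp add: Lnth)
    have w0: "w p i j = 0" for i j using 0[of "Inl i" "Inr j"] by (simp add: Lnth)
    have "fst p $ i $ j = 0" for i j using z0[of i j] w0[of i j] by (auto simp: z_def w_def split: if_splits)
    moreover have "snd p $ i = 0" for i using w0[of i i] by (simp add: w_def)
    ultimately show "p = 0" by (simp add: prod_eq_iff vec_eq_iff)
  qed
  moreover have "range L = imag_part"
  proof (intro equalityI subsetI)
    fix X assume "X \<in> range L"
    then obtain p where p: "X = L p" by blast
    have "transpose (L p) = L p"
    proof (rule eqI)
      fix i j show "transpose (L p) $ i $ j = L p $ i $ j"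
        by (cases i; cases j) (simp_all add: transpose_def Lnth zs[of p] ws[of p])
    qed
    moreover have "cj (L p) = - L p"
    proof (rule eqI)
      fix i j show "cj (L p) $ i $ j = (- L p) $ i $ j" by (cases i; cases j) (simp_all add: Lnth)
    qed
    moreover have "quat (L p)"
      unfolding quat_def by (rule eqI) (rename_tac i j, case_tac i; case_tac j; simp add: J_mult Lnth)
    ultimately show "X \<in> imag_part" by (simp add: imag_part_iff p)
  next
    fix X :: "'n cmat2" assume "X \<in> imag_part"
    then have X: "transpose X = X" "quat X" "cj X = - X" by (auto simp: imag_part_iff)
    then obtain zz ww where b: "X = block zz ww (- cj ww) (cj zz)" by (auto simp: quat_iff)
    have "cj X $ i $ j = (- X) $ i $ j" "transpose X $ i $ j = X $ i $ j" for i j using X by simp_all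
    from this(1)[of "Inl _" "Inl _"] this(1)[of "Inl _" "Inr _"] this(2)[of "Inl _" "Inl _"] this(2)[of "Inl _" "Inr _"]
    have e: "cnj (zz $ i $ j) = - zz $ i $ j" "cnj (ww $ i $ j) = - ww $ i $ j"
      "zz $ j $ i = zz $ i $ j" "ww $ j $ i = ww $ i $ j" for i j by (simp_all add: b transpose_def)
    have re: "Re (zz $ i $ j) = 0" "Re (ww $ i $ j) = 0" for i j
      using e(1,2)[of i j] by (simp_all add: complex_eq_iff)
    define p :: "'n model" where
      "p = (\<chi> i j. if f i \<le> f j then Im (zz $ i $ j) else Im (ww $ i $ j), \<chi> i. Im (ww $ i $ i))"
    have "z p i j = Im (zz $ i $ j)" "w p i j = Im (ww $ i $ j)" for i j
      using e(3,4)[of i j] fi[of i j] by (auto simp: z_def w_def p_def)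
    then have "L p $ i $ j = X $ i $ j" for i j
      by (cases i; cases j) (simp_all add: Lnth b complex_eq_iff re)
    then show "X \<in> range L" using eqI by (metis rangeI)
  qed
  ultimately show ?thesis by (rule that)
qed


section \<open>Isotropic vectors\<close>

definition cdot :: "complex ^ 'm::finite \<Rightarrow> complex ^ 'm \<Rightarrow> complex" where
  "cdot u v = (\<Sum>k\<in>UNIV. u $ k * v $ k)"

definition qf :: "complex ^ 'm::finite \<Rightarrow> 'm cmat \<Rightarrow> complex" where
  "qf b X = cdot b (X *v b)"

definition outer :: "complex ^ 'm::finite \<Rightarrow> complex ^ 'm \<Rightarrow> 'm cmat" where
  "outer u v = (\<chi> i j. u $ i * v $ j)"

definition cs :: "complex \<Rightarrow> 'm::finite cmat \<Rightarrow> 'm cmat" where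
  "cs c M = (\<chi> i j. c * M $ i $ j)"

definition pairing :: "'m::finite cmat \<Rightarrow> 'm cmat \<Rightarrow> complex" where
  "pairing X M = (\<Sum>i\<in>UNIV. \<Sum>j\<in>UNIV. X $ i $ j * M $ i $ j)"

abbreviation vcnj :: "complex ^ 'm::finite \<Rightarrow> complex ^ 'm" where
  "vcnj v \<equiv> (\<chi> i. cnj (v $ i))"

lemma cdot_commute: "cdot u v = cdot v u"
  by (simp add: cdot_def mult.commute)

lemma cdot_simps [simp]: "cdot u (v + w) = cdot u v + cdot u w" "cdot u (c *s v) = c * cdot u v" "cdot u (r *\<^sub>R v) = of_real r * cdot u v"
  "cdot u (- v) = - cdot u v" "cdot (- u) v = - cdot u v" "cdot u (v - w) = cdot u v - cdot u w"
  by (simp_all add: cdot_def algebra_simps sum.distrib sum_distrib_left sum_negf sum_subtractf scaleR_conv_of_real[where 'a = complex])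

lemma cdot_matrix: "cdot u (A *v v) = cdot (transpose A *v u) v"
  unfolding cdot_def matrix_vector_mult_def transpose_def
  by (simp add: sum_distrib_left sum_distrib_right mult_ac) (subst sum.swap, rule refl)

lemma cdot_vcnj: "cdot (vcnj u) u = of_real ((norm u)\<^sup>2)"
proof -
  have "(norm u)\<^sup>2 = (\<Sum>k\<in>UNIV. (cmod (u $ k))\<^sup>2)"
    by (simp add: norm_vec_def L2_set_def sum_nonneg)
  then show ?thesis by (simp add: cdot_def complex_norm_square[symmetric] mult.commute)
qed

lemma cnj_cdot: "cnj (cdot u v) = cdot (vcnj u) (vcnj v)"
  by (simp add: cdot_def)

lemma cj_mult_vec: "cj A *v vcnj v = vcnj (A *v v)"
  by (simp add: vec_eq_iff matrix_vector_mult_def)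

lemma cnj_qf: "cnj (qf b X) = qf (vcnj b) (cj X)"
  by (simp add: qf_def cnj_cdot cj_mult_vec)

lemma vcnj_vcnj [simp]: "vcnj (vcnj v) = v" by (simp add: vec_eq_iff)

lemma mult_vec_simps [simp]:
  "(A + B) *v v = A *v v + B *v v" "(A - B) *v v = A *v v - B *v v" "(r *\<^sub>R A) *v v = r *\<^sub>R (A *v v)"
  "cs c A *v v = c *s (A *v v)" "outer u w *v v = cdot w v *s u" "(- A) *v v = - (A *v v)"
  "A *v (v + w) = A *v v + A *v w" "A *v (c *s v) = c *s (A *v v)"
  for A B :: "'m::finite cmat" and u v w :: "complex ^ 'm"
  by (simp_all add: vec_eq_iff matrix_vector_mult_def cs_def outer_def cdot_def algebra_simps sum.distrib
      sum_subtractf scaleR_sum_right sum_distrib_left sum_negf)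

lemma cs_simps:
  "A ** cs c B = cs c (A ** B)" "cs c A ** B = cs c (A ** B)" "transpose (cs c A) = cs c (transpose A)"
  "cj (cs c A) = cs (cnj c) (cj A)"
  for A B :: "'m::finite cmat"
  by (simp_all add: vec_eq_iff matrix_matrix_mult_def cs_def transpose_def sum_distrib_left mult_ac)

lemma pairing_simps [simp]:
  "pairing X (A + B) = pairing X A + pairing X B" "pairing X (A - B) = pairing X A - pairing X B"
  "pairing X (- A) = - pairing X A"
  "pairing X (r *\<^sub>R A) = of_real r * pairing X A" "pairing X (cs c A) = c * pairing X A"
  by (simp_all add: pairing_def cs_def algebra_simps sum.distrib sum_subtractf sum_distrib_left sum_negf scaleR_conv_of_real[where 'a = complex])

lemma pairing_outer: "pairing X (outer u v) = cdot u (X *v v)"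
  by (simp add: pairing_def outer_def cdot_def matrix_vector_mult_def sum_distrib_left mult_ac)

lemma pairing_trace: "pairing X M = trace (X ** transpose M)"
  by (simp add: pairing_def trace_def matrix_matrix_mult_def transpose_def)

lemma pairing_mult: "pairing X (A ** M ** B) = pairing (transpose A ** X ** transpose B) M"
  for X A M B :: "'m::finite cmat"
proof -
  have "trace (X ** (transpose B ** (transpose M ** transpose A))) =
      trace ((X ** transpose B ** transpose M) ** transpose A)" by (simp add: matrix_mul_assoc)
  also have "\<dots> = trace (transpose A ** (X ** transpose B ** transpose M))" by (rule trace_mul_sym)
  finally show ?thesis by (simp add: pairing_trace matrix_transpose_mul matrix_mul_assoc)
qed

lemma inner_pairing: "Z \<bullet> M = Re (pairing Z (cj M))"
  by (simp add: inner_vec_def inner_complex_def pairing_def)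

text \<open>The complexification of \<open>imag_part\<close> inside the complex matrices is cut out by \<open>pC\<close>, \<open>prC\<close> is
  the projection onto it, and \<open>ip\<close> takes its elements back to \<open>imag_part\<close>.\<close>

definition pC :: "'n::finite cmat2 \<Rightarrow> bool" where
  "pC M \<longleftrightarrow> transpose M = M \<and> J ** M ** J = M"

definition prC :: "'n::finite cmat2 \<Rightarrow> 'n cmat2" where
  "prC M = (1/4) *\<^sub>R ((M + transpose M) + J ** (M + transpose M) ** J)"

definition ip :: "'m::finite cmat \<Rightarrow> 'm cmat" where
  "ip T = (1/2) *\<^sub>R (T - cj T)"

text \<open>Transposition and \<open>M \<mapsto> J ** M ** J\<close> are commuting involutions.
  \<open>prC\<close> averages over the group of order four that they generate, hence the 1/4, and
  \<open>pC\<close> describes the fixed matrices.\<close>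

lemma pC_prC: "pC (prC M)"
proof -
  let ?N = "M + transpose M"
  have "transpose (J ** ?N ** J) = J ** ?N ** J"
    by (simp add: matrix_transpose_mul matrix_mul_assoc mm.minus_left mm.minus_right add.commute)
  moreover have "transpose ?N = ?N" by (simp add: add.commute)
  moreover have "J ** (J ** ?N ** J) ** J = ?N"
  proof -
    have "J ** (J ** ?N ** J) ** J = (J ** J) ** ?N ** (J ** J)" by (simp only: matrix_mul_assoc)
    then show ?thesis by (simp add: J_J mm.minus_left mm.minus_right)
  qed
  ultimately show ?thesis unfolding pC_def prC_def
    by (simp only: transpose_scalar transpose_simps mm.add_left mm.add_right mm.scaleR_left mm.scaleR_right)
       (simp add: add_ac)
qed

lemma prC_symmetric: assumes "transpose M = M" shows "prC M = (1/2) *\<^sub>R (M + J ** M ** J)"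
  unfolding prC_def assms scaleR_2[symmetric] mm.scaleR_left mm.scaleR_right
  by (simp add: scaleR_add_right)

lemma pC_simps: "pC A \<Longrightarrow> pC B \<Longrightarrow> pC (A - B)" "pC A \<Longrightarrow> pC (- A)" "pC A \<Longrightarrow> pC (cs c A)" "pC A \<Longrightarrow> pC (cj A)"
proof -
  show "pC A \<Longrightarrow> pC (cj A)"
  proof -
    assume A: "pC A"
    then have "cj (J ** A ** J) = cj A" by (simp add: pC_def)
    then show ?thesis using A by (simp add: cj_mult pC_def)
  qed
qed (simp_all add: pC_def mm_simps cs_simps)

lemma ip_imag_part:
  assumes "pC T" shows "ip T \<in> imag_part"
proof -
  have "transpose (ip T) = ip T" using assms by (simp add: ip_def pC_def transpose_scalar)
  moreover have c: "cj (ip T) = - ip T" by (simp add: ip_def algebra_simps)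
  moreover have "quat (ip T)"
  proof -
    have "J ** ip T ** J = ip T"
      using assms pC_simps(4)[OF assms] by (simp add: ip_def pC_def mm_simps)
    then have "J ** (J ** ip T ** J) = J ** ip T" by simp
    moreover have "J ** (J ** ip T ** J) = (J ** J) ** ip T ** J" by (simp only: matrix_mul_assoc)
    ultimately have "J ** ip T = - (ip T ** J)" by (simp add: J_J mm_simps)
    then show ?thesis by (simp add: quat_def c mm_simps)
  qed
  ultimately show ?thesis by (simp add: imag_part_iff)
qed

lemma imag_part_J: assumes "X \<in> imag_part" shows "J ** X ** J = X"
proof -
  have "J ** - X = X ** J" using assms unfolding imag_part_iff quat_def by metis
  then have "J ** X = - (X ** J)" by (metis add.inverse_inverse mm.minus_right)
  then have "J ** X ** J = - (X ** (J ** J))" by (simp add: mm_simps matrix_mul_assoc)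
  then show ?thesis by (simp add: J_J mm_simps)
qed

text \<open>Both involutions behind \<open>prC\<close> fix \<open>X\<close> and preserve the
  pairing, so averaging \<open>M\<close> does not change its pairing with \<open>X\<close>.\<close>

lemma pairing_prC: assumes "X \<in> imag_part" shows "pairing X (prC M) = pairing X M"
proof -
  have t: "pairing X (transpose M) = pairing X M" for M
  proof -
    have "pairing X (transpose M) = (\<Sum>i\<in>UNIV. \<Sum>j\<in>UNIV. X $ j $ i * M $ j $ i)"
      using assms unfolding imag_part_iff pairing_def
      by (intro sum.cong refl) (metis (no_types, lifting) transpose_def vec_lambda_beta)
    also have "\<dots> = pairing X M" unfolding pairing_def by (rule sum.swap)
    finally show ?thesis .
  qed
  have "pairing X (J ** N ** J) = pairing X N" for N
    by (simp add: pairing_mult mm_simps imag_part_J[OF assms])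
  then show ?thesis by (simp add: prC_def t del: transpose_simps(1))
qed

text \<open>A complex linear functional on \<pp> is represented by two real vectors of \<pp>. The
  minus sign arises because \<open>cj X = - X\<close> gives the pairings of \<open>X\<close> with
  \<open>M\<close> and with \<open>cj M\<close> opposite real parts.\<close>

lemma inner_ip:
  assumes "X \<in> imag_part" shows "of_real (X \<bullet> ip T) + \<i> * of_real (X \<bullet> ip (cs (- \<i>) T)) = - pairing X T"
proof -
  have cx: "cj X = - X" using assms by (simp add: imag_part_iff)
  have cp: "cnj (pairing X M) = - pairing X (cj M)" for M
  proof -
    have "cnj (X $ i $ j) = - X $ i $ j" for i j using arg_cong[OF cx, of "\<lambda>M. M $ i $ j"] by simp
    then show ?thesis by (simp add: pairing_def sum_negf)
  qed
  have *: "X \<bullet> ip M = - Re (pairing X M)" for M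
  proof -
    have "Re (pairing X (cj M)) = - Re (pairing X M)" using arg_cong[OF cp[of M], of Re] by simp
    then show ?thesis by (simp add: inner_pairing ip_def)
  qed
  show ?thesis by (simp add: * complex_eq_iff)
qed

lemma ip_decomp: "ip T + cs \<i> (ip (cs (- \<i>) T)) = T"
proof -
  have "cs \<i> (ip (cs (- \<i>) T)) = (1/2) *\<^sub>R (T + cj T)"
    by (simp add: ip_def cs_def vec_eq_iff) (simp add: complex_eq_iff)
  then show ?thesis by (simp add: ip_def algebra_simps flip: scaleR_left_distrib)
qed

text \<open>Parseval's identity with common squared length \<open>c\<close>. The scale is kept
  because the orthonormal bases of a chart turn into bases of \<pp> with squared length 4.\<close>

lemma orthogonal_parseval:
  fixes E :: "'a::real_inner set"
  assumes "finite E" "c > 0" "\<And>e f. e \<in> E \<Longrightarrow> f \<in> E \<Longrightarrow> e \<bullet> f = (if e = f then c else 0)" "T \<in> span E"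
  shows "(\<Sum>e\<in>E. (e \<bullet> S) * (e \<bullet> T)) = c * (S \<bullet> T)"
proof -
  let ?R = "T - (\<Sum>e\<in>E. ((e \<bullet> T) / c) *\<^sub>R e)"
  have o: "?R \<bullet> f = 0" if f: "f \<in> E" for f
  proof -
    have "(\<Sum>e\<in>E. ((e \<bullet> T) / c) * (e \<bullet> f)) = (\<Sum>e\<in>E. if e = f then e \<bullet> T else 0)"
      by (rule sum.cong) (use assms(2,3) f in auto)
    then show ?thesis using assms(1) f
      by (simp add: inner_diff_left inner_sum_left inner_commute[of T f])
  qed
  have "?R \<in> span E" using assms(4) by (intro span_diff span_sum span_scale) (auto intro: span_base)
  then have "orthogonal ?R ?R"
    by (rule orthogonal_to_span) (use o in \<open>auto simp: orthogonal_def\<close>)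
  then have "T = (\<Sum>e\<in>E. ((e \<bullet> T) / c) *\<^sub>R e)" by (simp add: orthogonal_def)
  then have "S \<bullet> T = (\<Sum>e\<in>E. (e \<bullet> T) / c * (S \<bullet> e))" by (metis (no_types, lifting) inner_scaleR_right inner_sum_right sum.cong)
  then show ?thesis using assms(2) by (simp add: sum_distrib_left mult_ac inner_commute)
qed

section \<open>The gradient and the trace of the Hessian at an isotropic vector\<close>

locale isotropic =
  fixes b :: "complex ^ ('n::finite + 'n)"
  assumes isotropic: "cdot b b = 0" and nonzero: "b \<noteq> 0"
begin

definition G :: "'n cmat2" where "G = prC (outer b b)"

text \<open>As \<open>J\<close> is skew and its transpose is its inverse, \<open>b\<close> and
  \<open>J *v b\<close> span a totally isotropic space. Both the surjectivity of the differential
  and the vanishing of the trace depend on this.\<close>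

lemma J_b: "cdot b (J *v b) = 0" "cdot (J *v b) b = 0" "cdot (J *v b) (J *v b) = 0"
proof -
  have "cdot b (J *v b) = - cdot (J *v b) b" by (subst cdot_matrix) simp
  then show "cdot b (J *v b) = 0" "cdot (J *v b) b = 0" by (auto simp: cdot_commute)
  have "J *v (J *v b) = - b" by (simp add: matrix_vector_mul_assoc J_J)
  then show "cdot (J *v b) (J *v b) = 0" by (subst cdot_matrix) (simp add: isotropic)
qed

lemma transpose_outer [simp]: "transpose (outer u v) = outer v u"
  by (simp add: vec_eq_iff transpose_def outer_def mult.commute)

lemma prC_outer_mult: "prC (outer b v) *v b = (1/4) *\<^sub>R (cdot v b *s b + cdot v (J *v b) *s (J *v b))"
  by (simp add: prC_def matrix_vector_mul_assoc[symmetric] isotropic J_b)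

lemma G_b: "G *v b = 0" unfolding G_def by (simp add: prC_outer_mult isotropic J_b)

text \<open>Up to conjugation the second value is half of
  \<open>(norm b)^4 + (cmod ?z)\<^sup>2\<close>: the two summands of \<open>prC (outer b b)\<close>
  contribute squares of absolute values, and the first is positive.\<close>

lemma qf_G: "qf b G = 0" "qf b (cj G) \<noteq> 0"
proof -
  show "qf b G = 0" by (simp add: qf_def G_b cdot_def)
  let ?z = "cdot (vcnj b) (J *v b)"
  have z: "cnj ?z = - ?z"
  proof -
    have "cnj ?z = cdot b (J *v vcnj b)" using cj_mult_vec[of J b] by (simp add: cnj_cdot)
    also have "\<dots> = - ?z" by (subst cdot_matrix) (simp add: cdot_commute)
    finally show ?thesis .
  qed
  have q: "qf (vcnj b) G = (1/2) * (cdot (vcnj b) b * cdot b (vcnj b) + ?z * cdot b (J *v vcnj b))"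
    by (simp add: qf_def G_def prC_symmetric matrix_vector_mul_assoc[symmetric] algebra_simps)
  have "cdot b (J *v vcnj b) = cnj ?z" using cj_mult_vec[of J b] by (simp add: cnj_cdot)
  then have "?z * cdot b (J *v vcnj b) = of_real ((cmod ?z)\<^sup>2)"
    by (simp only: complex_norm_square)
  then have "qf (vcnj b) G = of_real ((1/2) * ((norm b)^4 + (cmod ?z)\<^sup>2))"
    unfolding q by (simp add: cdot_commute[of b "vcnj b"] cdot_vcnj power4_eq_xxxx power2_eq_square)
  moreover have "(norm b)^4 + (cmod ?z)\<^sup>2 > 0" using nonzero by (simp add: add_pos_nonneg)
  ultimately have "qf (vcnj b) G \<noteq> 0" by (metis less_irrefl mult_pos_pos of_real_eq_0_iff zero_less_divide_1_iff zero_less_numeral)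
  moreover have "cnj (qf b (cj G)) = qf (vcnj b) G" by (simp add: cnj_qf)
  ultimately show "qf b (cj G) \<noteq> 0" by force
qed

lemma qf_simps [simp]: "qf u (A - B) = qf u A - qf u B" "qf u (- A) = - qf u A" "qf u (r *\<^sub>R A) = of_real r * qf u A"
  "qf u (cs c A) = c * qf u A" "qf u (A + B) = qf u A + qf u B"
  by (simp_all add: qf_def)

lemma surj_qf: "\<exists>X\<in>imag_part. qf b X = \<zeta>"
proof -
  \<comment> \<open>Of the two halves of \<open>ip ?T\<close> the conjugated one is a multiple of
    \<open>G\<close> and contributes nothing to \<open>qf b\<close>; the factor 2 makes up for the
    half that remains.\<close>
  let ?T = "cs (2 * \<zeta> / qf b (cj G)) (cj G)"
  have "pC ?T" unfolding G_def by (intro pC_simps pC_prC)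
  then have "ip ?T \<in> imag_part" by (rule ip_imag_part)
  moreover have "qf b (ip ?T) = \<zeta>" using qf_G by (simp add: ip_def cs_simps)
  ultimately show ?thesis by blast
qed

definition K :: "'n cmat2 set" where "K = {X \<in> imag_part. qf b X = 0}"

text \<open>On \<open>K\<close> the functional \<open>X \<mapsto> (X *v b) $ k\<close> is the pairing with the projection of the matrix with
  \<open>k\<close>-th column \<open>b\<close>; the multiple of \<open>G\<close>, which pairs to zero with \<open>K\<close>, moves it into the complexification
  of \<open>K\<close>. The sign comes from passing to the inner product of imaginary matrices.\<close>

definition T :: "('n + 'n) \<Rightarrow> 'n cmat2" where
  "T k = cs (cnj (qf b (cj (prC (outer b (axis k 1)))) / qf b (cj G))) G - prC (outer b (axis k 1))"

lemma cdot_axis: "cdot (axis k 1) v = v $ k" "cdot v (axis k 1) = v $ k"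
  by (simp_all add: cdot_def axis_def if_distrib[of "\<lambda>x. x * _"] if_distrib[of "\<lambda>x. _ * x"] cong: if_cong)

lemma pC_T: "pC (T k)" unfolding T_def G_def by (intro pC_simps pC_prC)

lemma T_b: "(T k *v b) $ k = - (1/4) * (b $ k * b $ k + (J *v b) $ k * (J *v b) $ k)"
  by (simp add: T_def G_b prC_outer_mult cdot_axis scaleR_conv_of_real[where 'a = complex])

text \<open>The first value vanishes because \<open>b\<close> and \<open>J *v b\<close> are
  isotropic and orthogonal to each other. The second is what the coefficient of \<open>G\<close> in
  \<open>T k\<close> is solved for. Both are needed, since \<open>ip\<close> mixes
  \<open>T k\<close> with its conjugate.\<close>

lemma qf_T: "qf b (T k) = 0" "qf b (cj (T k)) = 0"
proof -
  show "qf b (T k) = 0"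
    unfolding T_def by (simp add: qf_G) (simp add: qf_def prC_outer_mult isotropic J_b)
  show "qf b (cj (T k)) = 0"
    using qf_G by (simp add: T_def cs_simps)
qed

lemma ip_T: "ip (T k) \<in> K" "ip (cs (- \<i>) (T k)) \<in> K"
  using qf_T[of k] unfolding K_def
  by (auto intro!: ip_imag_part pC_simps pC_T) (simp_all add: ip_def cs_simps)

lemma pairing_T: assumes "X \<in> K" shows "- pairing X (T k) = (X *v b) $ k"
proof -
  have X: "X \<in> imag_part" "qf b X = 0" using assms by (auto simp: K_def)
  have t: "transpose X = X" using X(1) by (simp add: imag_part_iff)
  have "pairing X G = 0" unfolding G_def using X by (simp add: pairing_prC pairing_outer qf_def)
  moreover have "pairing X (prC (outer b (axis k 1))) = (X *v b) $ k"
    using X(1) t by (simp add: pairing_prC pairing_outer cdot_matrix[of b] cdot_axis)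
  ultimately show ?thesis by (simp add: T_def)
qed

text \<open>\<open>qf b (X ** X)\<close> is the sum of the squares of the entries of
  \<open>X *v b\<close>. Each entry is \<open>X \<bullet> T1 + \<i> (X \<bullet> T2)\<close> with T1
  and T2 in \<open>K\<close>, so Parseval turns the sum of its squares over \<open>E\<close> into
  \<open>c\<close> times the entry at \<open>k\<close> of \<open>T k *v b\<close>. Summed over
  \<open>k\<close>, these give a multiple of b \<cdot> b + Jb \<cdot> Jb = 0. The correction by
  \<open>G\<close> inside \<open>T k\<close> lets this work on \<open>K\<close> directly.\<close>

lemma trace_qf_square:
  assumes "finite E" "E \<subseteq> K" "K \<subseteq> span E" "c > 0"
    "\<And>e f. e \<in> E \<Longrightarrow> f \<in> E \<Longrightarrow> e \<bullet> f = (if e = f then c else 0)"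
  shows "(\<Sum>X\<in>E. qf b (X ** X)) = 0"
proof -
  have "(\<Sum>X\<in>E. ((X *v b) $ k)\<^sup>2) = of_real c * (T k *v b) $ k" for k
  proof -
    let ?T1 = "ip (T k)" and ?T2 = "ip (cs (- \<i>) (T k))"
    have e: "(X *v b) $ k = of_real (X \<bullet> ?T1) + \<i> * of_real (X \<bullet> ?T2)" if "X \<in> K" for X
      using inner_ip[of X "T k"] pairing_T[OF that] that by (simp add: K_def)
    have p: "(\<Sum>X\<in>E. (X \<bullet> S) * (X \<bullet> S')) = c * (S \<bullet> S')" if "S' \<in> K" for S S'
      using orthogonal_parseval[OF assms(1,4,5)] that assms(3) by blast
    have "(\<Sum>X\<in>E. ((X *v b) $ k)\<^sup>2) = (\<Sum>X\<in>E. of_real ((X \<bullet> ?T1) * (X \<bullet> ?T1)) - of_real ((X \<bullet> ?T2) * (X \<bullet> ?T2))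
        + 2 * \<i> * of_real ((X \<bullet> ?T1) * (X \<bullet> ?T2)))"
    proof (rule sum.cong)
      fix X assume "X \<in> E"
      then show "((X *v b) $ k)\<^sup>2 = of_real ((X \<bullet> ?T1) * (X \<bullet> ?T1)) - of_real ((X \<bullet> ?T2) * (X \<bullet> ?T2))
        + 2 * \<i> * of_real ((X \<bullet> ?T1) * (X \<bullet> ?T2))"
        using e[of X] assms(2) by (auto simp: complex_eq_iff power2_eq_square algebra_simps)
    qed simp
    also have "\<dots> = of_real (\<Sum>X\<in>E. (X \<bullet> ?T1) * (X \<bullet> ?T1)) - of_real (\<Sum>X\<in>E. (X \<bullet> ?T2) * (X \<bullet> ?T2))
        + 2 * \<i> * of_real (\<Sum>X\<in>E. (X \<bullet> ?T1) * (X \<bullet> ?T2))"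
      by (simp only: of_real_sum sum.distrib sum_subtractf sum_distrib_left)
    also have "\<dots> = of_real c * ((?T1 *v b) $ k + \<i> * (?T2 *v b) $ k)"
      unfolding p[OF ip_T(1)] p[OF ip_T(2)] e[OF ip_T(1)] e[OF ip_T(2)]
      by (simp add: complex_eq_iff algebra_simps inner_commute[of ?T2 ?T1])
    also have "(?T1 *v b) $ k + \<i> * (?T2 *v b) $ k = ((?T1 + cs \<i> ?T2) *v b) $ k" by simp
    finally show ?thesis unfolding ip_decomp .
  qed
  then have *: "(\<Sum>X\<in>E. ((X *v b) $ k)\<^sup>2) = of_real c * (- (1/4) * (b $ k * b $ k + (J *v b) $ k * (J *v b) $ k))" for k
    by (simp only: T_b)
  have "(\<Sum>X\<in>E. qf b (X ** X)) = (\<Sum>X\<in>E. \<Sum>k\<in>UNIV. ((X *v b) $ k)\<^sup>2)"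
  proof (rule sum.cong)
    fix X assume "X \<in> E"
    then have "transpose X = X" using assms(2) by (auto simp: K_def imag_part_iff)
    then have "qf b (X ** X) = cdot (X *v b) (X *v b)"
      by (simp add: qf_def matrix_vector_mul_assoc[symmetric] cdot_matrix[of b])
    then show "qf b (X ** X) = (\<Sum>k\<in>UNIV. ((X *v b) $ k)\<^sup>2)" by (simp add: cdot_def power2_eq_square)
  qed simp
  also have "\<dots> = (\<Sum>k\<in>UNIV. of_real c * (- (1/4) * (b $ k * b $ k + (J *v b) $ k * (J *v b) $ k)))"
    by (subst sum.swap) (simp only: *)
  also have "\<dots> = of_real c * (- (1/4) * (cdot b b + cdot (J *v b) (J *v b)))"
    by (simp only: cdot_def sum_distrib_left[symmetric] sum.distrib)
  finally show ?thesis by (simp add: isotropic J_b)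
qed

end


section \<open>The Cartan embedding of the symmetric space\<close>

definition emb :: "'n::finite cmat2 set \<Rightarrow> 'n cmat2" where
  "emb C = the_elem ((\<lambda>q. q ** transpose q) ` C)"

lemma emb_proj: "emb (proj q) = q ** transpose q"
proof -
  have "(q ** k) ** transpose (q ** k) = q ** transpose q" if "k \<in> Ugroup" for k
  proof -
    have "(q ** k) ** transpose (q ** k) = q ** (k ** transpose k) ** transpose q"
      by (simp add: matrix_transpose_mul matrix_mul_assoc)
    then show ?thesis by (simp add: Ugroup_orthogonal[OF that])
  qed
  then have "(\<lambda>q. q ** transpose q) ` proj q = {q ** transpose q}"
    using one_in_Ugroup by (fastforce simp: proj_def image_iff)
  then show ?thesis by (simp add: emb_def)
qed

lemma self_in_proj: "q \<in> proj q"
  unfolding proj_def using one_in_Ugroup by (metis (mono_tags, lifting) CollectI matrix_mul_rid)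

lemma proj_mult:
  assumes k: "k \<in> Ugroup" shows "proj (q ** k) = proj q"
proof (intro equalityI subsetI)
  have ks: "k \<in> Sp" "cj k = k" using k by (auto simp: Ugroup_iff)
  fix r assume "r \<in> proj (q ** k)"
  then obtain k' where k': "r = q ** k ** k'" "k' \<in> Ugroup" unfolding proj_def by blast
  then have "k ** k' \<in> Ugroup" using ks by (simp add: Ugroup_iff Sp_mult cj_mult)
  moreover have "r = q ** (k ** k')" using k' by (simp add: matrix_mul_assoc)
  ultimately show "r \<in> proj q" unfolding proj_def by blast
next
  have ks: "k \<in> Sp" "cj k = k" using k by (auto simp: Ugroup_iff)
  fix r assume "r \<in> proj q"
  then obtain k' where k': "r = q ** k'" "k' \<in> Ugroup" unfolding proj_def by blast
  then have "adj k ** k' \<in> Ugroup" using ks by (simp add: Ugroup_iff Sp_mult Sp_adj cj_mult flip: adj_simps(7))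
  moreover have "r = (q ** k) ** (adj k ** k')"
  proof -
    have "(q ** k) ** (adj k ** k') = q ** (k ** (adj k ** k'))" by (simp only: matrix_mul_assoc)
    then show ?thesis using k' by (simp add: mult_adj_cancel ks)
  qed
  ultimately show "r \<in> proj (q ** k)" unfolding proj_def by blast
qed

text \<open>If the squares agree, \<open>k = adj q ** r\<close> is unitary and satisfies
  \<open>k ** transpose k = mat 1\<close>. Its transpose is then its adjoint, so \<open>k\<close> is
  real and lies in \<open>Ugroup\<close>.\<close>

lemma proj_eq_iff:
  assumes q: "q \<in> Sp" and r: "r \<in> Sp"
  shows "proj q = proj r \<longleftrightarrow> q ** transpose q = r ** transpose r"
proof
  assume "proj q = proj r" then show "q ** transpose q = r ** transpose r" by (metis emb_proj)
next
  assume e: "q ** transpose q = r ** transpose r"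
  let ?k = "adj q ** r"
  have k: "?k \<in> Sp" using q r by (simp add: Sp_mult Sp_adj)
  have "?k ** transpose ?k = adj q ** (r ** transpose r) ** transpose (adj q)"
    by (simp add: matrix_transpose_mul matrix_mul_assoc)
  also have "\<dots> = (adj q ** q) ** (transpose q ** transpose (adj q))" unfolding e[symmetric] by (simp add: matrix_mul_assoc)
  also have "transpose (adj q) = cj q" by (simp add: adj_def del: transpose_simps)
  finally have "?k ** transpose ?k = mat 1" by (simp add: SpD[OF q])
  then have "transpose ?k = adj ?k" using inverse_unique SpD(1)[OF k] by blast
  then have "cj ?k = ?k" unfolding adj_def[of ?k] by (metis transpose_iff)
  then have "?k \<in> Ugroup" using k by (simp add: Ugroup_iff)
  then have "proj (q ** ?k) = proj q" by (rule proj_mult)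
  then show "proj q = proj r" by (simp add: mult_adj_cancel q)
qed

lemma phi_eq: "phi a (proj q) = qf a (q ** transpose q)"
proof -
  have A: "transpose (rowvector a :: complex ^ _ ^ 1) ** rowvector a = outer a a"
    by (simp add: vec_eq_iff matrix_matrix_mult_def transpose_def rowvector_def outer_def)
  have "trace (outer a a ** P) = qf a P" for P
    by (simp add: trace_def matrix_matrix_mult_def outer_def qf_def cdot_def matrix_vector_mult_def sum_distrib_left mult_ac)
      (subst sum.swap, simp add: mult.left_commute)
  then show ?thesis by (simp add: phi_proj phi_hat_def Let_def A matrix_mul_assoc[symmetric])
qed

lemma qf_conj: "qf a (q ** X ** transpose q) = qf (transpose q *v a) X"
  by (simp add: qf_def matrix_vector_mul_assoc[symmetric] cdot_matrix[of a q] del: transpose_matrix_vector)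

lemma linear_qf: "linear (qf a)"
  by (simp add: linear_iff qf_def scaleR_conv_of_real[where 'a = complex])

lemma conj_cancel: assumes "q \<in> Sp"
  shows "adj q ** (q ** X ** transpose q) ** cj q = X" "q ** (adj q ** X ** cj q) ** transpose q = X"
proof -
  have "adj q ** (q ** X ** transpose q) ** cj q = (adj q ** q) ** X ** (transpose q ** cj q)" by (simp only: matrix_mul_assoc)
  then show "adj q ** (q ** X ** transpose q) ** cj q = X" by (simp add: SpD[OF assms])
  have "q ** (adj q ** X ** cj q) ** transpose q = (q ** adj q) ** X ** (cj q ** transpose q)" by (simp only: matrix_mul_assoc)
  then show "q ** (adj q ** X ** cj q) ** transpose q = X" by (simp add: SpD[OF assms])
qed

lemma inner_conj: assumes "q \<in> Sp"
  shows "(q ** A ** transpose q) \<bullet> (q ** B ** transpose q) = A \<bullet> B"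
proof -
  have t: "adj (transpose q) = cj q" by (simp add: adj_def)
  have "(q ** A ** transpose q) \<bullet> (q ** B ** transpose q) = A \<bullet> (adj q ** (q ** B ** transpose q) ** cj q)"
    unfolding inner_mult_right[of "q ** A"] t inner_mult_left[of q A] by (simp only: matrix_mul_assoc)
  then show ?thesis by (simp add: conj_cancel assms)
qed

lemma bounded_linear_conj: "bounded_linear (\<lambda>X. A ** X ** B)" for A B :: "'m::finite cmat"
  by (rule bounded_linear_compose[OF mm.bounded_linear_left mm.bounded_linear_right])

lemma bounded_linear_transpose: "bounded_linear (transpose :: 'm::finite cmat \<Rightarrow> 'm cmat)"
  using linear_transpose linear_conv_bounded_linear by blast

lemma bounded_linear_cj: "bounded_linear (cj :: 'm::finite cmat \<Rightarrow> 'm cmat)"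
  using linear_cj linear_conv_bounded_linear by blast

lemma smooth_square:
  assumes "open S" "smooth_on S s" shows "smooth_on S (\<lambda>y. s y ** transpose (s y :: 'm::finite cmat))"
  by (rule smooth_on_bilinear[OF bounded_bilinear_mm assms smooth_on_linear_comp[OF bounded_linear_transpose assms]])

lemma has_derivative_square:
  assumes "(s has_derivative s') (at x within S)"
  shows "((\<lambda>y. s y ** transpose (s y :: 'm::finite cmat)) has_derivative
     (\<lambda>v. s x ** transpose (s' v) + s' v ** transpose (s x))) (at x within S)"
  using mm.FDERIV[OF assms bounded_linear.has_derivative[OF bounded_linear_transpose assms]] .

lemma openin_SpU:
  "openin SpU_topology U \<longleftrightarrow> U \<subseteq> SpU \<and> openin (top_of_set Sp) {q \<in> Sp. proj q \<in> U}"
  by (simp add: SpU_topology_def openin_quotient_topology SpU_def)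

lemma topspace_SpU: "topspace SpU_topology = (SpU :: 'n::finite cmat2 set set)"
proof -
  have eq: "{q \<in> Sp. proj q \<in> (SpU :: 'n cmat2 set set)} = Sp" by (auto simp: SpU_def)
  have "openin SpU_topology (SpU :: 'n cmat2 set set)" unfolding openin_SpU eq by simp
  then have "SpU \<subseteq> topspace (SpU_topology :: 'n cmat2 set topology)" by (rule openin_subset)
  moreover have "topspace (SpU_topology :: 'n cmat2 set topology) \<subseteq> SpU"
    using openin_SpU openin_topspace by blast
  ultimately show ?thesis by blast
qed

lemma continuous_map_proj: "continuous_map (top_of_set Sp) SpU_topology proj"
  unfolding continuous_map_def topspace_SpU by (auto simp: openin_SpU) (simp add: SpU_def)

text \<open>A derivative within a submanifold is arbitrary in normal directions, but on velocities
  of curves in the set the chain rule determines it. This gives access to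
  \<open>dproj\<close>.\<close>

lemma derivative_within_unique:
  assumes "(f has_derivative f1) (at x within S)" "(f has_derivative f2) (at x within S)" "v \<in> tangent_space S x"
  shows "f1 v = f2 v"
proof -
  obtain \<gamma> e where g: "e > 0" "\<gamma> ` {-e<..<e} \<subseteq> S" "\<gamma> 0 = x" "(\<gamma> has_vector_derivative v) (at 0)"
    using assms(3) unfolding tangent_space_def by blast
  have *: "((f \<circ> \<gamma>) has_derivative (f' \<circ> (\<lambda>t. t *\<^sub>R v))) (at 0)" if "(f has_derivative f') (at x within S)" for f'
  proof -
    have "((f \<circ> \<gamma>) has_derivative (f' \<circ> (\<lambda>t. t *\<^sub>R v))) (at 0 within {-e<..<e})"
      using g that has_derivative_subset[OF that g(2)]
      by (intro diff_chain_within) (auto simp: has_vector_derivative_def intro: has_derivative_at_withinI)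
    then show ?thesis using at_within_open[of 0 "{-e<..<e}"] g(1) by simp
  qed
  have "f1 \<circ> (\<lambda>t. t *\<^sub>R v) = f2 \<circ> (\<lambda>t. t *\<^sub>R v)"
    using *[OF assms(1)] *[OF assms(2)] has_derivative_unique by blast
  then have "(f1 \<circ> (\<lambda>t. t *\<^sub>R v)) 1 = (f2 \<circ> (\<lambda>t. t *\<^sub>R v)) 1" by metis
  then show ?thesis by simp
qed

lemma tangent_space_mono: "S \<subseteq> T \<Longrightarrow> tangent_space S x \<subseteq> tangent_space T x"
  unfolding tangent_space_def by blast

lemma proj_subset: "q \<in> Sp \<Longrightarrow> proj q \<subseteq> Sp"
  using Sp_mult by (auto simp: proj_eq)

lemma proj_of_mem: "r \<in> proj q \<Longrightarrow> proj r = proj q"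
proof -
  assume "r \<in> proj q"
  then obtain k where "r = q ** k" "k \<in> Ugroup" unfolding proj_def by blast
  then show ?thesis using proj_mult by blast
qed

section \<open>Charts of the atlas\<close>

locale SpU_chart =
  fixes U :: "'n::finite cmat2 set set" and c :: "'n cmat2 set \<Rightarrow> 'n model"
  assumes chart: "(U, c) \<in> SpU_atlas"
begin

definition \<Omega> :: "'n model set" where "\<Omega> = c ` U"

definition \<psi> :: "'n model \<Rightarrow> 'n cmat2" where "\<psi> y = emb (inv_into U c y)"

lemma open_U: "openin (top_of_set Sp) {q \<in> Sp. proj q \<in> U}" and U_subset: "U \<subseteq> SpU"
  using chart unfolding SpU_atlas_def by (auto simp: openin_SpU)

lemma open_\<Omega>: "open \<Omega>"
  using chart unfolding SpU_atlas_def \<Omega>_def by simp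

lemma inj_c: "inj_on c U"
proof -
  have "homeomorphic_map (subtopology SpU_topology U) (top_of_set (c ` U)) c"
    using chart unfolding SpU_atlas_def by simp
  then have "inj_on c (topspace (subtopology SpU_topology U))" by (rule homeomorphic_imp_injective_map)
  then show ?thesis using U_subset by (simp add: topspace_SpU Int_absorb1)
qed

lemma inv_c: "p \<in> U \<Longrightarrow> inv_into U c (c p) = p"
  using inj_c by simp

lemma \<Omega>_cases:
  assumes "x \<in> \<Omega>" obtains q where "q \<in> Sp" "proj q \<in> U" "x = c (proj q)"
  using assms U_subset unfolding \<Omega>_def SpU_def by blast

lemma \<psi>_c: "proj q \<in> U \<Longrightarrow> \<psi> (c (proj q)) = q ** transpose q"
  by (simp add: \<psi>_def inv_c emb_proj)

text \<open>On tangent vectors \<open>dproj\<close> is replaced by the genuine derivative of a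
  smooth extension \<open>F\<close>, whose domain is shrunk so that all its group elements project
  into \<open>U\<close>.\<close>

lemma local_extension:
  assumes "q \<in> Sp" "proj q \<in> U"
  obtains V F where "open V" "q \<in> V" "smooth_on V F" "\<And>r. r \<in> Sp \<Longrightarrow> r \<in> V \<Longrightarrow> proj r \<in> U \<and> F r = c (proj r)"
    "((c \<circ> proj) has_derivative D F q) (at q within Sp)"
    "\<And>Z. Z \<in> tangent_space Sp q \<Longrightarrow> dproj c q Z = D F q Z"
proof -
  have "smooth_on_subset {q \<in> Sp. proj q \<in> U} (c \<circ> proj)" using chart unfolding SpU_atlas_def by simp
  moreover have "q \<in> {q \<in> Sp. proj q \<in> U}" using assms by simp
  ultimately obtain V F where "open V \<and> q \<in> V \<and> smooth_on V F \<and> (\<forall>y\<in>{q \<in> Sp. proj q \<in> U} \<inter> V. F y = (c \<circ> proj) y)"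
    unfolding smooth_on_subset_def by blast
  then have V: "open V" "q \<in> V" "smooth_on V F" "\<And>r. r \<in> Sp \<Longrightarrow> proj r \<in> U \<Longrightarrow> r \<in> V \<Longrightarrow> F r = c (proj r)"
    by auto
  obtain O' where O': "open O'" "{q \<in> Sp. proj q \<in> U} = Sp \<inter> O'" using open_U unfolding openin_open by blast
  have V': "open (V \<inter> O')" "q \<in> V \<inter> O'" "smooth_on (V \<inter> O') F"
    using V O' assms smooth_on_subset[OF V(3)] by auto
  have F: "proj r \<in> U \<and> F r = c (proj r)" if "r \<in> Sp" "r \<in> V \<inter> O'" for r using V(4)[of r] that O' by blast
  have d: "((c \<circ> proj) has_derivative D F q) (at q within Sp)"
  proof -
    obtain d where d: "d > 0" "ball q d \<subseteq> V \<inter> O'" using V'(1,2) openE by blast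
    show ?thesis
      by (rule has_derivative_transform_within[OF has_derivative_at_withinI[OF smooth_on_derivative[OF V'(3,2)]] d(1) assms(1)])
        (use F d(2) in \<open>auto simp: dist_commute subset_iff\<close>)
  qed
  then have "(c \<circ> proj) differentiable (at q within Sp)" by (auto simp: differentiable_def)
  then have "((c \<circ> proj) has_derivative dproj c q) (at q within Sp)" unfolding dproj_def frechet_derivative_works .
  note derivative_within_unique[OF this d]
  then show ?thesis by (intro that[OF V' F d])
qed

text \<open>The coordinates are constant on the coset. So 0 and \<open>D F q\<close> are both
  derivatives within the coset and agree on its tangent vectors.\<close>

lemma dproj_vertical:
  assumes "q \<in> Sp" "proj q \<in> U" "V \<in> real_part" shows "dproj c q (q ** V) = 0"
proof -
  obtain V' F where F: "open V'" "q \<in> V'" "smooth_on V' F" "\<And>r. r \<in> Sp \<Longrightarrow> r \<in> V' \<Longrightarrow> proj r \<in> U \<and> F r = c (proj r)"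
    "((c \<circ> proj) has_derivative D F q) (at q within Sp)"
    "\<And>Z. Z \<in> tangent_space Sp q \<Longrightarrow> dproj c q Z = D F q Z"
    by (rule local_extension[OF assms(1,2)]) (rule that; assumption)
  have t: "q ** V \<in> tangent_space (proj q) q" using assms by (auto simp: tangent_space_proj)
  have "((\<lambda>r. c (proj q)) has_derivative (\<lambda>v. 0)) (at q within proj q)" by simp
  then have "((c \<circ> proj) has_derivative (\<lambda>v. 0)) (at q within proj q)"
    by (rule has_derivative_transform_within[OF _ zero_less_one self_in_proj]) (simp add: proj_of_mem)
  moreover have "((c \<circ> proj) has_derivative D F q) (at q within proj q)"
    using has_derivative_subset[OF F(5) proj_subset[OF assms(1)]] .
  from derivative_within_unique[OF this calculation t] have "D F q (q ** V) = 0" by simp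
  moreover have "q ** V \<in> tangent_space Sp q" using t tangent_space_mono[OF proj_subset[OF assms(1)]] by blast
  ultimately show ?thesis using F(6) by metis
qed

lemma dproj_horizontal:
  assumes "q \<in> Sp" "proj q \<in> U" obtains X where "X \<in> imag_part" "dproj c q (q ** X) = u"
proof -
  obtain V F where V: "open V" "q \<in> V" "smooth_on V F" "\<And>r. r \<in> Sp \<Longrightarrow> r \<in> V \<Longrightarrow> proj r \<in> U \<and> F r = c (proj r)"
    "((c \<circ> proj) has_derivative D F q) (at q within Sp)"
    "\<And>Z. Z \<in> tangent_space Sp q \<Longrightarrow> dproj c q Z = D F q Z"
    by (rule local_extension[OF assms(1,2)]) (rule that; assumption)
  have "dproj c q ` tangent_space Sp q = UNIV" using chart assms unfolding SpU_atlas_def by blast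
  then have "u \<in> dproj c q ` {q ** X | X. X \<in> lie}" unfolding tangent_space_Sp[OF assms(1)] by simp
  then obtain X where X: "X \<in> lie" "dproj c q (q ** X) = u"
    by blast
  obtain A B where AB: "A \<in> real_part" "B \<in> imag_part" "X = A + B" using lie_decomp[OF X(1)] by blast
  then have "A \<in> lie" "B \<in> lie" by (auto simp: real_part_def imag_part_def)
  then have t: "q ** X \<in> tangent_space Sp q" "q ** A \<in> tangent_space Sp q" "q ** B \<in> tangent_space Sp q"
    using X(1) tangent_space_Sp[OF assms(1)] by auto
  have "D F q (q ** X) = D F q (q ** A) + D F q (q ** B)"
    unfolding AB(3) mm.add_right by (rule linear_add[OF linear_D[OF V(3,2)]])
  then have "dproj c q (q ** X) = dproj c q (q ** A) + dproj c q (q ** B)"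
    using V(6)[OF t(1)] V(6)[OF t(2)] V(6)[OF t(3)] by simp
  then show ?thesis using that[OF AB(2)] X(2) dproj_vertical[OF assms AB(1)] by simp
qed

text \<open>The Cayley transform parametrises a transversal to the coset through \<open>q\<close>.\<close>

lemma local_section:
  assumes q: "q \<in> Sp" "proj q \<in> U"
  obtains V s where "open V" "c (proj q) \<in> V" "V \<subseteq> \<Omega>" "smooth_on V s"
    "\<And>y. y \<in> V \<Longrightarrow> s y \<in> Sp \<and> proj (s y) \<in> U \<and> c (proj (s y)) = y"
proof -
  obtain V F where V: "open V" "q \<in> V" "smooth_on V F" "\<And>r. r \<in> Sp \<Longrightarrow> r \<in> V \<Longrightarrow> proj r \<in> U \<and> F r = c (proj r)"
    "((c \<circ> proj) has_derivative D F q) (at q within Sp)"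
    "\<And>Z. Z \<in> tangent_space Sp q \<Longrightarrow> dproj c q Z = D F q Z"
    by (rule local_extension[OF q]) (rule that; assumption)
  obtain L :: "'n model \<Rightarrow> 'n cmat2" where L: "linear L" "inj L" "range L = imag_part"
    by (rule imag_part_coordinates)
  have Llie: "range L \<subseteq> lie" using L(3) by (auto simp: imag_part_def)
  define \<sigma> where "\<sigma> = (\<lambda>y. q ** cay (L y))"
  have sm: "smooth_on UNIV \<sigma>" and Sp: "\<sigma> y \<in> Sp" and \<sigma>0: "\<sigma> 0 = q"
    and d\<sigma>: "(\<sigma> has_derivative (\<lambda>v. q ** (2 *\<^sub>R L v))) (at 0)" for y
    using cay_parametrisation[OF q(1) L(1) Llie] by (simp_all add: \<sigma>_def)
  define W0 where "W0 = \<sigma> -` V"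
  have W0: "open W0" "0 \<in> W0"
    using open_vimage[OF V(1)] smooth_on_imp_continuous_on[OF sm] \<sigma>0 V(2) by (auto simp: W0_def)
  define G where "G = (\<lambda>y. F (\<sigma> y))"
  have smG: "smooth_on W0 G"
    unfolding G_def by (rule smooth_on_compose[OF W0(1) V(1) _ smooth_on_subset[OF sm] V(3)]) (auto simp: W0_def)
  have Gc: "proj (\<sigma> y) \<in> U \<and> c (proj (\<sigma> y)) = G y" if "y \<in> W0" for y
    using V(4)[OF Sp, of y] that by (simp add: W0_def G_def)
  have "((F \<circ> \<sigma>) has_derivative (D F q \<circ> (\<lambda>v. q ** (2 *\<^sub>R L v)))) (at 0)"
    using smooth_on_derivative[OF V(3,2)] \<sigma>0 by (intro diff_chain_at d\<sigma>) auto
  then have DG: "D G 0 v = D F q (q ** (2 *\<^sub>R L v))" for v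
    unfolding G_def o_def by (simp add: D_eqI)
  have "u \<in> range (D G 0)" for u
  proof -
    obtain X where X: "X \<in> imag_part" "dproj c q (q ** X) = u" using dproj_horizontal[OF q] by blast
    then have t: "q ** X \<in> tangent_space Sp q" by (auto simp: tangent_space_Sp[OF q(1)] imag_part_def)
    have "(1/2) *\<^sub>R X \<in> range L" using X(1) L(3) subspace_scale[OF subspace_imag_part] by blast
    then obtain v where "(1/2) *\<^sub>R X = L v" by blast
    then have "X = 2 *\<^sub>R L v" by (metis (no_types) scaleR_half_double scaleR_2 scaleR_add_right)
    then have "D G 0 v = u" using X(2) V(6)[OF t] DG by simp
    then show ?thesis by blast
  qed
  \<comment> \<open>The parameters and the coordinates have the same type \<open>'n model\<close>,
    so a surjective differential is injective.\<close>
  then have "inj (D G 0)" using linear_surjective_imp_injective[OF linear_D[OF smG W0(2)]] by blast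
  then obtain W V' g where *: "open W" "W \<subseteq> W0" "0 \<in> W" "open V'" "G ` W = V'"
    "\<And>x. x \<in> W \<Longrightarrow> g (G x) = x" "g ` V' = W" "\<And>y. y \<in> V' \<Longrightarrow> G (g y) = y" "smooth_on V' g"
    using smooth_inverse_function[OF W0(1) smG W0(2)] by metis
  have s: "\<sigma> (g y) \<in> Sp \<and> proj (\<sigma> (g y)) \<in> U \<and> c (proj (\<sigma> (g y))) = y" if "y \<in> V'" for y
    using Gc[of "g y"] *(2,7,8) that Sp by auto
  show ?thesis
  proof (rule that[OF *(4) _ _ _ s])
    show "c (proj q) \<in> V'" using Gc[OF W0(2)] *(3,5) \<sigma>0 by auto
    show "V' \<subseteq> \<Omega>" using s unfolding \<Omega>_def by (metis image_eqI subsetI)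
    show "smooth_on V' (\<lambda>y. \<sigma> (g y))" by (rule smooth_on_compose[OF *(4) open_UNIV _ *(9) sm]) simp
  qed
qed

text \<open>Local sections \<open>s\<close> exist, and along them the immersion is
  \<open>s y ** transpose (s y)\<close>.\<close>

lemma smooth_\<psi>: "smooth_on \<Omega> \<psi>"
proof (rule smooth_on_local)
  fix x assume "x \<in> \<Omega>"
  then obtain q where q: "q \<in> Sp" "proj q \<in> U" "x = c (proj q)" by (rule \<Omega>_cases)
  obtain V s where V: "open V" "c (proj q) \<in> V" "smooth_on V s"
    "\<And>y. y \<in> V \<Longrightarrow> s y \<in> Sp \<and> proj (s y) \<in> U \<and> c (proj (s y)) = y"
    using local_section[OF q(1,2)] by metis
  have "smooth_on V \<psi>"
  proof (rule smooth_on_cong[OF V(1) smooth_square[OF V(1,3)]])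
    fix y assume "y \<in> V"
    then show "s y ** transpose (s y) = \<psi> y" using V(4)[of y] \<psi>_c[of "s y"] by simp
  qed
  then show "\<exists>V. open V \<and> x \<in> V \<and> smooth_on V \<psi>" using V q by blast
qed

lemma D\<psi>_dproj:
  assumes q: "q \<in> Sp" "proj q \<in> U" and Z: "Z \<in> tangent_space Sp q"
  shows "D \<psi> (c (proj q)) (dproj c q Z) = Z ** transpose q + q ** transpose Z"
proof -
  obtain V F where V: "open V" "q \<in> V" "smooth_on V F" "\<And>r. r \<in> Sp \<Longrightarrow> r \<in> V \<Longrightarrow> proj r \<in> U \<and> F r = c (proj r)"
    "((c \<circ> proj) has_derivative D F q) (at q within Sp)"
    "\<And>Z. Z \<in> tangent_space Sp q \<Longrightarrow> dproj c q Z = D F q Z"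
    by (rule local_extension[OF q]) (rule that; assumption)
  have x: "c (proj q) \<in> \<Omega>" using q by (auto simp: \<Omega>_def)
  have "((\<psi> \<circ> (c \<circ> proj)) has_derivative (D \<psi> (c (proj q)) \<circ> D F q)) (at q within Sp)"
    using smooth_on_derivative[OF smooth_\<psi> x] by (intro diff_chain_within V(5)) (auto intro: has_derivative_at_withinI)
  moreover have "((\<psi> \<circ> (c \<circ> proj)) has_derivative (\<lambda>v. q ** transpose v + v ** transpose q)) (at q within Sp)"
  proof -
    obtain O' where O': "open O'" "{q \<in> Sp. proj q \<in> U} = Sp \<inter> O'" using open_U unfolding openin_open by blast
    then obtain d where d: "d > 0" "ball q d \<subseteq> O'" using q openE by (metis (mono_tags, lifting) IntE mem_Collect_eq)
    have "((\<lambda>r. r ** transpose r) has_derivative (\<lambda>v. q ** transpose v + v ** transpose q)) (at q within Sp)"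
      using has_derivative_square[OF has_derivative_ident] .
    then show ?thesis
    proof (rule has_derivative_transform_within[OF _ d(1) q(1)])
      fix r assume r: "r \<in> Sp" "dist r q < d"
      then have "r \<in> Sp \<inter> O'" using d(2) by (auto simp: dist_commute)
      then have "proj r \<in> U" using O'(2) by blast
      then show "r ** transpose r = (\<psi> \<circ> (c \<circ> proj)) r" by (simp add: \<psi>_c)
    qed
  qed
  ultimately have "(D \<psi> (c (proj q)) \<circ> D F q) Z = q ** transpose Z + Z ** transpose q"
    using derivative_within_unique[OF _ _ Z] by blast
  then show ?thesis by (simp add: V(6)[OF Z])
qed

text \<open>Since \<open>X\<close> is symmetric, the two terms of the product rule coincide.
  Squaring this factor 2 gives the constant 1/4 in \<open>metric\<close>.\<close>

lemma D\<psi>_horizontal: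
  assumes q: "q \<in> Sp" "proj q \<in> U" and X: "X \<in> imag_part"
  shows "D \<psi> (c (proj q)) (dproj c q (q ** X)) = 2 *\<^sub>R (q ** X ** transpose q)"
proof -
  have "q ** X \<in> tangent_space Sp q" using X by (auto simp: tangent_space_Sp[OF q(1)] imag_part_def)
  moreover have "transpose (q ** X) = X ** transpose q" using X by (simp add: matrix_transpose_mul imag_part_iff)
  ultimately show ?thesis using D\<psi>_dproj[OF q] by (simp add: matrix_mul_assoc scaleR_2)
qed

lemma range_D\<psi>:
  assumes q: "q \<in> Sp" "proj q \<in> U"
  shows "range (D \<psi> (c (proj q))) = {q ** X ** transpose q | X. X \<in> imag_part}"
proof (intro equalityI subsetI)
  fix P assume "P \<in> range (D \<psi> (c (proj q)))"
  then obtain u where u: "P = D \<psi> (c (proj q)) u" by blast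
  obtain X where X: "X \<in> imag_part" "dproj c q (q ** X) = u" using dproj_horizontal[OF q] by blast
  then have "P = q ** (2 *\<^sub>R X) ** transpose q" using D\<psi>_horizontal[OF q X(1)] u by (simp add: mm_simps)
  then show "P \<in> {q ** X ** transpose q | X. X \<in> imag_part}"
    using X(1) subspace_scale[OF subspace_imag_part] by blast
next
  fix P assume "P \<in> {q ** X ** transpose q | X. X \<in> imag_part}"
  then obtain X where X: "P = q ** X ** transpose q" "X \<in> imag_part" by blast
  then have "(1/2) *\<^sub>R X \<in> imag_part" using subspace_scale[OF subspace_imag_part] by blast
  from D\<psi>_horizontal[OF q this] have "D \<psi> (c (proj q)) (dproj c q (q ** (1/2) *\<^sub>R X)) = P"
    using X(1) by (simp add: mm_simps)
  then show "P \<in> range (D \<psi> (c (proj q)))" by blast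
qed

text \<open>The velocity of the immersion moved back to the identity. If \<open>q ** X\<close> is
  the horizontal lift of \<open>u\<close>, this is \<open>2 *\<^sub>R X\<close>.\<close>

definition \<xi> :: "'n cmat2 \<Rightarrow> 'n model \<Rightarrow> 'n cmat2" where
  "\<xi> q u = adj q ** D \<psi> (c (proj q)) u ** cj q"

lemma linear_\<xi>:
  assumes q: "q \<in> Sp" "proj q \<in> U" shows "linear (\<xi> q)"
proof -
  have "linear (D \<psi> (c (proj q)))" using linear_D[OF smooth_\<psi>] q by (auto simp: \<Omega>_def)
  then show ?thesis
    unfolding \<xi>_def using linear_compose[OF _ bounded_linear.linear[OF bounded_linear_conj]] by (auto simp: o_def)
qed

lemma D\<psi>_\<xi>: "q \<in> Sp \<Longrightarrow> D \<psi> (c (proj q)) u = q ** \<xi> q u ** transpose q"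
  by (simp add: \<xi>_def conj_cancel)

lemma range_\<xi>:
  assumes q: "q \<in> Sp" "proj q \<in> U" shows "range (\<xi> q) = imag_part"
proof -
  have "range (\<xi> q) = (\<lambda>P. adj q ** P ** cj q) ` range (D \<psi> (c (proj q)))" by (auto simp: \<xi>_def)
  also have "\<dots> = imag_part" unfolding range_D\<psi>[OF q] by (force simp: conj_cancel[OF q(1)] image_iff)
  finally show ?thesis .
qed

text \<open>A dimension count: after the linear identification of \<pp> with the coordinate space,
  the map is a surjective endomorphism.\<close>

lemma inj_\<xi>:
  assumes q: "q \<in> Sp" "proj q \<in> U" shows "inj (\<xi> q)"
proof -
  obtain L :: "'n model \<Rightarrow> 'n cmat2" where L: "linear L" "inj L" "range L = imag_part"
    by (rule imag_part_coordinates)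
  obtain M where M: "linear M" "M \<circ> L = id" using linear_injective_left_inverse[OF L(1,2)] by blast
  have "y \<in> range (M \<circ> \<xi> q)" for y
  proof -
    have "L y \<in> range (\<xi> q)" using L(3) range_\<xi>[OF q] by blast
    then show ?thesis using M(2) by (metis comp_apply id_apply imageE rangeI)
  qed
  then have "inj (M \<circ> \<xi> q)"
    using linear_surjective_imp_injective[OF linear_compose[OF linear_\<xi>[OF q] M(1)]] by blast
  then show ?thesis using inj_on_imageI2 by blast
qed

lemma inj_D\<psi>: assumes "x \<in> \<Omega>" shows "inj (D \<psi> x)"
proof -
  obtain q where q: "q \<in> Sp" "proj q \<in> U" "x = c (proj q)" using assms by (rule \<Omega>_cases)
  show ?thesis using inj_\<xi>[OF q(1,2)] unfolding \<xi>_def q(3) inj_def by metis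
qed

text \<open>Every choice of a representative and of horizontal lifts yields the same expression in
  the immersion. This settles uniqueness in the description of \<open>SpU_metric\<close>, and the
  existence of lifts settles the rest.\<close>

lemma metric:
  assumes "x \<in> \<Omega>" shows "SpU_metric (U, c) x u v = (1/4) * (D \<psi> x u \<bullet> D \<psi> x v)"
proof -
  let ?P = "\<lambda>r. \<exists>q X Y. q \<in> Sp \<and> proj q \<in> U \<and> c (proj q) = x \<and>
     X \<in> horizontal q \<and> Y \<in> horizontal q \<and> dproj c q X = u \<and> dproj c q Y = v \<and> r = Sp_metric q X Y"
  have uniq: "r = (1/4) * (D \<psi> x u \<bullet> D \<psi> x v)" if P: "?P r" for r
  proof -
    obtain q X Y where q: "q \<in> Sp" "proj q \<in> U" "c (proj q) = x" and
      XY: "X \<in> horizontal q" "Y \<in> horizontal q" "dproj c q X = u" "dproj c q Y = v" "r = Sp_metric q X Y"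
      using P by blast
    obtain A B where AB: "X = q ** A" "A \<in> imag_part" "Y = q ** B" "B \<in> imag_part"
      using XY(1,2) unfolding horizontal[OF q(1)] by blast
    have "D \<psi> x u = 2 *\<^sub>R (q ** A ** transpose q)" "D \<psi> x v = 2 *\<^sub>R (q ** B ** transpose q)"
      using D\<psi>_horizontal[OF q(1,2)] AB XY q(3) by auto
    then show ?thesis using AB XY(5) q(1) by (simp add: Sp_metric_mult inner_conj)
  qed
  obtain q where q: "q \<in> Sp" "proj q \<in> U" "x = c (proj q)" using assms by (rule \<Omega>_cases)
  obtain A where A: "A \<in> imag_part" "dproj c q (q ** A) = u" using dproj_horizontal[OF q(1,2)] by blast
  obtain B where B: "B \<in> imag_part" "dproj c q (q ** B) = v" using dproj_horizontal[OF q(1,2)] by blast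
  have "?P (Sp_metric q (q ** A) (q ** B))"
    using q A B horizontal[OF q(1)] by blast
  then have "(THE r. ?P r) = (1/4) * (D \<psi> x u \<bullet> D \<psi> x v)"
    using uniq by (intro the_equality) metis+
  then show ?thesis by (simp add: SpU_metric_def)
qed

lemma linear_relation:
  assumes "bounded_linear l" "\<And>y. y \<in> \<Omega> \<Longrightarrow> l (\<psi> y) = 0" "x \<in> \<Omega>"
  shows "l (D (\<lambda>y. D \<psi> y u) x v) = 0"
proof -
  have 1: "l (D \<psi> y u) = 0" if "y \<in> \<Omega>" for y
  proof -
    have "l (D \<psi> y u) = D (\<lambda>y. l (\<psi> y)) y u"
      using D_linear_comp[OF assms(1) smooth_on_differentiable[OF smooth_\<psi> that]] by simp
    also have "D (\<lambda>y. l (\<psi> y)) y = D (\<lambda>y. 0) y" by (rule D_cong[OF open_\<Omega> that assms(2)])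
    finally show ?thesis by simp
  qed
  have "l (D (\<lambda>y. D \<psi> y u) x v) = D (\<lambda>y. l (D \<psi> y u)) x v"
    using D_linear_comp[OF assms(1) smooth_on_differentiable[OF smooth_on_D[OF smooth_\<psi>] assms(3)]] by simp
  also have "D (\<lambda>y. l (D \<psi> y u)) x = D (\<lambda>y. 0) x" by (rule D_cong[OF open_\<Omega> assms(3) 1])
  finally show ?thesis by simp
qed

text \<open>Differentiating \<open>\<psi> \<cdot> cj \<psi> = 1\<close> twice determines the real part of the second derivative.\<close>

lemma second_derivative:
  assumes q: "q \<in> Sp" "proj q \<in> U"
  shows "adj q ** D (\<lambda>y. D \<psi> y u) (c (proj q)) u ** cj q - \<xi> q u ** \<xi> q u \<in> imag_part"
proof -
  let ?x = "c (proj q)" and ?X = "\<xi> q u"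
  let ?H = "D (\<lambda>y. D \<psi> y u) ?x u"
  let ?Q = "adj q ** ?H ** cj q"
  have x: "?x \<in> \<Omega>" using q by (auto simp: \<Omega>_def)
  have H: "?H = q ** ?Q ** transpose q" by (simp add: conj_cancel q)
  have X: "?X \<in> imag_part" using range_\<xi>[OF q] by blast
  have sq: "\<exists>q\<in>Sp. \<psi> y = q ** transpose q" if y: "y \<in> \<Omega>" for y
  proof -
    obtain q where "q \<in> Sp" "proj q \<in> U" "y = c (proj q)" using y by (rule \<Omega>_cases)
    then show ?thesis using \<psi>_c by blast
  qed
  \<comment> \<open>Symmetry and the quaternionic condition are linear equations on the image, so
    second derivatives inherit them.\<close>
  have "transpose ?H - ?H = 0"
    by (rule linear_relation[OF bounded_linear_sub[OF bounded_linear_transpose bounded_linear_ident] _ x])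
      (use sq in \<open>fastforce simp: matrix_transpose_mul\<close>)
  then have "transpose ?Q = ?Q" by (simp add: matrix_transpose_mul matrix_mul_assoc adj_def)
  moreover have "quat ?Q"
  proof -
    have bl: "bounded_linear (\<lambda>P. J ** cj P - P ** J :: 'n cmat2)"
      by (intro bounded_linear_sub bounded_linear_compose[OF mm.bounded_linear_right bounded_linear_cj] mm.bounded_linear_left)
    have "J ** cj ?H - ?H ** J = 0"
    proof (rule linear_relation[OF bl _ x])
      fix y assume "y \<in> \<Omega>"
      then obtain r where r: "r \<in> Sp" "\<psi> y = r ** transpose r" using sq by blast
      have "quat (\<psi> y)" unfolding r(2) by (rule quat_square[OF r(1)])
      then show "J ** cj (\<psi> y) - \<psi> y ** J = 0" by (simp add: quat_def)
    qed
    then have "quat ?H" by (simp add: quat_def)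
    then show ?thesis using SpD(3)[OF q(1)] by (intro quat_mult quat_adj quat_cj)
  qed
  moreover have s: "?Q + cj ?Q = 2 *\<^sub>R (?X ** ?X)"
  proof -
    have d: "((\<lambda>y. \<psi> y) has_derivative D \<psi> y) (at y)" if "y \<in> \<Omega>" for y using smooth_on_derivative[OF smooth_\<psi> that] .
    have dc: "((\<lambda>y. cj (\<psi> y)) has_derivative (\<lambda>v. cj (D \<psi> y v))) (at y)" if "y \<in> \<Omega>" for y
      by (rule bounded_linear.has_derivative[OF bounded_linear_cj d[OF that]])
    have 1: "\<psi> y ** cj (D \<psi> y u) + D \<psi> y u ** cj (\<psi> y) = 0" if "y \<in> \<Omega>" for y
    proof -
      have "D (\<lambda>y. \<psi> y ** cj (\<psi> y)) y u = \<psi> y ** cj (D \<psi> y u) + D \<psi> y u ** cj (\<psi> y)"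
        using D_eqI[OF mm.FDERIV[OF d[OF that] dc[OF that]]] by simp
      moreover have "D (\<lambda>y. \<psi> y ** cj (\<psi> y)) y = D (\<lambda>y. mat 1) y"
      proof (rule D_cong[OF open_\<Omega> that])
        fix y assume "y \<in> \<Omega>"
        then obtain r where r: "r \<in> Sp" "\<psi> y = r ** transpose r" using sq by blast
        have "\<psi> y ** cj (\<psi> y) = r ** (transpose r ** cj r) ** cj (transpose r)"
          by (simp add: r(2) cj_mult matrix_mul_assoc)
        then show "\<psi> y ** cj (\<psi> y) = mat 1" using SpD(2)[OF r(1)] by (simp add: SpD[OF r(1)] adj_def)
      qed
      ultimately show ?thesis by simp
    qed
    let ?A = "D \<psi> ?x u"
    have d2: "((\<lambda>y. D \<psi> y u) has_derivative (\<lambda>v. D (\<lambda>y. D \<psi> y u) ?x v)) (at ?x)"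
      by (rule smooth_on_derivative[OF smooth_on_D[OF smooth_\<psi>] x])
    have d2c: "((\<lambda>y. cj (D \<psi> y u)) has_derivative (\<lambda>v. cj (D (\<lambda>y. D \<psi> y u) ?x v))) (at ?x)"
      by (rule bounded_linear.has_derivative[OF bounded_linear_cj d2])
    have "D (\<lambda>y. \<psi> y ** cj (D \<psi> y u) + D \<psi> y u ** cj (\<psi> y)) ?x u =
        (\<psi> ?x ** cj ?H + ?A ** cj ?A) + (?A ** cj ?A + ?H ** cj (\<psi> ?x))"
      using D_eqI[OF has_derivative_add[OF mm.FDERIV[OF d[OF x] d2c] mm.FDERIV[OF d2 dc[OF x]]]] by simp
    moreover have "D (\<lambda>y. \<psi> y ** cj (D \<psi> y u) + D \<psi> y u ** cj (\<psi> y)) ?x = D (\<lambda>y. 0) ?x"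
      by (rule D_cong[OF open_\<Omega> x 1])
    ultimately have sum0: "(\<psi> ?x ** cj ?H + ?A ** cj ?A) + (?A ** cj ?A + ?H ** cj (\<psi> ?x)) = 0" by simp
    have prod: "(q ** M ** transpose q) ** cj (q ** N ** transpose q) = q ** (M ** cj N) ** adj q" for M N
    proof -
      have "(q ** M ** transpose q) ** cj (q ** N ** transpose q) = q ** M ** (transpose q ** cj q) ** cj N ** cj (transpose q)"
        by (simp only: cj_mult matrix_mul_assoc)
      then show ?thesis by (simp add: SpD[OF q(1)] matrix_mul_assoc adj_def)
    qed
    have A: "?A = q ** ?X ** transpose q" by (rule D\<psi>_\<xi>[OF q(1)])
    have P: "\<psi> ?x = q ** mat 1 ** transpose q" by (simp add: \<psi>_c[OF q(2)])
    have cX: "cj ?X = - ?X" using X by (simp add: imag_part_iff)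
    have 1: "\<psi> ?x ** cj ?H = q ** cj ?Q ** adj q" unfolding P by (subst H) (simp only: prod matrix_mul_lid)
    have 2: "?H ** cj (\<psi> ?x) = q ** ?Q ** adj q" unfolding P by (subst H) (simp only: prod, simp only: cj_mat_1 matrix_mul_rid)
    have 3: "?A ** cj ?A = - (q ** (?X ** ?X) ** adj q)" unfolding A prod cX by (simp add: mm_simps)
    have gen: "h' + c' - 2 *\<^sub>R x' = 0" if "(c' + - x') + (- x' + h') = 0" for h' c' x' :: "'n cmat2"
      using that by (simp add: scaleR_2 algebra_simps)
    from gen[OF sum0[unfolded 1 2 3]] have "q ** (?Q + cj ?Q - 2 *\<^sub>R (?X ** ?X)) ** adj q = 0"
      by (simp only: mm.add_left mm.add_right mm.diff_left mm.diff_right mm.scaleR_left mm.scaleR_right)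
    then have "adj q ** (q ** (?Q + cj ?Q - 2 *\<^sub>R (?X ** ?X)) ** adj q) ** q = 0" by (simp only: mm.zero_left mm.zero_right)
    moreover have "adj q ** (q ** M ** adj q) ** q = M" for M
    proof -
      have "adj q ** (q ** M ** adj q) ** q = (adj q ** q) ** M ** (adj q ** q)" by (simp only: matrix_mul_assoc)
      then show ?thesis by (simp add: SpD[OF q(1)])
    qed
    ultimately have "?Q + cj ?Q - 2 *\<^sub>R (?X ** ?X) = 0" by (simp only:)
    then show ?thesis by simp
  qed
  \<comment> \<open>\<open>?X ** ?X\<close> is the real part of \<open>?Q\<close>, so the difference
    is its imaginary part.\<close>
  moreover have e: "?Q - ?X ** ?X = (1/2) *\<^sub>R (?Q - cj ?Q)"
  proof -
    have "?X ** ?X = (1/2) *\<^sub>R (?Q + cj ?Q)" unfolding s by simp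
    moreover have "?Q = (1/2) *\<^sub>R ?Q + (1/2) *\<^sub>R ?Q" by (simp flip: scaleR_left_distrib)
    ultimately show ?thesis by (simp add: algebra_simps)
  qed
  ultimately show ?thesis by (metis half_diff_cj_imag_part)
qed

end


lemma isotropic_fibre:
  assumes "a \<noteq> 0" "q \<in> Sp" "qf a (q ** transpose q) = 0"
  shows "isotropic (transpose q *v a)"
proof
  have "qf a (q ** transpose q) = qf (transpose q *v a) (mat 1)" using qf_conj[of a q "mat 1"] by simp
  then show "cdot (transpose q *v a) (transpose q *v a) = 0" using assms(3) by (simp add: qf_def)
  have "cj q *v (transpose q *v a) = a" by (simp add: matrix_vector_mul_assoc SpD[OF assms(2)] del: transpose_matrix_vector)
  then show "transpose q *v a \<noteq> 0" using assms(1) by (metis matrix_vector_mult_0_right)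
qed

section \<open>The fibre in a chart\<close>

context SpU_chart
begin

lemma phi_inv: "y \<in> \<Omega> \<Longrightarrow> phi a (inv_into U c y) = qf a (\<psi> y)"
  by (erule \<Omega>_cases) (simp add: inv_c phi_eq \<psi>_c)

lemma regular_fibre:
  assumes "a \<noteq> 0" "x \<in> \<Omega>" "qf a (\<psi> x) = 0"
  shows "surj (\<lambda>u. qf a (D \<psi> x u))"
proof -
  obtain q where q: "q \<in> Sp" "proj q \<in> U" "x = c (proj q)" using assms(2) by (rule \<Omega>_cases)
  interpret isotropic "transpose q *v a"
    using isotropic_fibre[OF assms(1) q(1)] assms(3) \<psi>_c[OF q(2)] q(3) by simp
  have "\<exists>u. qf a (D \<psi> x u) = \<zeta>" for \<zeta>
  proof -
    obtain X where X: "X \<in> imag_part" "qf (transpose q *v a) X = \<zeta>" using surj_qf by blast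
    then have "q ** X ** transpose q \<in> range (D \<psi> x)" unfolding q(3) range_D\<psi>[OF q(1,2)] by blast
    then obtain u where u: "q ** X ** transpose q = D \<psi> x u" by blast
    have "qf a (D \<psi> x u) = \<zeta>" unfolding u[symmetric] qf_conj by (rule X(2))
    then show ?thesis by blast
  qed
  then show ?thesis by (metis surj_def)
qed

lemma zero_set: "a \<noteq> 0 \<Longrightarrow> immersed_zero_set \<Omega> \<psi> (qf a) (1/4) (SpU_metric (U, c))"
  by (rule immersed_zero_set.intro) (auto simp: open_\<Omega> smooth_\<psi> linear_qf metric inj_D\<psi> regular_fibre)

lemma mean_curvature_fibre:
  assumes "a \<noteq> 0" "p \<in> U" "phi a p = 0"
  shows "mean_curvature (SpU_metric (U, c)) (c ` (U \<inter> {p \<in> SpU. phi a p = 0})) (c p) = 0"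
proof -
  interpret S: immersed_zero_set \<Omega> \<psi> "qf a" "1/4" "SpU_metric (U, c)" by (rule zero_set[OF assms(1)])
  obtain q where q: "q \<in> Sp" "p = proj q" using assms(2) U_subset by (auto simp: SpU_def)
  have qU: "proj q \<in> U" using assms(2) q by simp
  let ?x = "c (proj q)" and ?b = "transpose q *v a"
  have phi0: "qf a (q ** transpose q) = 0" using assms(3) q by (simp add: phi_eq)
  interpret isotropic ?b by (rule isotropic_fibre[OF assms(1) q(1) phi0])
  have x: "?x \<in> \<Omega>" using qU by (simp add: \<Omega>_def)
  have fibre: "c ` (U \<inter> {p \<in> SpU. phi a p = 0}) = S.S"
  proof (intro equalityI subsetI)
    fix y assume "y \<in> c ` (U \<inter> {p \<in> SpU. phi a p = 0})"
    then obtain r where r: "r \<in> U" "phi a r = 0" "y = c r" by blast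
    then have y: "y \<in> \<Omega>" by (simp add: \<Omega>_def)
    then show "y \<in> S.S" using phi_inv[OF y, of a] r by (simp add: S.S_def inv_c)
  next
    fix y assume "y \<in> S.S"
    then have y: "y \<in> \<Omega>" "phi a (inv_into U c y) = 0" by (auto simp: S.S_def phi_inv)
    then obtain r where "r \<in> U" "y = c r" by (auto simp: \<Omega>_def)
    then show "y \<in> c ` (U \<inter> {p \<in> SpU. phi a p = 0})" using y U_subset by (auto simp: inv_c)
  qed
  let ?II = "\<lambda>u. q ** (\<xi> q u ** \<xi> q u) ** transpose q"
  have \<xi>im: "\<xi> q u \<in> imag_part" for u using range_\<xi>[OF q(1) qU] by blast
  have D\<xi>: "D \<psi> ?x u = q ** \<xi> q u ** transpose q" for u by (rule D\<psi>_\<xi>[OF q(1)])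
  have "mean_curvature (SpU_metric (U, c)) S.S ?x = 0"
  proof (rule S.mean_curvature_zero)
    show "?x \<in> S.S" using x phi0 \<psi>_c[OF qU] by (simp add: S.S_def)
  next
    fix u
    let ?H = "S.D2 ?x u u"
    have "?H - ?II u = q ** (adj q ** ?H ** cj q - \<xi> q u ** \<xi> q u) ** transpose q"
      by (simp only: mm.diff_left mm.diff_right conj_cancel[OF q(1)])
    moreover have "adj q ** ?H ** cj q - \<xi> q u ** \<xi> q u \<in> imag_part"
      unfolding S.D2_def by (rule second_derivative[OF q(1) qU])
    ultimately show "?H - ?II u \<in> range (D \<psi> ?x)" unfolding range_D\<psi>[OF q(1) qU] by blast
  next
    fix u w
    \<comment> \<open>The square of an imaginary matrix is real, whereas tangent vectors are
      imaginary, so they are orthogonal.\<close>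
    have c1: "cj (\<xi> q u ** \<xi> q u) = \<xi> q u ** \<xi> q u" using \<xi>im[of u] by (simp add: imag_part_iff cj_mult mm_simps)
    have c2: "cj (\<xi> q w) = - \<xi> q w" using \<xi>im[of w] by (simp add: imag_part_iff)
    show "?II u \<bullet> D \<psi> ?x w = 0" unfolding D\<xi> inner_conj[OF q(1)] by (rule inner_real_imag[OF c1 c2])
  next
    fix E assume E: "orthonormal_basis (SpU_metric (U, c)) ?x (S.K ?x) E"
    have SK: "u \<in> S.K ?x \<longleftrightarrow> \<xi> q u \<in> K" for u
      unfolding S.K_def K_def using \<xi>im by (simp add: D\<xi> qf_conj)
    have inj: "inj_on (\<xi> q) E" using inj_\<xi>[OF q(1) qU] inj_on_subset by blast
    \<comment> \<open>The metric of the chart is a quarter of the inner product on \<pp>, so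
      orthonormal vectors get squared length 4.\<close>
    have inner: "\<xi> q e \<bullet> \<xi> q f = (if \<xi> q e = \<xi> q f then 4 else 0)" if "e \<in> E" "f \<in> E" for e f
    proof -
      have "SpU_metric (U, c) ?x e f = (if e = f then 1 else 0)" using E that by (simp add: orthonormal_basis_def)
      moreover have "SpU_metric (U, c) ?x e f = (1/4) * (\<xi> q e \<bullet> \<xi> q f)"
        by (simp add: metric[OF x] D\<xi> inner_conj[OF q(1)])
      ultimately show ?thesis using inj that by (auto simp: inj_on_def split: if_splits)
    qed
    have "(\<Sum>X\<in>\<xi> q ` E. qf ?b (X ** X)) = 0"
    proof (rule trace_qf_square[of _ 4])
      show "finite (\<xi> q ` E)" using E by (simp add: orthonormal_basis_def)
      show "\<xi> q ` E \<subseteq> K" using E SK by (auto simp: orthonormal_basis_def)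
      show "K \<subseteq> span (\<xi> q ` E)"
      proof
        fix X assume X: "X \<in> K"
        then have "X \<in> range (\<xi> q)" unfolding range_\<xi>[OF q(1) qU] K_def by blast
        then obtain u where u: "X = \<xi> q u" by blast
        then have "u \<in> S.K ?x" using SK X by blast
        moreover have "S.K ?x \<subseteq> span E" using E by (simp add: orthonormal_basis_def)
        ultimately have "u \<in> span E" by blast
        then show "X \<in> span (\<xi> q ` E)" using linear_span_image[OF linear_\<xi>[OF q(1) qU]] u by blast
      qed
      show "e \<bullet> f = (if e = f then 4 else 0)" if "e \<in> \<xi> q ` E" "f \<in> \<xi> q ` E" for e f
        using that inner by auto
    qed simp
    then show "(\<Sum>e\<in>E. qf a (?II e)) = 0" by (simp only: qf_conj sum.reindex[OF inj] o_def)
  qed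
  then show ?thesis using fibre q(2) by simp
qed

end

section \<open>Slice charts\<close>

lemma norm_cj: "norm (cj A) = norm (A :: 'm::finite cmat)"
  by (simp add: norm_eq_sqrt_inner inner_cj)

text \<open>Near the identity the secants of the image of the Cartan embedding are almost imaginary:
  \<open>Y cj Y = Y' cj Y' = 1\<close> bounds the real part of \<open>Y - Y'\<close> by a small multiple of \<open>Y - Y'\<close>.\<close>

lemma secant:
  fixes \<Lambda> :: "'n::finite cmat2 \<Rightarrow> 'n model" and L :: "'n model \<Rightarrow> 'n cmat2"
  assumes "linear \<Lambda>" "linear L" "range L = imag_part" "\<And>y. \<Lambda> (L y) = y"
  obtains e where "e > 0" "\<And>k k'. k \<in> Sp \<Longrightarrow> k' \<in> Sp \<Longrightarrow> norm (k ** transpose k - mat 1) < e \<Longrightarrow>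
    norm (k' ** transpose k' - mat 1) < e \<Longrightarrow> \<Lambda> (k ** transpose k) = \<Lambda> (k' ** transpose k') \<Longrightarrow>
    k ** transpose k = k' ** transpose k'"
proof -
  obtain K1 where K1: "K1 > 0" "\<And>(A :: 'n cmat2) (B :: 'n cmat2). norm (A ** B) \<le> norm A * norm B * K1"
    using bounded_bilinear.pos_bounded[OF bounded_bilinear_mm[where 'm = "'n + 'n"]] by metis
  obtain K2 where K2: "K2 > 0" "\<And>A. norm (\<Lambda> A) \<le> K2 * norm A"
    using assms(1) linear_bounded_pos by blast
  obtain K3 where K3: "K3 > 0" "\<And>y. norm (L y) \<le> K3 * norm y"
    using assms(2) linear_bounded_pos by blast
  define C where "C = (1 + K3 * K2) * (2 * K1)"
  have C: "C > 0" using K1 K2 K3 by (simp add: C_def add_pos_pos)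
  \<comment> \<open>\<open>C\<close> collects the constants of the two estimates below, which
    combine to \<open>norm ?Q \<le> (C * e) * norm ?Q\<close>. This choice makes the factor 1/2 and
    forces \<open>?Q = 0\<close>.\<close>
  define e where "e = 1 / (2 * C)"
  have e: "e > 0" using C by (simp add: e_def)
  show ?thesis
  proof (rule that[OF e])
    fix k k' :: "'n cmat2"
    assume k: "k \<in> Sp" "k' \<in> Sp" "norm (k ** transpose k - mat 1) < e" "norm (k' ** transpose k' - mat 1) < e"
      "\<Lambda> (k ** transpose k) = \<Lambda> (k' ** transpose k')"
    let ?Y = "k ** transpose k" and ?Y' = "k' ** transpose k'"
    let ?Q = "?Y - ?Y'" and ?R = "?Y' - mat 1"
    let ?re = "(1/2) *\<^sub>R (?Q + cj ?Q)" and ?im = "(1/2) *\<^sub>R (?Q - cj ?Q)"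
    have YY: "r ** transpose r ** cj (r ** transpose r) = mat 1" if "r \<in> Sp" for r :: "'n cmat2"
    proof -
      have "r ** transpose r ** cj (r ** transpose r) = r ** (transpose r ** cj r) ** adj r"
        by (simp add: cj_mult matrix_mul_assoc adj_def)
      then show ?thesis by (simp add: SpD[OF that])
    qed
    have "transpose ?Q = ?Q" by (simp only: transpose_simps transpose_square)
    moreover have "quat ?Q" by (rule quat_simps(3)[OF quat_square[OF k(1)] quat_square[OF k(2)]])
    ultimately have "?im \<in> imag_part" by (rule half_diff_cj_imag_part)
    then obtain y where y: "?im = L y" using assms(3) by blast
    have split: "?Q = ?re + ?im"
      by (simp only: scaleR_right_distrib scaleR_right_diff_distrib) (simp flip: scaleR_left_distrib)
    \<comment> \<open>As \<open>\<Lambda>\<close> inverts \<open>L\<close> on \<pp>, the vanishing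
      of \<open>\<Lambda> ?Q\<close> lets the real part of \<open>?Q\<close> control the imaginary
      part.\<close>
    have "\<Lambda> ?Q = 0" using k(5) by (simp add: linear_diff[OF assms(1)])
    then have "\<Lambda> ?re + y = 0"
      using linear_add[OF assms(1), of ?re ?im] unfolding split[symmetric] unfolding y assms(4) by simp
    then have "y = - \<Lambda> ?re" by (simp only: add_eq_0_iff)
    then have "norm y = norm (\<Lambda> ?re)" by (simp only: norm_minus_cancel)
    then have "norm y \<le> K2 * norm ?re" using K2(2)[of ?re] by simp
    then have "K3 * norm y \<le> K3 * (K2 * norm ?re)" using K3(1) by (intro mult_left_mono) auto
    then have "norm ?im \<le> K3 * (K2 * norm ?re)" unfolding y using K3(2)[of y] by (rule order_trans[rotated])
    then have 1: "norm ?Q \<le> (1 + K3 * K2) * norm ?re"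
      using norm_triangle_ineq[of ?re ?im] unfolding split[symmetric] by (simp add: algebra_simps)
    \<comment> \<open>Expanding around \<open>?Y' = mat 1 + ?R\<close> leaves
      \<open>?Q + cj ?Q\<close>, twice the real part, plus products with a small factor
      \<open>?R\<close> or \<open>?Q\<close>.\<close>
    have "?Y ** cj ?Y = (mat 1 + ?R + ?Q) ** cj (mat 1 + ?R + ?Q)" by simp
    also have "\<dots> = (mat 1 + ?R) ** cj (mat 1 + ?R) + (?Q + cj ?Q) + (?Q ** cj ?R + ?R ** cj ?Q + ?Q ** cj ?Q)"
      unfolding cj_simps(1) mm.add_left mm.add_right cj_mat_1 matrix_mul_lid matrix_mul_rid by (simp only: ac_simps)
    also have "(mat 1 + ?R) ** cj (mat 1 + ?R) = ?Y' ** cj ?Y'" by simp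
    finally have "mat 1 = mat 1 + (?Q + cj ?Q) + (?Q ** cj ?R + ?R ** cj ?Q + ?Q ** cj ?Q)"
      unfolding YY[OF k(1)] YY[OF k(2)] .
    moreover have "s = - p" if "m = m + s + p" for m s p :: "'n cmat2"
      using that by (simp add: eq_neg_iff_add_eq_0 add.assoc)
    ultimately have "?Q + cj ?Q = - (?Q ** cj ?R + ?R ** cj ?Q + ?Q ** cj ?Q)" by blast
    then have "norm (?Q + cj ?Q) = norm (?Q ** cj ?R + ?R ** cj ?Q + ?Q ** cj ?Q)" by (simp only: norm_minus_cancel)
    also have "\<dots> \<le> norm (?Q ** cj ?R) + norm (?R ** cj ?Q) + norm (?Q ** cj ?Q)"
      by (intro norm_triangle_le add_mono order_refl norm_triangle_ineq)
    also have "\<dots> \<le> norm ?Q * norm ?R * K1 + norm ?R * norm ?Q * K1 + norm ?Q * norm ?Q * K1"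
      using K1(2)[of ?Q "cj ?R"] K1(2)[of ?R "cj ?Q"] K1(2)[of ?Q "cj ?Q"] unfolding norm_cj by (intro add_mono)
    also have "\<dots> = (2 * norm ?R + norm ?Q) * (norm ?Q * K1)" by (simp add: algebra_simps)
    also have "\<dots> \<le> (4 * e) * (norm ?Q * K1)"
    proof (rule mult_right_mono)
      have "norm ?Q \<le> norm (?Y - mat 1) + norm ?R" using norm_triangle_ineq4[of "?Y - mat 1" ?R] by simp
      then show "2 * norm ?R + norm ?Q \<le> 4 * e" using k(3,4) by linarith
    qed (use K1 in simp)
    finally have "norm ?re \<le> 2 * e * K1 * norm ?Q" by (simp add: mult_ac)
    then have "(1 + K3 * K2) * norm ?re \<le> (1 + K3 * K2) * (2 * e * K1 * norm ?Q)"
      using K2 K3 by (intro mult_left_mono) auto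
    then have "norm ?Q \<le> (C * e) * norm ?Q" using 1 by (simp add: C_def algebra_simps)
    moreover have "C * e = 1/2" using C by (simp add: e_def)
    ultimately have "norm ?Q = 0" by simp
    then show "?Y = ?Y'" by simp
  qed
qed

lemma curve_tangent:
  fixes f :: "'a::euclidean_space \<Rightarrow> 'b::euclidean_space"
  assumes "smooth_on UNIV f" "\<And>y. f y \<in> S" shows "D f y v \<in> tangent_space S (f y)"
proof -
  let ?\<gamma> = "\<lambda>t::real. f (y + t *\<^sub>R v)"
  have "smooth_on UNIV (\<lambda>t::real. y + t *\<^sub>R v)"
    by (intro smooth_on_add smooth_on_const smooth_on_bounded_linear bounded_linear_scaleR_left) auto
  from smooth_on_compose[OF open_UNIV open_UNIV _ this assms(1)] have sm: "smooth_on UNIV ?\<gamma>" by simp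
  have "((\<lambda>t::real. y + t *\<^sub>R v) has_derivative (\<lambda>t. 0 + t *\<^sub>R v)) (at 0)"
    by (intro has_derivative_add has_derivative_const has_derivative_scaleR_left has_derivative_ident)
  then have "((f \<circ> (\<lambda>t::real. y + t *\<^sub>R v)) has_derivative (D f y \<circ> (\<lambda>t. 0 + t *\<^sub>R v))) (at 0)"
    using smooth_on_derivative[OF assms(1), of y] by (intro diff_chain_at) auto
  then have "(?\<gamma> has_vector_derivative D f y v) (at 0)"
    using linear_scale[OF linear_D[OF assms(1)]] by (simp add: has_vector_derivative_def o_def)
  then show ?thesis
    unfolding tangent_space_def using smooth_on_subset[OF sm] assms(2)
    by (intro CollectI exI[of _ ?\<gamma>] exI[of _ 1]) auto
qed

lemma dim_kernel:
  fixes f :: "'a::euclidean_space \<Rightarrow> 'b::euclidean_space"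
  assumes "linear f" "surj f" shows "dim {x. f x = 0} + DIM('b) = DIM('a)"
proof -
  obtain s where s: "linear s" "f \<circ> s = id" using linear_surjective_right_inverse[OF assms] by blast
  have fs: "f (s z) = z" for z using s(2) by (metis comp_apply id_apply)
  have "dim (range s) = DIM('b)"
    using dim_image_eq[of s UNIV] s(1) fs by (metis dim_UNIV inj_on_subset injI subset_UNIV span_UNIV)
  moreover have "{x. f x = 0} \<inter> range s = {0}"
  proof (intro equalityI subsetI)
    fix x assume "x \<in> {x. f x = 0} \<inter> range s"
    then show "x \<in> {0}" using fs linear_0[OF s(1)] by auto
  next
    fix x :: 'a assume "x \<in> {0}"
    then show "x \<in> {x. f x = 0} \<inter> range s"
      using linear_0[OF s(1)] linear_0[OF assms(1)] by (auto intro: image_eqI[of _ _ 0])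
  qed
  moreover have "{x + y | x y. x \<in> {x. f x = 0} \<and> y \<in> range s} = UNIV"
  proof -
    have "z = (z - s (f z)) + s (f z)" "f (z - s (f z)) = 0" for z by (simp_all add: linear_diff[OF assms(1)] fs)
    then show ?thesis by blast
  qed
  moreover have "subspace {x. f x = 0}" by (rule linear_subspace_kernel[OF assms(1)])
  moreover have "subspace (range s)" using linear_subspace_image[OF s(1) subspace_UNIV] .
  ultimately show ?thesis using dim_sums_Int[of "{x. f x = 0}" "range s"] by simp
qed

lemma slice_chart:
  assumes "a \<noteq> 0" "q0 \<in> Sp" "phi a (proj q0) = 0"
  shows "\<exists>(U, c)\<in>SpU_atlas. proj q0 \<in> U \<and> (\<exists>N. subspace N \<and> dim N + 2 = DIM('n::finite model) \<and>
    c ` (U \<inter> {p \<in> SpU. phi a p = 0}) = c ` U \<inter> (N :: 'n model set))"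
proof -
  obtain L :: "'n model \<Rightarrow> 'n cmat2" where L: "linear L" "inj L" "range L = imag_part"
    by (rule imag_part_coordinates)
  have Lim: "L y \<in> imag_part" for y using L(3) by blast
  have Llie: "range L \<subseteq> lie" using L(3) by (auto simp: imag_part_def)
  define j where "j = (\<lambda>y. q0 ** L y ** transpose q0)"
  have linj: "linear j"
    unfolding j_def using linear_compose[OF L(1) bounded_linear.linear[OF bounded_linear_conj]] by (simp add: o_def)
  have "inj j" using L(2) conj_cancel(1)[OF assms(2)] unfolding j_def inj_def by metis
  then obtain \<Theta> where \<Theta>: "linear \<Theta>" "\<Theta> \<circ> j = id" using linear_injective_left_inverse[OF linj] by blast
  have \<Theta>j: "\<Theta> (j y) = y" for y using \<Theta>(2) by (metis comp_apply id_apply)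
  interpret isotropic "transpose q0 *v a"
    using isotropic_fibre[OF assms(1,2)] assms(3) by (simp add: phi_eq)
  let ?l0 = "\<lambda>y. qf a (j y)"
  have linl0: "linear ?l0" using linear_compose[OF linj linear_qf] by (simp add: o_def)
  have surjl0: "surj ?l0"
  proof -
    have "\<exists>y. ?l0 y = \<zeta>" for \<zeta>
    proof -
      obtain X where X: "X \<in> imag_part" "qf (transpose q0 *v a) X = \<zeta>" using surj_qf by blast
      then obtain y where "X = L y" using L(3) by blast
      then show ?thesis using X(2) unfolding j_def qf_conj by blast
    qed
    then show ?thesis by (metis surj_def)
  qed
  obtain s where s: "linear s" "?l0 \<circ> s = id" using linear_surjective_right_inverse[OF linl0 surjl0] by blast
  have ls: "qf a (j (s z)) = z" for z using s(2) by (metis comp_apply id_apply)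
  define \<Phi> where "\<Phi> = (\<lambda>P. \<Theta> P + s (qf a P - ?l0 (\<Theta> P)))"
  have lin\<Phi>: "linear \<Phi>"
    unfolding \<Phi>_def
    by (intro linear_compose_add \<Theta>(1) linear_compose[OF _ s(1), unfolded o_def] linear_compose_sub linear_qf
        linear_compose[OF \<Theta>(1) linl0, unfolded o_def])
  have bl\<Phi>: "bounded_linear \<Phi>" using lin\<Phi> linear_conv_bounded_linear by blast
  have \<Phi>j: "\<Phi> (j y) = y" for y by (simp add: \<Phi>_def \<Theta>j linear_0[OF s(1)])
  have l\<Phi>: "?l0 (\<Phi> P) = qf a P" for P by (simp add: \<Phi>_def linear_add[OF linl0, simplified] ls)
  let ?N = "{y. ?l0 y = 0}"

  have lin\<Lambda>: "linear (\<lambda>Y. \<Phi> (q0 ** Y ** transpose q0))"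
    using linear_compose[OF bounded_linear.linear[OF bounded_linear_conj] lin\<Phi>] by (simp add: o_def)
  obtain e where e: "e > 0" "\<And>k k'. k \<in> Sp \<Longrightarrow> k' \<in> Sp \<Longrightarrow> norm (k ** transpose k - mat 1) < e \<Longrightarrow>
    norm (k' ** transpose k' - mat 1) < e \<Longrightarrow>
    \<Phi> (q0 ** (k ** transpose k) ** transpose q0) = \<Phi> (q0 ** (k' ** transpose k') ** transpose q0) \<Longrightarrow>
    k ** transpose k = k' ** transpose k'"
    by (rule secant[OF lin\<Lambda> L(1,3)]) (use \<Phi>j in \<open>auto simp: j_def\<close>)
  \<comment> \<open>Conjugation by \<open>q0\<close> moves the base point to the identity, where
    \<open>secant\<close> applies.\<close>
  define near :: "'n cmat2 \<Rightarrow> bool" where "near q \<longleftrightarrow> norm (adj q0 ** (q ** transpose q) ** cj q0 - mat 1) < e" for q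
  have secant: "q ** transpose q = r ** transpose r" if qr: "q \<in> Sp" "r \<in> Sp" "near q" "near r"
    "\<Phi> (q ** transpose q) = \<Phi> (r ** transpose r)" for q r
  proof -
    let ?k = "adj q0 ** q" and ?k' = "adj q0 ** r"
    have kk: "(adj q0 ** p) ** transpose (adj q0 ** p) = adj q0 ** (p ** transpose p) ** cj q0" for p
      by (simp add: matrix_transpose_mul matrix_mul_assoc adj_def)
    have "?k ** transpose ?k = ?k' ** transpose ?k'"
      by (rule e(2)) (use qr in \<open>simp_all add: Sp_mult Sp_adj assms(2) kk near_def conj_cancel(2)[OF assms(2)] del: transpose_simps\<close>)
    then have "adj q0 ** (q ** transpose q) ** cj q0 = adj q0 ** (r ** transpose r) ** cj q0" unfolding kk .
    then show ?thesis using conj_cancel(2)[OF assms(2)] by metis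
  qed

  define \<sigma> where "\<sigma> = (\<lambda>y. q0 ** cay (L y))"
  have sm: "smooth_on UNIV \<sigma>" and Sp: "\<sigma> y \<in> Sp" and \<sigma>0: "\<sigma> 0 = q0"
    and d\<sigma>: "(\<sigma> has_derivative (\<lambda>v. q0 ** (2 *\<^sub>R L v))) (at 0)" for y
    using cay_parametrisation[OF assms(2) L(1) Llie] by (simp_all add: \<sigma>_def)
  define F where "F = (\<lambda>q :: 'n cmat2. \<Phi> (q ** transpose q))"
  have smF: "smooth_on UNIV F"
    unfolding F_def
    by (rule smooth_on_linear_comp[OF bl\<Phi> open_UNIV smooth_square[OF open_UNIV smooth_on_bounded_linear[OF bounded_linear_ident]]])
  define G where "G = (\<lambda>y. F (\<sigma> y))"
  have smG: "smooth_on UNIV G"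
    unfolding G_def by (rule smooth_on_compose[OF open_UNIV open_UNIV _ sm smF]) simp
  \<comment> \<open>One factor 2 is the differential of the Cayley transform, the other comes from
    the two equal terms in the derivative of q q^t.\<close>
  have DG: "D G 0 v = 4 *\<^sub>R v" for v
  proof -
    have "(G has_derivative (\<lambda>v. \<Phi> (\<sigma> 0 ** transpose (q0 ** (2 *\<^sub>R L v)) + q0 ** (2 *\<^sub>R L v) ** transpose (\<sigma> 0)))) (at 0)"
      unfolding G_def F_def by (rule bounded_linear.has_derivative[OF bl\<Phi> has_derivative_square[OF d\<sigma>]])
    then have "D G 0 v = \<Phi> (\<sigma> 0 ** transpose (q0 ** (2 *\<^sub>R L v)) + q0 ** (2 *\<^sub>R L v) ** transpose (\<sigma> 0))"
      by (simp add: D_eqI)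
    also have "\<sigma> 0 ** transpose (q0 ** (2 *\<^sub>R L v)) + q0 ** (2 *\<^sub>R L v) ** transpose (\<sigma> 0) = 4 *\<^sub>R j v"
      using Lim[of v] by (simp add: \<sigma>0 j_def matrix_transpose_mul imag_part_iff transpose_scalar mm_simps matrix_mul_assoc
         flip: scaleR_left_distrib)
    finally show ?thesis by (simp add: linear_scale[OF lin\<Phi>] \<Phi>j)
  qed
  have cont_square: "continuous_on UNIV (\<lambda>q :: 'n cmat2. q ** transpose q)"
    by (rule smooth_on_imp_continuous_on[OF smooth_square[OF open_UNIV smooth_on_bounded_linear[OF bounded_linear_ident]]])
  have open_near: "open {q. near q}"
  proof -
    have "continuous_on UNIV (\<lambda>q :: 'n cmat2. norm (adj q0 ** (q ** transpose q) ** cj q0 - mat 1))"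
      by (intro continuous_intros bounded_linear.continuous_on[OF bounded_linear_conj] cont_square)
    then show ?thesis unfolding near_def by (intro open_Collect_less continuous_on_const)
  qed
  define W0 where "W0 = \<sigma> -` {q. near q}"
  have W0: "open W0" unfolding W0_def by (rule open_vimage[OF open_near smooth_on_imp_continuous_on[OF sm]])
  have "near q0"
  proof -
    have "adj q0 ** (q0 ** transpose q0) ** cj q0 = (adj q0 ** q0) ** (transpose q0 ** cj q0)" by (simp only: matrix_mul_assoc)
    then show ?thesis using e(1) by (simp add: near_def SpD[OF assms(2)])
  qed
  then have W00: "0 \<in> W0" by (simp add: W0_def \<sigma>0)
  have inj: "inj (D G 0)" unfolding DG inj_def by simp
  obtain W V g where *: "open W" "W \<subseteq> W0" "0 \<in> W" "open V" "G ` W = V"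
    "\<And>x. x \<in> W \<Longrightarrow> g (G x) = x" "g ` V = W" "\<And>y. y \<in> V \<Longrightarrow> G (g y) = y" "smooth_on V g" "\<And>x. x \<in> W \<Longrightarrow> bij (D G x)"
    by (rule smooth_inverse_function[OF W0 smooth_on_subset[OF smG subset_UNIV] W00 inj]) (rule that; assumption)
  define U where "U = proj ` \<sigma> ` W"
  define c where "c = (\<lambda>p. \<Phi> (emb p))"
  have c_proj: "c (proj q) = F q" for q by (simp add: c_def F_def emb_proj)
  \<comment> \<open>\<open>U\<close> is built from the section, but openness in the quotient
    concerns all representatives. The secant estimate shows that every near \<open>q\<close> with
    coordinates in \<open>V\<close> lies over the section.\<close>
  have U_iff: "proj q \<in> U \<longleftrightarrow> near q \<and> F q \<in> V" if q: "q \<in> Sp" for q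
  proof
    assume "proj q \<in> U"
    then obtain y where y: "y \<in> W" "proj q = proj (\<sigma> y)" by (auto simp: U_def)
    then have "q ** transpose q = \<sigma> y ** transpose (\<sigma> y)" using proj_eq_iff[OF q Sp] by blast
    then show "near q \<and> F q \<in> V" using y(1) *(2,5) by (auto simp: near_def W0_def F_def G_def)
  next
    assume n: "near q \<and> F q \<in> V"
    then obtain y where y: "y \<in> W" "F q = F (\<sigma> y)" using *(5) by (auto simp: G_def)
    then have "q ** transpose q = \<sigma> y ** transpose (\<sigma> y)"
      using n *(2) by (intro secant q Sp) (auto simp: W0_def F_def)
    then have "proj q = proj (\<sigma> y)" using proj_eq_iff[OF q Sp] by blast
    then show "proj q \<in> U" using y(1) unfolding U_def by blast
  qed
  have cU: "c ` U = V" using *(5) by (simp add: U_def image_image c_proj G_def)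
  have USp: "U \<subseteq> SpU" using Sp by (auto simp: U_def SpU_def)
  have openU: "openin SpU_topology U"
  proof -
    have "{q \<in> Sp. proj q \<in> U} = Sp \<inter> ({q. near q} \<inter> F -` V)" using U_iff by auto
    moreover have "open (F -` V)" by (rule open_vimage[OF *(4) smooth_on_imp_continuous_on[OF smF]])
    ultimately show ?thesis unfolding openin_SpU openin_open using USp open_near by blast
  qed
  have top: "topspace (subtopology SpU_topology U) = U" using USp by (simp add: topspace_SpU Int_absorb1)
  have cont_c: "continuous_map SpU_topology euclidean c"
    unfolding continuous_map_def topspace_SpU
  proof (intro conjI allI impI)
    fix X :: "'n model set" assume "openin euclidean X"
    then have "open (F -` X)" using open_vimage[OF _ smooth_on_imp_continuous_on[OF smF]] by simp
    moreover have "{q \<in> Sp. proj q \<in> {p \<in> SpU. c p \<in> X}} = Sp \<inter> F -` X" by (auto simp: c_proj SpU_def)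
    ultimately show "openin SpU_topology {p \<in> SpU. c p \<in> X}" unfolding openin_SpU openin_open by blast
  qed simp
  have cg: "proj (\<sigma> (g (c p))) = p" if "p \<in> U" for p
    using that *(6) by (auto simp: U_def c_proj G_def)
  have gc: "c (proj (\<sigma> (g y))) = y" if "y \<in> V" for y using *(8)[OF that] by (simp add: c_proj G_def)
  have homeo: "homeomorphic_map (subtopology SpU_topology U) (top_of_set (c ` U)) c"
    unfolding homeomorphic_map_maps cU
  proof
    have "continuous_on V (\<lambda>y. \<sigma> (g y))"
      using smooth_on_imp_continuous_on[OF smooth_on_compose[OF *(4) open_UNIV _ *(9) sm]] by simp
    then have "continuous_map (top_of_set V) (top_of_set Sp) (\<lambda>y. \<sigma> (g y))"
      using Sp by (simp add: continuous_map_in_subtopology image_subset_iff)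
    from continuous_map_compose[OF this continuous_map_proj]
    have "continuous_map (top_of_set V) SpU_topology (\<lambda>y. proj (\<sigma> (g y)))" by (simp add: o_def)
    moreover have "proj (\<sigma> (g y)) \<in> U" if "y \<in> V" for y using *(7) that by (auto simp: U_def)
    moreover have "continuous_map (subtopology SpU_topology U) (top_of_set V) c"
      using continuous_map_from_subtopology[OF cont_c, of U] cU top by (auto simp: continuous_map_in_subtopology)
    ultimately show "homeomorphic_maps (subtopology SpU_topology U) (top_of_set V) c (\<lambda>y. proj (\<sigma> (g y)))"
      unfolding homeomorphic_maps_def top by (auto simp: continuous_map_in_subtopology cg gc)
  qed
  have smc: "smooth_on_subset {q \<in> Sp. proj q \<in> U} (c \<circ> proj)"
    unfolding smooth_on_subset_def using smF c_proj by (intro ballI exI[of _ UNIV] exI[of _ F]) auto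
  have dF: "(F has_derivative D F q) (at q)" for q using smooth_on_derivative[OF smF] by simp
  have submersion: "dproj c q ` tangent_space Sp q = UNIV" if q: "q \<in> Sp" "proj q \<in> U" for q
  proof -
    obtain y where y: "y \<in> W" "proj q = proj (\<sigma> y)" using q(2) by (auto simp: U_def)
    then have "q \<in> proj (\<sigma> y)" using self_in_proj by metis
    then obtain k where k: "q = \<sigma> y ** k" "k \<in> Ugroup" unfolding proj_def by blast
    \<comment> \<open>An arbitrary representative need not lie on the section. Right translation by
      \<open>k\<close> yields a section through \<open>q\<close> with the same coordinates, so
      \<open>D G y\<close> transfers to it.\<close>
    let ?f = "\<lambda>z. \<sigma> z ** k"
    have smf: "smooth_on UNIV ?f"
      by (rule smooth_on_linear_comp[OF mm.bounded_linear_left open_UNIV sm])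
    have fSp: "?f z \<in> Sp" for z using Sp k(2) by (simp add: Ugroup_iff Sp_mult)
    have Ff: "F (?f z) = G z" for z using proj_mult[OF k(2), of "\<sigma> z"] c_proj unfolding G_def by metis
    have "((F \<circ> ?f) has_derivative (D F q \<circ> D ?f y)) (at y)"
      using smooth_on_derivative[OF smf, of y] dF k(1) by (intro diff_chain_at) auto
    then have DFf: "D F q (D ?f y v) = D G y v" for v unfolding o_def Ff by (simp add: D_eqI)
    have "((c \<circ> proj) has_derivative D F q) (at q within Sp)"
      using has_derivative_at_withinI[OF dF] by (simp add: o_def c_proj)
    moreover from this have "((c \<circ> proj) has_derivative dproj c q) (at q within Sp)"
      unfolding dproj_def using frechet_derivative_works differentiable_def by blast
    ultimately have dp: "dproj c q Z = D F q Z" if "Z \<in> tangent_space Sp q" for Z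
      using derivative_within_unique that by blast
    have "v \<in> dproj c q ` tangent_space Sp q" for v
    proof -
      obtain u where u: "v = D G y u" using *(10)[OF y(1)] by (metis bij_pointE)
      have t: "D ?f y u \<in> tangent_space Sp q" using curve_tangent[OF smf fSp, of y u] k(1) by simp
      have "v = dproj c q (D ?f y u)" unfolding dp[OF t] DFf by (rule u)
      then show ?thesis using t by blast
    qed
    then show ?thesis by blast
  qed
  have "(U, c) \<in> SpU_atlas"
    unfolding SpU_atlas_def using openU homeo smc submersion *(4) cU by auto
  moreover have "proj q0 \<in> U" using *(3) \<sigma>0 by (auto simp: U_def image_iff)
  moreover have "subspace ?N" by (rule linear_subspace_kernel[OF linl0])
  moreover have "dim ?N + 2 = DIM('n model)" using dim_kernel[OF linl0 surjl0] by simp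
  moreover have "c ` (U \<inter> {p \<in> SpU. phi a p = 0}) = c ` U \<inter> ?N"
  proof -
    have "phi a p = ?l0 (c p)" if p: "p \<in> SpU" for p
    proof -
      obtain q where "p = proj q" using p by (auto simp: SpU_def)
      then show ?thesis using l\<Phi>[of "q ** transpose q"] by (simp add: phi_eq c_proj F_def)
    qed
    then show ?thesis using USp by auto
  qed
  ultimately show ?thesis by blast
qed

section \<open>Compactness of the fibre and conclusion\<close>

lemma compact_Sp: "compact (Sp :: 'n::finite cmat2 set)"
proof -
  have "norm q = norm (mat 1 :: 'n cmat2)" if "q \<in> Sp" for q :: "'n cmat2"
    using inner_mult_left[of q "mat 1" q] SpD(1)[OF that] by (simp add: norm_eq_sqrt_inner)
  then have "bounded (Sp :: 'n cmat2 set)" unfolding bounded_iff by (metis order_refl)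
  moreover have "closed (Sp :: 'n cmat2 set)"
  proof -
    have adj: "bounded_linear (adj :: 'n cmat2 \<Rightarrow> _)" using linear_adj linear_conv_bounded_linear by blast
    have "continuous_on UNIV (\<lambda>q :: 'n cmat2. adj q ** q)"
      by (intro mm.continuous_on bounded_linear.continuous_on[OF adj] continuous_on_id)
    moreover have "continuous_on UNIV (\<lambda>q :: 'n cmat2. J ** cj q)" "continuous_on UNIV (\<lambda>q :: 'n cmat2. q ** J)"
      by (intro mm.continuous_on bounded_linear.continuous_on[OF bounded_linear_cj] continuous_on_id continuous_on_const)+
    ultimately have "closed ({q :: 'n cmat2. adj q ** q = mat 1} \<inter> {q. J ** cj q = q ** J})"
      by (intro closed_Int closed_Collect_eq continuous_on_const)
    moreover have "Sp = {q :: 'n cmat2. adj q ** q = mat 1} \<inter> {q. J ** cj q = q ** J}"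
      by (auto simp: Sp_iff quat_def)
    ultimately show ?thesis by simp
  qed
  ultimately show ?thesis by (simp add: compact_eq_bounded_closed)
qed

lemma compact_fibre:
  fixes a :: "complex ^ ('n::finite + 'n)"
  shows "compactin SpU_topology {p \<in> SpU. phi a p = 0}"
proof -
  have bl: "bounded_linear (qf a)" using linear_qf linear_conv_bounded_linear by blast
  have "continuous_on UNIV (\<lambda>q :: 'n cmat2. q ** transpose q)"
    by (rule smooth_on_imp_continuous_on[OF smooth_square[OF open_UNIV smooth_on_bounded_linear[OF bounded_linear_ident]]])
  then have "continuous_on UNIV (\<lambda>q :: 'n cmat2. qf a (q ** transpose q))" by (rule bounded_linear.continuous_on[OF bl])
  then have "closed {q :: 'n cmat2. qf a (q ** transpose q) = 0}"
    by (intro closed_Collect_eq continuous_on_const)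
  then have "compact (Sp \<inter> {q. qf a (q ** transpose q) = 0})" using compact_Sp compact_Int_closed by blast
  then have "compactin (top_of_set Sp) (Sp \<inter> {q. qf a (q ** transpose q) = 0})" by (simp add: compactin_subtopology)
  then have "compactin SpU_topology (proj ` (Sp \<inter> {q. qf a (q ** transpose q) = 0}))"
    using continuous_map_proj by (rule image_compactin)
  moreover have "proj ` (Sp \<inter> {q. qf a (q ** transpose q) = 0}) = {p \<in> SpU. phi a p = 0}"
    by (auto simp: SpU_def phi_eq)
  ultimately show ?thesis by simp
qed

theorem theorem2p2:
  fixes a :: "complex ^ ('n::finite + 'n)"
  assumes "a \<noteq> 0"
  shows "regular_value SpU_atlas SpU (phi a) 0 \<and>
    compactin SpU_topology {p \<in> SpU. phi a p = 0} \<and>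
    submanifold_of_codim SpU_atlas SpU 2 {p \<in> SpU. phi a p = 0} \<and>
    minimal SpU_atlas SpU_metric {p \<in> SpU. phi a p = 0}"
proof (intro conjI)
  show "regular_value SpU_atlas SpU (phi a) 0"
    unfolding regular_value_def smooth_map_def
  proof (intro conjI ballI impI; clarify?)
    fix U and c :: "'n cmat2 set \<Rightarrow> 'n model" assume "(U, c) \<in> SpU_atlas"
    then interpret SpU_chart U c by unfold_locales
    have bl: "bounded_linear (qf a)" using linear_qf linear_conv_bounded_linear by blast
    have "smooth_on \<Omega> (phi a \<circ> inv_into U c)"
      by (rule smooth_on_cong[OF open_\<Omega> smooth_on_linear_comp[OF bl open_\<Omega> smooth_\<psi>]]) (simp add: phi_inv)
    then show "smooth_on (c ` U) (phi a \<circ> inv_into U c)" by (simp add: \<Omega>_def)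
    fix p assume p: "p \<in> U" "phi a p = 0"
    then have x: "c p \<in> \<Omega>" by (simp add: \<Omega>_def)
    have "D (phi a \<circ> inv_into U c) (c p) = D (\<lambda>y. qf a (\<psi> y)) (c p)"
      by (rule D_cong[OF open_\<Omega> x]) (simp add: phi_inv)
    also have "\<dots> = (\<lambda>u. qf a (D \<psi> (c p) u))"
      using D_linear_comp[OF bl smooth_on_differentiable[OF smooth_\<psi> x]] by blast
    finally show "surj (D (phi a \<circ> inv_into U c) (c p))"
      using regular_fibre[OF assms x] phi_inv[OF x, of a] p by (simp add: inv_c)
  qed
  show "submanifold_of_codim SpU_atlas SpU 2 {p \<in> SpU. phi a p = 0}"
    unfolding submanifold_of_codim_def
  proof (intro conjI ballI)
    fix p assume p: "p \<in> {p \<in> SpU. phi a p = 0}"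
    then obtain q where "q \<in> Sp" "p = proj q" by (auto simp: SpU_def)
    then show "\<exists>(U, c)\<in>SpU_atlas. p \<in> U \<and> (\<exists>L. subspace L \<and> dim L + 2 = DIM('n model) \<and>
        c ` (U \<inter> {p \<in> SpU. phi a p = 0}) = c ` U \<inter> L)"
      using slice_chart[OF assms] p by blast
  qed blast
  show "minimal SpU_atlas SpU_metric {p \<in> SpU. phi a p = 0}"
    unfolding minimal_def
  proof (intro ballI; clarify)
    fix p U and c :: "'n cmat2 set \<Rightarrow> 'n model"
    assume "(U, c) \<in> SpU_atlas" and p: "p \<in> U" "phi a p = 0"
    then interpret SpU_chart U c by unfold_locales
    show "mean_curvature (SpU_metric (U, c)) (c ` (U \<inter> {p \<in> SpU. phi a p = 0})) (c p) = 0"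
      by (rule mean_curvature_fibre[OF assms p])
  qed
qed (rule compact_fibre)


end
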